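(* Let $N\ge 1$, let $\Omega\subset\mathbb{R}^N$ be a bounded open set, and let $A\in (L^\infty(\Omega))^{N\times N}$ and $\alpha>0$ be such that $A(x)\xi\cdot\xi\ge\alpha|\xi|^2$ for a.e. $x\in\Omega$ and all $\xi\in\mathbb{R}^N$. Let $F:\Omega\times[0,+\infty)\to[0,+\infty]$ be a Carathéodory function (i.e. $x\mapsto F(x,s)$ is measurable for every $s\in[0,+\infty)$, and for a.e. $x\in\Omega$ the map $s\mapsto F(x,s)\in[0,+\infty]$ is continuous on $[0,+\infty)$) such that $$0\le F(x,s)\le \frac{h(x)}{\Gamma(s)}\quad\text{for a.e. } x\in\Omega,\ \forall s>0,$$ where $h\ge 0$ a.e., $h\in L^r(\Omega)$ with $r=\frac{2N}{N+2}$ if $N\ge3$, $r>1$ if $N=2$, $r=1$ if $N=1$, and where $\Gamma:[0,+\infty)\to[0,+\infty)$ is of class $C^1([0,+\infty))$ with $\Gamma(0)=0$ and $\Gamma'(s)>0$ for all $s>0$. Define $\beta:[0,+\infty)\to[0,+\infty)$ by $\beta(s)=\int_0^s\sqrt{\Gamma'(t)}\,dt$. Then every solution $u$, in the sense of the definition given in the context, to the problem $u\ge 0$, $-\operatorname{div}A(x)Du=F(x,u)$ in $\Omega$, $u=0$ on $\partial\Omega$ satisfies $$\beta(u)\in H_0^1(\Omega)\qquad\text{and}\qquad \alpha\,\|D\beta(u)\|^2_{(L^2(\Omega))^N}\le\|h\|_{L^1(\Omega)}.$$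
   Context: All functions are real-valued unless otherwise said; $D$ denotes the gradient, ${}^tA$ the transpose of $A$, $\mathcal{D}(\Omega)=C_c^\infty(\Omega)$, $\mathcal{D}'(\Omega)$ the distributions on $\Omega$; no regularity of $\partial\Omega$ is assumed. For $k>0$ and $s\in\mathbb{R}$: $T_k(s)=\max\{-k,\min\{s,k\}\}$, $G_k(s)=s-T_k(s)$. Test functions. For $\hat\varphi\in H_0^1(\Omega)\cap L^\infty(\Omega)$ and $\hat g\in(L^2(\Omega))^N$, the distribution $\hat\varphi(-\operatorname{div}\hat g)$ is defined by $\langle\hat\varphi(-\operatorname{div}\hat g),\phi\rangle=\int_\Omega\hat g\cdot D(\hat\varphi\phi)$ for $\phi\in\mathcal{D}(\Omega)$. The space $\mathcal{V}(\Omega)$ is the set of $v\in H_0^1(\Omega)\cap L^\infty(\Omega)$ for which there exist a finite set $I$, functions $\hat\varphi_i\in H_0^1(\Omega)\cap L^\infty(\Omega)$, $\hat g_i\in(L^2(\Omega))^N$ ($i\in I$) and $\hat f\in L^1(\Omega)$ such that $$-\operatorname{div}\,{}^tA(x)Dv=\sum_{i\in I}\hat\varphi_i(-\operatorname{div}\hat g_i)+\hat f\quad\text{in }\mathcal{D}'(\Omega).\qquad( * )$$ Definition of solution. A function $u$ is a solution to the problem $u\ge0$, $-\operatorname{div}A(x)Du=F(x,u)$ in $\Omega$, $u=0$ on $\partial\Omega$ if: (1) $u\in L^2(\Omega)\cap H^1_{\rm loc}(\Omega)$; $u(x)\ge0$ for a.e. $x\in\Omega$; $G_k(u)\in H_0^1(\Omega)$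 for all $k>0$; and $\varphi T_k(u)\in H_0^1(\Omega)$ for all $k>0$ and all $\varphi\in H_0^1(\Omega)\cap L^\infty(\Omega)$; (2) for every $v\in\mathcal{V}(\Omega)$ with $v\ge0$, and every $I,\hat\varphi_i,\hat g_i,\hat f$ as in $( * )$, one has $\int_\Omega F(x,u)v<+\infty$ (with the usual convention $0\cdot\infty=0$ in integrands) and $$\int_\Omega{}^tA(x)Dv\cdot DG_k(u)+\sum_{i\in I}\int_\Omega\hat g_i\cdot D(\hat\varphi_iT_k(u))+\int_\Omega\hat f\,T_k(u)=\int_\Omega F(x,u)v\qquad\forall k>0.$$ *)

theory Defs
  imports "HOL-Analysis.Analysis"
begin

text \<open>Functions on \<open>\<Omega>\<close> are represented by total functions; their values outside \<open>\<Omega>\<close> and on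
  null sets are irrelevant.\<close>

definition Lp :: "real \<Rightarrow> 'a::euclidean_space set \<Rightarrow> ('a \<Rightarrow> 'b::euclidean_space) set" where
  "Lp p \<Omega> = {f. f \<in> borel_measurable (lebesgue_on \<Omega>) \<and>
                integrable (lebesgue_on \<Omega>) (\<lambda>x. norm (f x) powr p)}"

definition Lp_norm :: "real \<Rightarrow> 'a::euclidean_space set \<Rightarrow> ('a \<Rightarrow> 'b::euclidean_space) \<Rightarrow> real" where
  "Lp_norm p \<Omega> f = (LINT x|lebesgue_on \<Omega>. norm (f x) powr p) powr (1 / p)"

definition Linf :: "'a::euclidean_space set \<Rightarrow> ('a \<Rightarrow> real) set" where
  "Linf \<Omega> = {f. f \<in> borel_measurable (lebesgue_on \<Omega>) \<and>
                (\<exists>C. AE x in lebesgue_on \<Omega>. \<bar>f x\<bar> \<le> C)}"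

definition L1_loc :: "'a::euclidean_space set \<Rightarrow> ('a \<Rightarrow> 'b::euclidean_space) set" where
  "L1_loc \<Omega> = {f. \<forall>K. compact K \<and> K \<subseteq> \<Omega> \<longrightarrow> f absolutely_integrable_on K}"

primrec C_k :: "nat \<Rightarrow> ('a::euclidean_space \<Rightarrow> real) \<Rightarrow> bool" where
  "C_k 0 f \<longleftrightarrow> continuous_on UNIV f"
| "C_k (Suc k) f \<longleftrightarrow> (\<exists>g. (\<forall>x. GDERIV f x :> g x) \<and> (\<forall>b\<in>Basis. C_k k (\<lambda>x. g x \<bullet> b)))"

definition test_fun :: "'a::euclidean_space set \<Rightarrow> ('a \<Rightarrow> real) set" where
  "test_fun \<Omega> = {\<phi>. (\<forall>k. C_k k \<phi>) \<and> compact (closure {x. \<phi> x \<noteq> 0}) \<and>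
                     closure {x. \<phi> x \<noteq> 0} \<subseteq> \<Omega>}"

definition weak_gradient ::
  "'a::euclidean_space set \<Rightarrow> ('a \<Rightarrow> real) \<Rightarrow> ('a \<Rightarrow> 'a) \<Rightarrow> bool" where
  "weak_gradient \<Omega> u g \<longleftrightarrow> u \<in> L1_loc \<Omega> \<and> g \<in> L1_loc \<Omega> \<and>
     (\<forall>\<phi>\<in>test_fun \<Omega>. \<forall>\<psi>. (\<forall>x. GDERIV \<phi> x :> \<psi> x) \<longrightarrow>
        (LINT x|lebesgue_on \<Omega>. u x *\<^sub>R \<psi> x) = - (LINT x|lebesgue_on \<Omega>. \<phi> x *\<^sub>R g x))"

text \<open>A representative of the weak gradient, which is unique almost everywhere.  It is unspecified
  if there is no weak gradient, so that \<open>grad\<close> is only meaningful for weakly differentiable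
  functions.\<close>
definition grad :: "'a::euclidean_space set \<Rightarrow> ('a \<Rightarrow> real) \<Rightarrow> 'a \<Rightarrow> 'a" where
  "grad \<Omega> u = (SOME g. weak_gradient \<Omega> u g)"

definition H1 :: "'a::euclidean_space set \<Rightarrow> ('a \<Rightarrow> real) set" where
  "H1 \<Omega> = {u. u \<in> Lp 2 \<Omega> \<and> (\<exists>g. weak_gradient \<Omega> u g \<and> g \<in> Lp 2 \<Omega>)}"

definition H1_norm :: "'a::euclidean_space set \<Rightarrow> ('a \<Rightarrow> real) \<Rightarrow> real" where
  "H1_norm \<Omega> u = sqrt ((Lp_norm 2 \<Omega> u)\<^sup>2 + (Lp_norm 2 \<Omega> (grad \<Omega> u))\<^sup>2)"

definition H10 :: "'a::euclidean_space set \<Rightarrow> ('a \<Rightarrow> real) set" where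
  "H10 \<Omega> = {u. u \<in> H1 \<Omega> \<and> (\<exists>\<phi>. (\<forall>n. \<phi> n \<in> test_fun \<Omega>) \<and>
                  (\<lambda>n::nat. H1_norm \<Omega> (\<lambda>x. u x - \<phi> n x)) \<longlonglongrightarrow> 0)}"

definition H1_loc :: "'a::euclidean_space set \<Rightarrow> ('a \<Rightarrow> real) set" where
  "H1_loc \<Omega> = {u. \<forall>\<omega>. open \<omega> \<and> compact (closure \<omega>) \<and> closure \<omega> \<subseteq> \<Omega> \<longrightarrow> u \<in> H1 \<omega>}"

text \<open>Distributions are given by their action on test functions.\<close>

definition eq_distr ::
  "'a::euclidean_space set \<Rightarrow> (('a \<Rightarrow> real) \<Rightarrow> real) \<Rightarrow> (('a \<Rightarrow> real) \<Rightarrow> real) \<Rightarrow> bool" where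
  "eq_distr \<Omega> S T \<longleftrightarrow> (\<forall>\<phi>\<in>test_fun \<Omega>. S \<phi> = T \<phi>)"

definition fun_distr :: "'a::euclidean_space set \<Rightarrow> ('a \<Rightarrow> real) \<Rightarrow> ('a \<Rightarrow> real) \<Rightarrow> real" where
  "fun_distr \<Omega> f \<phi> = (LINT x|lebesgue_on \<Omega>. f x * \<phi> x)"

definition neg_div :: "'a::euclidean_space set \<Rightarrow> ('a \<Rightarrow> 'a) \<Rightarrow> ('a \<Rightarrow> real) \<Rightarrow> real" where
  "neg_div \<Omega> g \<phi> = (LINT x|lebesgue_on \<Omega>. g x \<bullet> grad \<Omega> \<phi> x)"

text \<open>The distribution \<open>w (- div g)\<close>; here the product \<open>w \<phi>\<close> is in general only weakly
  differentiable.\<close>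
definition mult_neg_div ::
  "'a::euclidean_space set \<Rightarrow> ('a \<Rightarrow> real) \<Rightarrow> ('a \<Rightarrow> 'a) \<Rightarrow> ('a \<Rightarrow> real) \<Rightarrow> real" where
  "mult_neg_div \<Omega> w g \<phi> = (LINT x|lebesgue_on \<Omega>. g x \<bullet> grad \<Omega> (\<lambda>y. w y * \<phi> y) x)"

definition trunc :: "real \<Rightarrow> real \<Rightarrow> real" where
  "trunc k s = max (- k) (min s k)"

definition excess :: "real \<Rightarrow> real \<Rightarrow> real" where
  "excess k s = s - trunc k s"

definition dual_rep ::
  "(real^'n) set \<Rightarrow> (real^'n \<Rightarrow> real^'n^'n) \<Rightarrow> (real^'n \<Rightarrow> real) \<Rightarrow> nat set \<Rightarrow>
    (nat \<Rightarrow> real^'n \<Rightarrow> real) \<Rightarrow> (nat \<Rightarrow> real^'n \<Rightarrow> real^'n) \<Rightarrow> (real^'n \<Rightarrow> real) \<Rightarrow> bool" where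
  "dual_rep \<Omega> A v I \<phi> g f \<longleftrightarrow>
     finite I \<and> (\<forall>i\<in>I. \<phi> i \<in> H10 \<Omega> \<inter> Linf \<Omega>) \<and> (\<forall>i\<in>I. g i \<in> Lp 2 \<Omega>) \<and> f \<in> Lp 1 \<Omega> \<and>
     eq_distr \<Omega> (neg_div \<Omega> (\<lambda>x. transpose (A x) *v grad \<Omega> v x))
       (\<lambda>\<psi>. (\<Sum>i\<in>I. mult_neg_div \<Omega> (\<phi> i) (g i) \<psi>) + fun_distr \<Omega> f \<psi>)"

definition V_space :: "(real^'n) set \<Rightarrow> (real^'n \<Rightarrow> real^'n^'n) \<Rightarrow> (real^'n \<Rightarrow> real) set" where
  "V_space \<Omega> A = {v. v \<in> H10 \<Omega> \<inter> Linf \<Omega> \<and> (\<exists>I \<phi> g f. dual_rep \<Omega> A v I \<phi> g f)}"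

text \<open>The integral of \<open>F(x,u) v\<close> is taken in \<open>[0,\<infinity>]\<close>, where \<open>0 * \<infinity> = 0\<close>.\<close>
definition is_solution ::
  "(real^'n) set \<Rightarrow> (real^'n \<Rightarrow> real^'n^'n) \<Rightarrow> (real^'n \<Rightarrow> real \<Rightarrow> ennreal) \<Rightarrow>
    (real^'n \<Rightarrow> real) \<Rightarrow> bool" where
  "is_solution \<Omega> A F u \<longleftrightarrow>
     u \<in> Lp 2 \<Omega> \<inter> H1_loc \<Omega> \<and>
     (AE x in lebesgue_on \<Omega>. 0 \<le> u x) \<and>
     (\<forall>k>0. (\<lambda>x. excess k (u x)) \<in> H10 \<Omega>) \<and>
     (\<forall>k>0. \<forall>w \<in> H10 \<Omega> \<inter> Linf \<Omega>. (\<lambda>x. w x * trunc k (u x)) \<in> H10 \<Omega>) \<and>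
     (\<forall>v \<in> V_space \<Omega> A. (AE x in lebesgue_on \<Omega>. 0 \<le> v x) \<longrightarrow>
       (\<forall>I \<phi> g f. dual_rep \<Omega> A v I \<phi> g f \<longrightarrow>
          (\<integral>\<^sup>+x. F x (u x) * ennreal (v x) \<partial>lebesgue_on \<Omega>) < \<infinity> \<and>
          (\<forall>k>0.
             (LINT x|lebesgue_on \<Omega>.
                (transpose (A x) *v grad \<Omega> v x) \<bullet> grad \<Omega> (\<lambda>y. excess k (u y)) x)
             + (\<Sum>i\<in>I. LINT x|lebesgue_on \<Omega>. g i x \<bullet> grad \<Omega> (\<lambda>y. \<phi> i y * trunc k (u y)) x)
             + (LINT x|lebesgue_on \<Omega>. f x * trunc k (u x))
             = enn2real (\<integral>\<^sup>+x. F x (u x) * ennreal (v x) \<partial>lebesgue_on \<Omega>))))"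

end

theory Submission
  imports Defs
begin

text \<open>
  Tested with \<open>\<Gamma>(u)\<close>, the equation would give
  \<open>\<alpha> \<integral> \<Gamma>'(u) |Du|\<^sup>2 \<le> \<integral> A Du \<bullet> D\<Gamma>(u) = \<integral> F(x,u) \<Gamma>(u) \<le> \<integral> h\<close>, and \<open>|D\<beta>(u)|\<^sup>2 = \<Gamma>'(u) |Du|\<^sup>2\<close> because
  \<open>\<beta>'\<^sup>2 = \<Gamma>'\<close>.  However, \<open>\<Gamma>(u)\<close> need not be an admissible test function, since \<open>u\<close> is controlled in
  \<open>H\<^sub>0\<^sup>1\<close> only away from its zero set, and \<open>\<Gamma>(u)\<close> may be unbounded.

  Therefore \<open>\<beta>'\<close> is multiplied by a cutoff with compact support in \<open>(0,\<infinity>)\<close>.  Let \<open>\<rho>\<close> be the product,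
  vanishing below \<open>2 \<delta>\<close>, and let \<open>b\<close> and \<open>K\<close> be the antiderivatives of
  \<open>\<rho>\<close> and \<open>\<rho>\<^sup>2\<close> that vanish at \<open>0\<close>.
  Then \<open>v = K(u)\<close> is a bounded \<open>C\<^sup>1\<close> function of \<open>G\<^sub>\<delta>(u) \<in> H\<^sub>0\<^sup>1\<close>, and it is admissible:
  with a step function \<open>\<phi>\<close> of \<open>u\<close> that is one where \<open>u \<ge> 2 \<delta>\<close> and zero where \<open>u \<le> \<delta>\<close>, the
  distribution \<open>-div \<^sup>tA Dv\<close> equals \<open>\<phi> (-div \<^sup>tA Dv)\<close>.  At the level \<open>k = \<delta>\<close> the contribution of
  \<open>\<phi> T\<^sub>k(u) = \<delta> \<phi>\<close> to the equation disappears (\<open>energy_identity\<close>), and what remains is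
  \<open>\<alpha> \<integral> \<rho>(u)\<^sup>2 |DG\<^sub>\<delta>(u)|\<^sup>2 \<le> \<integral> F(x,u) K(u) \<le> \<integral> h\<close> (\<open>energy_estimate\<close>), that is, a bound for \<open>D(b(u))\<close>.

  Finally the cutoff tends to one.  Since weak gradients are unique, the gradients of the functions
  \<open>b\<^sub>j(u)\<close> become stationary at almost every point, so that Fatou's lemma keeps the bound and
  dominated convergence gives their strong convergence in \<open>L\<^sup>2\<close>; the Poincare inequality and the same two
  convergence theorems give \<open>b\<^sub>j(u) \<rightarrow> \<beta>(u)\<close> in \<open>L\<^sup>2\<close>.  As \<open>H\<^sub>0\<^sup>1\<close> is closed, it contains \<open>\<beta>(u)\<close>.

  The calculus in \<open>H\<^sub>0\<^sup>1\<close> that this uses rests on polynomials instead of mollifiers.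
  Polynomials without constant term map test functions to test functions, and they approximate
  \<open>C\<^sup>1\<close> functions on the bounded range of a test function: this gives
  the chain rule (\<open>H10_pair_chain\<close>).  A polynomial times a bump function is a test
  function: with the Stone-Weierstrass theorem this gives the uniqueness of weak gradients
  (\<open>weak_gradient_unique\<close>).
\<close>

section \<open>Smooth functions and test functions\<close>

lemma GDERIV_isCont: "GDERIV f x :> D \<Longrightarrow> isCont f x"
  unfolding gderiv_def by (rule has_derivative_continuous)

lemma C_k_SucD: "C_k (Suc k) f \<Longrightarrow> C_k k f"
proof (induction k arbitrary: f)
  case 0
  then obtain g where "\<And>x. GDERIV f x :> g x" unfolding C_k.simps by blast
  then have "isCont f x" for x by (rule GDERIV_isCont)
  then show ?case by (simp add: continuous_on_eq_continuous_at)
next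
  case (Suc k)
  from Suc.prems obtain g where g: "\<And>x. GDERIV f x :> g x" "\<And>b. b \<in> Basis \<Longrightarrow> C_k (Suc k) (\<lambda>x. g x \<bullet> b)"
    unfolding C_k.simps(2)[of "Suc k"] by blast
  show ?case unfolding C_k.simps(2)[of k] using g Suc.IH by blast
qed

lemma C_k_SucI:
  "(\<And>x. GDERIV f x :> g x) \<Longrightarrow> (\<And>b. b \<in> Basis \<Longrightarrow> C_k k (\<lambda>x. g x \<bullet> b)) \<Longrightarrow> C_k (Suc k) f"
  unfolding C_k.simps by blast

lemma C_k_SucE:
  assumes "C_k (Suc k) f"
  obtains g where "\<And>x. GDERIV f x :> g x" "\<And>b. b \<in> Basis \<Longrightarrow> C_k k (\<lambda>x. g x \<bullet> b)"
  using assms that unfolding C_k.simps by blast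

lemma C_k_const: "C_k k (\<lambda>x. c)"
proof (induction k arbitrary: c)
  case (Suc k)
  show ?case by (rule C_k_SucI[OF GDERIV_const]) (simp add: Suc.IH)
qed simp

lemma bounded_linear_gradient:
  fixes f :: "'a::euclidean_space \<Rightarrow> real"
  assumes "bounded_linear f"
  shows "GDERIV f x :> (\<Sum>b\<in>Basis. f b *\<^sub>R b)"
proof -
  interpret bounded_linear f by fact
  have "f = (\<lambda>h. h \<bullet> (\<Sum>b\<in>Basis. f b *\<^sub>R b))"
  proof
    fix h
    have "f h = f (\<Sum>b\<in>Basis. (h \<bullet> b) *\<^sub>R b)" by (simp add: euclidean_representation)
    also have "\<dots> = (\<Sum>b\<in>Basis. (h \<bullet> b) * f b)" by (simp add: sum scaleR)
    also have "\<dots> = h \<bullet> (\<Sum>b\<in>Basis. f b *\<^sub>R b)"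
      by (simp add: inner_sum_right mult.commute)
    finally show "f h = h \<bullet> (\<Sum>b\<in>Basis. f b *\<^sub>R b)" .
  qed
  moreover have "(f has_derivative f) (at x)"
    by (rule bounded_linear_imp_has_derivative[OF assms])
  ultimately show ?thesis unfolding gderiv_def by metis
qed

lemma C_k_linear:
  fixes f :: "'a::euclidean_space \<Rightarrow> real"
  assumes "bounded_linear f" shows "C_k k f"
proof (cases k)
  case 0
  then show ?thesis using assms by (simp add: linear_continuous_on)
next
  case (Suc m)
  show ?thesis unfolding Suc
    by (rule C_k_SucI[OF bounded_linear_gradient[OF assms] C_k_const])
qed

lemma C_k_add: "C_k k f \<Longrightarrow> C_k k g \<Longrightarrow> C_k k (\<lambda>x. f x + g x)"
proof (induction k arbitrary: f g)
  case 0 then show ?case unfolding C_k.simps by (rule continuous_on_add)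
next
  case (Suc k)
  obtain f' where
    f: "\<And>x. GDERIV f x :> f' x" "\<And>b. b \<in> Basis \<Longrightarrow> C_k k (\<lambda>x. f' x \<bullet> b)"
    using C_k_SucE[OF Suc.prems(1)] by blast
  obtain g' where
    g: "\<And>x. GDERIV g x :> g' x" "\<And>b. b \<in> Basis \<Longrightarrow> C_k k (\<lambda>x. g' x \<bullet> b)"
    using C_k_SucE[OF Suc.prems(2)] by blast
  show ?case
  proof (rule C_k_SucI[where g = "\<lambda>x. f' x + g' x"])
    show "GDERIV (\<lambda>x. f x + g x) x :> f' x + g' x" for x by (rule GDERIV_add[OF f(1) g(1)])
    show "C_k k (\<lambda>x. (f' x + g' x) \<bullet> b)" if "b \<in> Basis" for b
      unfolding inner_add_left by (rule Suc.IH[OF f(2)[OF that] g(2)[OF that]])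
  qed
qed

lemma C_k_mult: "C_k k f \<Longrightarrow> C_k k g \<Longrightarrow> C_k k (\<lambda>x. f x * g x)"
proof (induction k arbitrary: f g)
  case 0 then show ?case unfolding C_k.simps by (rule continuous_on_mult)
next
  case (Suc k)
  obtain f' where
    f: "\<And>x. GDERIV f x :> f' x" "\<And>b. b \<in> Basis \<Longrightarrow> C_k k (\<lambda>x. f' x \<bullet> b)"
    using C_k_SucE[OF Suc.prems(1)] by blast
  obtain g' where
    g: "\<And>x. GDERIV g x :> g' x" "\<And>b. b \<in> Basis \<Longrightarrow> C_k k (\<lambda>x. g' x \<bullet> b)"
    using C_k_SucE[OF Suc.prems(2)] by blast
  show ?case
  proof (rule C_k_SucI[where g = "\<lambda>x. f x *\<^sub>R g' x + g x *\<^sub>R f' x"])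
    show "GDERIV (\<lambda>x. f x * g x) x :> f x *\<^sub>R g' x + g x *\<^sub>R f' x" for x
      by (rule GDERIV_mult[OF f(1) g(1)])
    show "C_k k (\<lambda>x. (f x *\<^sub>R g' x + g x *\<^sub>R f' x) \<bullet> b)" if "b \<in> Basis" for b
      unfolding inner_add_left inner_scaleR_left
      by (intro C_k_add Suc.IH f(2) g(2) that C_k_SucD[OF Suc.prems(1)] C_k_SucD[OF Suc.prems(2)])
  qed
qed

lemma C_k_real_polynomial:
  fixes p :: "'a::euclidean_space \<Rightarrow> real"
  assumes "real_polynomial_function p" shows "C_k k p"
  using assms by induction (auto intro: C_k_linear C_k_const C_k_add C_k_mult)

lemma C_k_power: "C_k k f \<Longrightarrow> C_k k (\<lambda>x. f x ^ n)"
  by (induction n) (auto intro: C_k_const C_k_mult)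

lemma C_k_sum: "finite I \<Longrightarrow> (\<And>i. i \<in> I \<Longrightarrow> C_k k (f i)) \<Longrightarrow> C_k k (\<lambda>x. \<Sum>i\<in>I. f i x)"
  by (induction I rule: finite_induct) (auto intro: C_k_const C_k_add)

text \<open>The functions \<open>t\<^sup>-\<^sup>j exp (-1/t)\<close> for \<open>t > 0\<close>, extended by zero: a family that differentiation
  maps into its own span, which is what the recursion in \<open>C_k\<close> asks for.\<close>
definition exp_flat :: "nat \<Rightarrow> real \<Rightarrow> real" where
  "exp_flat j t = (if t > 0 then inverse t ^ j * exp (- inverse t) else 0)"

lemma exp_flat_at_right_0: "(exp_flat j \<longlongrightarrow> 0) (at_right 0)"
proof -
  have "((\<lambda>t::real. t ^ j / exp t) \<longlongrightarrow> 0) at_top" by (rule tendsto_power_div_exp_0)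
  from filterlim_compose[OF this filterlim_inverse_at_top_right]
  have "((\<lambda>t::real. inverse t ^ j / exp (inverse t)) \<longlongrightarrow> 0) (at_right 0)" .
  moreover have "\<forall>\<^sub>F t in at_right (0::real). inverse t ^ j / exp (inverse t) = exp_flat j t"
    by (auto simp: eventually_at_filter exp_flat_def exp_minus divide_inverse)
  ultimately show ?thesis by (simp add: tendsto_cong)
qed

lemma exp_flat_DERIV:
  "DERIV (exp_flat j) t :> (exp_flat (j + 2) t - real j * exp_flat (j + 1) t)"
proof -
  consider "t > 0" | "t < 0" | "t = 0" by linarith
  then show ?thesis
  proof cases
    case 1
    have "DERIV (\<lambda>t. inverse t ^ j * exp (- inverse t)) t :>
        (exp_flat (j + 2) t - real j * exp_flat (j + 1) t)"
    proof -
      have "DERIV (\<lambda>t. inverse t ^ j * exp (- inverse t)) t :>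
          real j * (- (inverse t * inverse t) * inverse t ^ (j - Suc 0)) * exp (- inverse t)
          + exp (- inverse t) * (inverse t * inverse t) * inverse t ^ j"
        by (rule derivative_eq_intros refl | use 1 in simp)+
      moreover have "real j * (inverse t * inverse t * inverse t ^ (j - Suc 0)) = real j * inverse t ^ (j + 1)"
        by (cases j) auto
      ultimately show ?thesis
        using 1 by (cases j) (simp_all add: exp_flat_def algebra_simps)
    qed
    moreover have "\<forall>\<^sub>F s in nhds t. exp_flat j s = inverse s ^ j * exp (- inverse s)"
      using eventually_nhds_in_open[of "{0<..}" t] 1
      by (auto simp: exp_flat_def elim!: eventually_mono)
    ultimately show ?thesis by (subst DERIV_cong_ev[OF refl _ refl])
  next
    case 2
    have "\<forall>\<^sub>F s in nhds t. exp_flat j s = 0"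
      using eventually_nhds_in_open[of "{..<0}" t] 2
      by (auto simp: exp_flat_def elim!: eventually_mono)
    then show ?thesis using 2 by (subst DERIV_cong_ev[OF refl _ refl]) (auto simp: exp_flat_def)
  next
    case 3
    have "((\<lambda>s. exp_flat j s / s) \<longlongrightarrow> 0) (at_right 0)"
      using exp_flat_at_right_0[of "Suc j"]
      by (rule tendsto_cong[THEN iffD1, rotated])
        (auto simp: eventually_at_filter exp_flat_def divide_inverse)
    moreover have "((\<lambda>s. exp_flat j s / s) \<longlongrightarrow> 0) (at_left 0)"
      by (rule tendsto_cong[THEN iffD2, OF _ tendsto_const])
        (auto simp: eventually_at_filter exp_flat_def)
    ultimately have "((\<lambda>s. exp_flat j s / s) \<longlongrightarrow> 0) (at 0)" by (simp add: filterlim_split_at)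
    then show ?thesis using 3 by (simp add: DERIV_def exp_flat_def)
  qed
qed

text \<open>Induction on the order for all \<open>j\<close> at once, since differentiation raises \<open>j\<close>.\<close>
lemma C_k_exp_flat:
  fixes q :: "'a::euclidean_space \<Rightarrow> real"
  assumes q: "\<And>k. C_k k q"
  shows "C_k k (\<lambda>x. exp_flat j (q x))"
proof (induction k arbitrary: j)
  case 0
  have "continuous_on UNIV (exp_flat j)"
    using exp_flat_DERIV by (intro DERIV_continuous_on) auto
  then show ?case
    using q[of 0] by (auto intro: continuous_on_compose2)
next
  case (Suc k)
  obtain q' where
    q': "\<And>x. GDERIV q x :> q' x" "\<And>b. b \<in> Basis \<Longrightarrow> C_k k (\<lambda>x. q' x \<bullet> b)"
    using C_k_SucE[OF q[of "Suc k"]] by blast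
  let ?d = "\<lambda>x. exp_flat (j + 2) (q x) + (- real j) * exp_flat (j + 1) (q x)"
  have "GDERIV (\<lambda>x. exp_flat j (q x)) x :> ?d x *\<^sub>R q' x" for x
    using GDERIV_DERIV_compose[OF q'(1) exp_flat_DERIV] by simp
  moreover have "C_k k (\<lambda>x. (?d x *\<^sub>R q' x) \<bullet> b)" if "b \<in> Basis" for b
    unfolding inner_scaleR_left
    by (intro C_k_mult C_k_add C_k_const Suc.IH q'(2) that)
  ultimately show ?case by (rule C_k_SucI)
qed

lemma C_k_norm_square: "C_k k (\<lambda>x::'a::euclidean_space. r - (norm (x - c))\<^sup>2)"
proof -
  have *: "r - (norm (x - c))\<^sup>2 = r + (- 1) * (\<Sum>b\<in>Basis. (x \<bullet> b + (- (c \<bullet> b))) ^ 2)" for x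
    unfolding power2_norm_eq_inner
    by (subst euclidean_inner) (simp add: power2_eq_square inner_diff_left)
  have "C_k k (\<lambda>x. (x \<bullet> b + (- (c \<bullet> b))) ^ 2)" for b
    by (rule C_k_power[OF C_k_add[OF C_k_linear[OF bounded_linear_inner_left] C_k_const]])
  from C_k_add[OF C_k_const C_k_mult[OF C_k_const C_k_sum[OF finite_Basis this]]]
  show ?thesis unfolding * .
qed

lemma test_fun_subset_support:
  assumes "\<And>k. C_k k \<phi>" "compact K" "K \<subseteq> \<Omega>" "\<And>x. \<phi> x \<noteq> 0 \<Longrightarrow> x \<in> K"
  shows "\<phi> \<in> test_fun \<Omega>"
proof -
  have *: "closure {x. \<phi> x \<noteq> 0} \<subseteq> K"
    using assms by (intro closure_minimal) (auto simp: compact_imp_closed)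
  then have "compact (closure {x. \<phi> x \<noteq> 0})"
    using assms(2) by (metis compact_Int_closed closed_closure inf.absorb_iff2)
  then show ?thesis using assms(1,3) * unfolding test_fun_def by blast
qed

text \<open>The gradient vanishes off the support because the support is closed, so that \<open>\<phi>\<close> is locally
  constant on its complement.\<close>
lemma test_funE:
  assumes "\<phi> \<in> test_fun \<Omega>"
  obtains K \<psi> where "compact K" "K \<subseteq> \<Omega>" "\<And>x. \<phi> x \<noteq> 0 \<Longrightarrow> x \<in> K" "\<And>x. GDERIV \<phi> x :> \<psi> x"
    "continuous_on UNIV \<phi>" "continuous_on UNIV \<psi>" "\<And>x. x \<notin> K \<Longrightarrow> \<phi> x = 0" "\<And>x. x \<notin> K \<Longrightarrow> \<psi> x = 0"
proof -
  define K where "K = closure {x. \<phi> x \<noteq> 0}"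
  have C: "\<And>k. C_k k \<phi>" and K: "compact K" "K \<subseteq> \<Omega>" using assms by (auto simp: test_fun_def K_def)
  obtain \<psi> where \<psi>: "\<And>x. GDERIV \<phi> x :> \<psi> x" "\<And>b. b \<in> Basis \<Longrightarrow> C_k 0 (\<lambda>x. \<psi> x \<bullet> b)"
    using C_k_SucE[OF C[of "Suc 0"]] by blast
  have supp: "x \<in> K" if "\<phi> x \<noteq> 0" for x
    unfolding K_def by (rule subsetD[OF closure_subset]) (simp add: that)
  then have 0: "\<phi> x = 0" if "x \<notin> K" for x using that by blast
  have "\<psi> x = 0" if x: "x \<notin> K" for x
  proof -
    have "((\<lambda>y. 0) has_derivative (\<lambda>h. h \<bullet> \<psi> x)) (at x)"
      by (rule has_derivative_transform_within_open[OF \<psi>(1)[unfolded gderiv_def], of "- K"])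
        (use x 0 K in \<open>auto intro: open_Compl compact_imp_closed\<close>)
    from has_derivative_unique[OF this has_derivative_const]
    have "\<psi> x \<bullet> \<psi> x = 0" by (rule fun_cong)
    then show ?thesis by simp
  qed
  moreover have "continuous_on UNIV \<psi>"
    using \<psi>(2) by (subst continuous_on_componentwise) (simp add: C_k.simps(1))
  moreover have "continuous_on UNIV \<phi>" using C[of 0] by simp
  ultimately show ?thesis
    using that[of K \<psi>, OF K supp \<psi>(1) _ _ 0] by blast
qed

lemma GDERIV_unique: "GDERIV f x :> D \<Longrightarrow> GDERIV f x :> E \<Longrightarrow> D = E"
proof -
  assume "GDERIV f x :> D" "GDERIV f x :> E"
  then have "(\<lambda>h. h \<bullet> D) = (\<lambda>h. h \<bullet> E)" unfolding gderiv_def by (rule has_derivative_unique)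
  then show ?thesis by (metis vector_eq_ldot)
qed

lemma test_fun_mult:
  assumes "\<phi> \<in> test_fun \<Omega>" "\<And>k. C_k k f"
  shows "(\<lambda>x. f x * \<phi> x) \<in> test_fun \<Omega>"
proof -
  obtain K where "compact K" "K \<subseteq> \<Omega>" "\<And>x. \<phi> x \<noteq> 0 \<Longrightarrow> x \<in> K"
    using test_funE[OF assms(1)] by metis
  moreover have "C_k k (\<lambda>x. f x * \<phi> x)" for k
    by (rule C_k_mult) (use assms in \<open>simp_all add: test_fun_def\<close>)
  ultimately show ?thesis by (intro test_fun_subset_support[of _ K]) simp_all
qed

text \<open>Polynomials without constant term keep the support.  They are the only nonlinear functions that
  need to be composed with test functions: the rest is reached by approximation.\<close>
lemma test_fun_polynomial:
  fixes p :: "real \<Rightarrow> real"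
  assumes "\<phi> \<in> test_fun \<Omega>" "real_polynomial_function p" "p 0 = 0"
  shows "(\<lambda>x. p (\<phi> x)) \<in> test_fun \<Omega>"
proof -
  obtain K where K: "compact K" "K \<subseteq> \<Omega>" "\<And>x. \<phi> x \<noteq> 0 \<Longrightarrow> x \<in> K"
    using test_funE[OF assms(1)] by metis
  have \<phi>: "C_k k \<phi>" for k using assms by (auto simp: test_fun_def)
  obtain a n where p: "p = (\<lambda>x. \<Sum>i\<le>n. a i * x ^ i)"
    using assms(2) by (auto simp: real_polynomial_function_iff_sum)
  have "C_k k (\<lambda>x. p (\<phi> x))" for k
    unfolding p by (rule C_k_sum[OF finite_atMost C_k_mult[OF C_k_const C_k_power[OF \<phi>]]])
  moreover have "x \<in> K" if "p (\<phi> x) \<noteq> 0" for x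
    by (rule K(3)) (use that assms(3) in \<open>cases "\<phi> x = 0"; simp\<close>)
  ultimately show ?thesis by (rule test_fun_subset_support[OF _ K(1,2)])
qed

lemma test_fun_bump:
  assumes "open \<Omega>" "c \<in> \<Omega>"
  obtains r \<phi> where "r > 0" "\<phi> \<in> test_fun \<Omega>" "\<And>x. \<phi> x \<ge> 0" "\<And>x. x \<in> ball c r \<Longrightarrow> \<phi> x > 0"
proof -
  obtain r where r: "r > 0" "cball c r \<subseteq> \<Omega>" using assms open_contains_cball by metis
  let ?\<phi> = "\<lambda>x. exp_flat 0 (r\<^sup>2 - (norm (x - c))\<^sup>2)"
  have "x \<in> cball c r" if "?\<phi> x \<noteq> 0" for x
  proof -
    have "(norm (x - c))\<^sup>2 < r\<^sup>2" using that by (auto simp: exp_flat_def split: if_splits)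
    then have "norm (x - c) < r" using r by (simp add: power_less_imp_less_base)
    then show ?thesis by (simp add: dist_norm norm_minus_commute)
  qed
  then have "?\<phi> \<in> test_fun \<Omega>"
    by (rule test_fun_subset_support[OF C_k_exp_flat[OF C_k_norm_square] compact_cball r(2)])
  moreover have "?\<phi> x > 0" if "x \<in> ball c r" for x
  proof -
    have "(norm (x - c))\<^sup>2 < r\<^sup>2"
      using that r by (intro power_strict_mono) (auto simp: dist_norm norm_minus_commute)
    then show ?thesis by (simp add: exp_flat_def)
  qed
  ultimately show ?thesis using that[of r ?\<phi>] r by (auto simp: exp_flat_def)
qed

section \<open>Weak gradients\<close>

text \<open>Continuity with support in a fixed compact set: what integrability and integration by parts use of a
  test function and of its gradient.\<close>
definition cont_supp :: "'a::euclidean_space set \<Rightarrow> ('a \<Rightarrow> 'b::euclidean_space) \<Rightarrow> bool" where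
  "cont_supp K f \<longleftrightarrow> compact K \<and> continuous_on UNIV f \<and> (\<forall>x. x \<notin> K \<longrightarrow> f x = 0)"

lemma cont_supp_bounded:
  assumes "cont_supp K f" obtains B where "B > 0" "\<And>x. norm (f x) \<le> B"
proof -
  have "compact (f ` K)"
    using assms unfolding cont_supp_def by (meson compact_continuous_image continuous_on_subset subset_UNIV)
  then obtain B where "B > 0" "\<forall>y\<in>f ` K. norm y \<le> B"
    using bounded_pos compact_imp_bounded by blast
  moreover have "norm (f x) \<le> B" for x
    using calculation assms unfolding cont_supp_def by (cases "x \<in> K") auto
  ultimately show ?thesis using that by blast
qed

lemma cont_supp_integrable_lborel:
  assumes "cont_supp K f" shows "integrable lborel f"
proof -
  have "integrable lborel (\<lambda>x. indicator K x *\<^sub>R f x)"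
    using assms unfolding cont_supp_def
    by (intro borel_integrable_compact) (auto intro: continuous_on_subset)
  moreover have "(\<lambda>x. indicator K x *\<^sub>R f x) = f"
    using assms unfolding cont_supp_def by (auto simp: fun_eq_iff indicator_def)
  ultimately show ?thesis by simp
qed

lemma cont_supp_integrable_lebesgue:
  assumes "cont_supp K f" shows "integrable lebesgue f"
  using cont_supp_integrable_lborel[OF assms] borel_measurable_integrable
  by (subst integrable_completion) auto

lemma cont_supp_integrable:
  assumes "cont_supp K f" "\<Omega> \<in> sets lebesgue" shows "integrable (lebesgue_on \<Omega>) f"
  using assms(2) cont_supp_integrable_lebesgue[OF assms(1)]
  by (simp add: integrable_restrict_space integrable_mult_indicator)

lemma cont_supp_integral:
  assumes "cont_supp K f" "K \<subseteq> \<Omega>" "\<Omega> \<in> sets lebesgue"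
  shows "(LINT x|lebesgue_on \<Omega>. f x) = (LINT x|lborel. f x)"
proof -
  have "(LINT x|lebesgue_on \<Omega>. f x) = (LINT x|lebesgue. indicator \<Omega> x *\<^sub>R f x)"
    using assms(3) by (intro integral_restrict_space) auto
  also have "(\<lambda>x. indicator \<Omega> x *\<^sub>R f x) = f"
    using assms(1,2) unfolding cont_supp_def by (auto simp: fun_eq_iff indicator_def)
  also have "(LINT x|lebesgue. f x) = (LINT x|lborel. f x)"
    using cont_supp_integrable_lborel[OF assms(1)] borel_measurable_integrable
    by (intro integral_completion) auto
  finally show ?thesis .
qed

text \<open>Translation invariance makes the integral of every difference quotient vanish, and the
  difference quotients converge to the directional derivative.\<close>
lemma integral_gradient_eq_0:
  fixes f :: "'a::euclidean_space \<Rightarrow> real"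
  assumes f: "\<And>x. GDERIV f x :> g x" and ccf: "cont_supp K f" and ccg: "cont_supp K g"
  shows "(LINT x|lborel. g x) = 0"
proof (rule euclidean_eqI)
  fix b :: 'a assume b: "b \<in> Basis"
  obtain M where M: "M > 0" "\<And>x. norm (g x) \<le> M" using cont_supp_bounded[OF ccg] by blast
  obtain R where R: "R > 0" "\<And>x. x \<in> K \<Longrightarrow> norm x \<le> R"
    using ccf unfolding cont_supp_def by (meson bounded_pos compact_imp_bounded)
  define t where "t = (\<lambda>n::nat. inverse (real (Suc n)))"
  define D where "D = (\<lambda>n x. (f (t n *\<^sub>R b + x) - f x) / t n)"
  have t: "t n > 0" "t n \<le> 1" for n by (auto simp: t_def inverse_le_1_iff)
  have lim_t: "t \<longlonglongrightarrow> 0" unfolding t_def by (rule LIMSEQ_inverse_real_of_nat)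
  have fi: "integrable lborel f" by (rule cont_supp_integrable_lborel[OF ccf])
  have fm: "f \<in> borel_measurable lborel" using fi by simp
  have shift: "integrable lborel (\<lambda>x. f (c + x))" "(LINT x|lborel. f (c + x)) = (LINT x|lborel. f x)" for c
  proof -
    have "integrable (distr lborel borel ((+) c)) f" using fi by (simp add: lborel_distr_plus)
    then show "integrable lborel (\<lambda>x. f (c + x))"
      using fm by (subst (asm) integrable_distr_eq) auto
    have "(LINT x|distr lborel borel ((+) c). f x) = (LINT x|lborel. f (c + x))"
      using fm by (intro integral_distr) auto
    then show "(LINT x|lborel. f (c + x)) = (LINT x|lborel. f x)" by (simp add: lborel_distr_plus)
  qed
  have D0: "(LINT x|lborel. D n x) = 0" for n
    unfolding D_def using shift[of "t n *\<^sub>R b"] fi by simp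
  have Dm: "D n \<in> borel_measurable lborel" for n
    unfolding D_def using shift(1)[of "t n *\<^sub>R b"] fm by (intro borel_measurable_divide) auto
  have lim: "(\<lambda>n. D n x) \<longlonglongrightarrow> g x \<bullet> b" for x
  proof -
    have "((\<lambda>s::real. s *\<^sub>R b + x) has_derivative (\<lambda>s. s *\<^sub>R b)) (at 0)"
      by (auto intro!: derivative_eq_intros)
    moreover have "(f has_derivative (\<lambda>h. h \<bullet> g x)) (at (0 *\<^sub>R b + x))"
      using f[of x] by (simp add: gderiv_def)
    ultimately have "((\<lambda>s. f (s *\<^sub>R b + x)) has_derivative (\<lambda>s. (s *\<^sub>R b) \<bullet> g x)) (at 0)"
      by (rule has_derivative_compose)
    then have "DERIV (\<lambda>s. f (s *\<^sub>R b + x)) 0 :> g x \<bullet> b"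
      unfolding has_field_derivative_def
      by (rule has_derivative_eq_rhs) (auto simp: fun_eq_iff inner_commute)
    then have "((\<lambda>h. (f (h *\<^sub>R b + x) - f x) / h) \<longlongrightarrow> g x \<bullet> b) (at 0)"
      by (simp add: DERIV_def)
    moreover have "filterlim t (at 0) sequentially"
      using lim_t t by (auto simp: filterlim_at less_imp_neq[symmetric] intro!: always_eventually)
    ultimately show ?thesis unfolding D_def by (rule filterlim_compose)
  qed
  have bnd: "norm (D n x) \<le> M * indicator (cball 0 (R + 1)) x" for n x
  proof (cases "x \<in> cball 0 (R + 1)")
    case True
    have "norm (f (t n *\<^sub>R b + x) - f x) \<le> M * norm (t n *\<^sub>R b + x - x)"
    proof (rule differentiable_bound[where S = UNIV and f' = "\<lambda>x h. h \<bullet> g x"])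
      show "onorm (\<lambda>h. h \<bullet> g y) \<le> M" for y
      proof (rule onorm_bound)
        fix h :: 'a
        have "norm (h \<bullet> g y) \<le> norm h * norm (g y)" by (simp add: Cauchy_Schwarz_ineq2)
        also have "\<dots> \<le> norm h * M" using M by (intro mult_left_mono) auto
        finally show "norm (h \<bullet> g y) \<le> M * norm h" by (simp add: mult.commute)
      qed (use M in auto)
    qed (use f in \<open>auto simp: gderiv_def\<close>)
    also have "\<dots> = M * t n" using b t[of n] by simp
    finally have "norm (f (t n *\<^sub>R b + x) - f x) / t n \<le> M" using t[of n] by (simp add: field_simps)
    then show ?thesis using True t[of n] by (simp add: D_def)
  next
    case False
    then have x: "norm x > R + 1" by simp
    have "x \<notin> K" using x R(2)[of x] by auto
    moreover have "t n *\<^sub>R b + x \<notin> K"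
    proof
      assume "t n *\<^sub>R b + x \<in> K"
      from R(2)[OF this] have "norm (t n *\<^sub>R b + x) \<le> R" .
      moreover have "norm x \<le> norm (t n *\<^sub>R b + x) + norm (t n *\<^sub>R b)"
        by (metis add_diff_cancel_left' norm_triangle_ineq4)
      ultimately show False using x b t[of n] by simp
    qed
    ultimately show ?thesis using ccf False by (simp add: D_def cont_supp_def)
  qed
  have "emeasure lborel (cball (0::'a) (R + 1)) < \<infinity>" by (rule emeasure_bounded_finite) simp
  then have ind: "integrable lborel (\<lambda>x. M * indicator (cball 0 (R + 1)) (x::'a))"
    by (intro integrable_mult_right integrable_real_indicator) auto
  have "(\<lambda>n. LINT x|lborel. D n x) \<longlonglongrightarrow> (LINT x|lborel. g x \<bullet> b)"
    by (rule integral_dominated_convergence[OF _ Dm ind])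
      (use lim bnd cont_supp_integrable_lborel[OF ccg] in auto)
  then have "(LINT x|lborel. g x \<bullet> b) = 0" using D0 by (simp add: LIMSEQ_const_iff)
  then show "(LINT x|lborel. g x) \<bullet> b = 0 \<bullet> b"
    using cont_supp_integrable_lborel[OF ccg] by simp
qed

lemma test_fun_cont_suppE:
  assumes "\<phi> \<in> test_fun \<Omega>"
  obtains K \<psi> where "K \<subseteq> \<Omega>" "\<And>x. GDERIV \<phi> x :> \<psi> x" "cont_supp K \<phi>" "cont_supp K \<psi>"
  using test_funE[OF assms] unfolding cont_supp_def by metis

lemma test_fun_cont_supp:
  assumes "\<phi> \<in> test_fun \<Omega>" "\<And>x. GDERIV \<phi> x :> \<psi> x"
  obtains K where "K \<subseteq> \<Omega>" "cont_supp K \<phi>" "cont_supp K \<psi>"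
proof -
  obtain K \<psi>' where *: "K \<subseteq> \<Omega>" "\<And>x. GDERIV \<phi> x :> \<psi>' x" "cont_supp K \<phi>" "cont_supp K \<psi>'"
    using test_fun_cont_suppE[OF assms(1)] by blast
  have "\<psi>' = \<psi>" using GDERIV_unique[OF *(2) assms(2)] by auto
  then show ?thesis using that * by blast
qed

lemma L1_locD:
  assumes "f \<in> L1_loc \<Omega>" "compact K" "K \<subseteq> \<Omega>"
  shows "integrable lebesgue (\<lambda>x. indicator K x *\<^sub>R f x)"
  using assms unfolding L1_loc_def set_integrable_def by blast

lemma L1_locI:
  assumes "\<And>K. compact K \<Longrightarrow> K \<subseteq> \<Omega> \<Longrightarrow> integrable lebesgue (\<lambda>x. indicator K x *\<^sub>R f x)"
  shows "f \<in> L1_loc \<Omega>"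
  using assms unfolding L1_loc_def set_integrable_def by blast

lemma continuous_L1_loc:
  assumes "continuous_on UNIV f" shows "f \<in> L1_loc \<Omega>"
proof (rule L1_locI)
  fix K :: "'a set" assume "compact K"
  then have "integrable lborel (\<lambda>x. indicator K x *\<^sub>R f x)"
    using assms by (intro borel_integrable_compact) (auto intro: continuous_on_subset)
  then show "integrable lebesgue (\<lambda>x. indicator K x *\<^sub>R f x)"
    using borel_measurable_integrable by (subst integrable_completion) auto
qed

lemma L1_loc_diff: "f \<in> L1_loc \<Omega> \<Longrightarrow> g \<in> L1_loc \<Omega> \<Longrightarrow> (\<lambda>x. f x - g x) \<in> L1_loc \<Omega>"
  by (rule L1_locI) (auto simp: scaleR_diff_right dest: L1_locD)

lemma integrable_cont_supp_scaleR:
  assumes \<phi>: "cont_supp K \<phi>" "K \<subseteq> \<Omega>" and f: "f \<in> L1_loc \<Omega>" and \<Omega>: "\<Omega> \<in> sets lebesgue"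
  shows "integrable (lebesgue_on \<Omega>) (\<lambda>x. \<phi> x *\<^sub>R f x)"
proof -
  obtain B where B: "B > 0" "\<And>x. norm (\<phi> x) \<le> B" using cont_supp_bounded[OF \<phi>(1)] by blast
  have i: "integrable lebesgue (\<lambda>x. indicator K x *\<^sub>R f x)"
    using L1_locD[OF f _ \<phi>(2)] \<phi> unfolding cont_supp_def by blast
  have "integrable lebesgue (\<lambda>x. \<phi> x *\<^sub>R (indicator K x *\<^sub>R f x))"
  proof (rule Bochner_Integration.integrable_bound)
    show "integrable lebesgue (\<lambda>x. B * norm (indicator K x *\<^sub>R f x))"
      using i by (intro integrable_mult_right integrable_norm)
    show "(\<lambda>x. \<phi> x *\<^sub>R (indicator K x *\<^sub>R f x)) \<in> borel_measurable lebesgue"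
      using borel_measurable_integrable[OF i] borel_measurable_integrable[OF cont_supp_integrable_lebesgue[OF \<phi>(1)]]
      by (rule borel_measurable_scaleR[rotated])
    show "AE x in lebesgue. norm (\<phi> x *\<^sub>R (indicator K x *\<^sub>R f x)) \<le> norm (B * norm (indicator K x *\<^sub>R f x))"
      using B by (intro always_eventually allI) (auto intro!: mult_right_mono simp: indicator_def)
  qed
  moreover have "(\<lambda>x. indicator \<Omega> x *\<^sub>R (\<phi> x *\<^sub>R f x)) = (\<lambda>x. \<phi> x *\<^sub>R (indicator K x *\<^sub>R f x))"
    using \<phi> unfolding cont_supp_def by (auto simp: fun_eq_iff indicator_def)
  ultimately show ?thesis using \<Omega> by (simp add: integrable_restrict_space)
qed

lemma test_fun_product:
  assumes "\<phi> \<in> test_fun \<Omega>" "\<theta> \<in> test_fun \<Omega>"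
  shows "(\<lambda>x. \<phi> x * \<theta> x) \<in> test_fun \<Omega>"
  using test_fun_mult[OF assms(2)] assms(1) by (simp add: test_fun_def)

lemma integral_by_parts_test_fun:
  assumes \<Omega>: "\<Omega> \<in> sets lebesgue"
    and \<phi>: "\<phi> \<in> test_fun \<Omega>" "\<And>x. GDERIV \<phi> x :> \<phi>' x" and f: "continuous_on UNIV f"
      "\<And>x. GDERIV f x :> f' x" "continuous_on UNIV f'"
  shows "(LINT x|lebesgue_on \<Omega>. f x *\<^sub>R \<phi>' x) = - (LINT x|lebesgue_on \<Omega>. \<phi> x *\<^sub>R f' x)"
proof -
  obtain K where K: "K \<subseteq> \<Omega>" "cont_supp K \<phi>" "cont_supp K \<phi>'" using test_fun_cont_supp[OF \<phi>] by blast
  have 1: "cont_supp K (\<lambda>x. f x *\<^sub>R \<phi>' x)" and 2: "cont_supp K (\<lambda>x. \<phi> x *\<^sub>R f' x)"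
    using K f unfolding cont_supp_def by (auto intro!: continuous_intros)
  have 3: "cont_supp K (\<lambda>x. f x *\<^sub>R \<phi>' x + \<phi> x *\<^sub>R f' x)" and 4: "cont_supp K (\<lambda>x. f x * \<phi> x)"
    using K f unfolding cont_supp_def by (auto intro!: continuous_intros)
  have "(LINT x|lborel. f x *\<^sub>R \<phi>' x + \<phi> x *\<^sub>R f' x) = 0"
    by (rule integral_gradient_eq_0[OF GDERIV_mult[OF f(2) \<phi>(2)] 4 3])
  then have "(LINT x|lebesgue_on \<Omega>. f x *\<^sub>R \<phi>' x + \<phi> x *\<^sub>R f' x) = 0"
    using cont_supp_integral[OF 3 K(1) \<Omega>] by simp
  then show ?thesis
    using cont_supp_integrable[OF 1 \<Omega>] cont_supp_integrable[OF 2 \<Omega>] by (simp add: eq_neg_iff_add_eq_0)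
qed

lemma weak_gradient_test_fun:
  assumes \<Omega>: "\<Omega> \<in> sets lebesgue" and \<phi>: "\<phi> \<in> test_fun \<Omega>" "\<And>x. GDERIV \<phi> x :> \<psi> x"
  shows "weak_gradient \<Omega> \<phi> \<psi>"
proof -
  obtain K where "cont_supp K \<phi>" "cont_supp K \<psi>" using test_fun_cont_supp[OF \<phi>] by blast
  then have c: "continuous_on UNIV \<phi>" "continuous_on UNIV \<psi>" unfolding cont_supp_def by auto
  have "(LINT x|lebesgue_on \<Omega>. \<phi> x *\<^sub>R \<psi>' x) = - (LINT x|lebesgue_on \<Omega>. \<theta> x *\<^sub>R \<psi> x)"
    if "\<theta> \<in> test_fun \<Omega>" "\<forall>x. GDERIV \<theta> x :> \<psi>' x" for \<theta> \<psi>'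
    using integral_by_parts_test_fun[OF \<Omega> that(1) _ c(1) \<phi>(2) c(2)] that(2) by blast
  then show ?thesis unfolding weak_gradient_def using c by (auto intro: continuous_L1_loc)
qed

text \<open>The bump function \<open>\<phi>\<close> turns \<open>d\<close> into an integrable function \<open>e\<close> on the whole space.  Test
  functions of the form \<open>p \<phi>\<close>, with \<open>p\<close> a polynomial, are enough: by the Stone-Weierstrass theorem
  \<open>e\<close> is orthogonal to all continuous functions, hence to its own sign.\<close>
lemma locally_zero_of_orthogonal_test_fun:
  fixes d :: "'a::euclidean_space \<Rightarrow> real"
  assumes \<Omega>: "open \<Omega>" and d: "d \<in> L1_loc \<Omega>"
    and orth: "\<And>\<phi>. \<phi> \<in> test_fun \<Omega> \<Longrightarrow> (LINT x|lebesgue_on \<Omega>. \<phi> x * d x) = 0" and c: "c \<in> \<Omega>"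
  obtains r where "r > 0" "negligible {x \<in> ball c r \<inter> \<Omega>. d x \<noteq> 0}"
proof -
  have \<Omega>s: "\<Omega> \<in> sets lebesgue" using \<Omega> by (simp add: lebesgue_openin)
  obtain r \<phi> where \<phi>: "r > 0" "\<phi> \<in> test_fun \<Omega>" "\<And>x. x \<in> ball c r \<Longrightarrow> \<phi> x > 0"
    using test_fun_bump[OF \<Omega> c] by metis
  obtain K where K: "K \<subseteq> \<Omega>" "cont_supp K \<phi>" using test_fun_cont_suppE[OF \<phi>(2)] by metis
  have cK: "compact K" and \<phi>K: "\<And>x. x \<notin> K \<Longrightarrow> \<phi> x = 0" using K by (auto simp: cont_supp_def)
  define e where "e = (\<lambda>x. indicator \<Omega> x * (\<phi> x * d x))"
  have ei: "integrable lebesgue e"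
    using integrable_cont_supp_scaleR[OF K(2,1) d \<Omega>s] \<Omega>s by (simp add: e_def integrable_restrict_space)
  have eK: "e x = 0" if "x \<notin> K" for x using that \<phi>K by (simp add: e_def)
  have bdd_int: "integrable lebesgue (\<lambda>x. q x * e x)"
    if "q \<in> borel_measurable lebesgue" "\<And>x. x \<in> K \<Longrightarrow> \<bar>q x\<bar> \<le> B" for q B
  proof (rule Bochner_Integration.integrable_bound)
    show "integrable lebesgue (\<lambda>x. B * \<bar>e x\<bar>)" using ei by simp
    show "(\<lambda>x. q x * e x) \<in> borel_measurable lebesgue" using that ei by auto
    show "AE x in lebesgue. norm (q x * e x) \<le> norm (B * \<bar>e x\<bar>)"
    proof (intro always_eventually allI)
      fix x show "norm (q x * e x) \<le> norm (B * \<bar>e x\<bar>)"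
        using that(2)[of x] eK[of x]
        by (cases "x \<in> K") (auto simp: abs_mult intro!: mult_right_mono)
    qed
  qed
  have cont_meas: "q \<in> borel_measurable lebesgue" if "continuous_on UNIV q" for q :: "'a \<Rightarrow> real"
    using borel_measurable_continuous_onI[OF that] by (simp add: measurable_completion)
  have cont_bound: "\<exists>B. \<forall>x\<in>K. \<bar>q x\<bar> \<le> B" if "continuous_on UNIV q" for q :: "'a \<Rightarrow> real"
  proof -
    have "compact (q ` K)" using cK that by (meson compact_continuous_image continuous_on_subset subset_UNIV)
    then show ?thesis using compact_imp_bounded bounded_iff by (metis imageI real_norm_def)
  qed
  have poly0: "(LINT x|lebesgue. p x * e x) = 0" if "real_polynomial_function p" for p
  proof -
    have "(\<lambda>x. p x * \<phi> x) \<in> test_fun \<Omega>" by (rule test_fun_mult[OF \<phi>(2) C_k_real_polynomial[OF that]])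
    from orth[OF this] show ?thesis
      using \<Omega>s by (simp add: integral_restrict_space e_def ac_simps)
  qed
  have cont0: "(LINT x|lebesgue. q x * e x) = 0" if q: "continuous_on UNIV q" for q
  proof (rule ccontr)
    let ?I = "LINT x|lebesgue. q x * e x" and ?E = "LINT x|lebesgue. \<bar>e x\<bar>"
    assume n0: "?I \<noteq> 0"
    have E0: "?E \<ge> 0" by simp
    define \<epsilon> where "\<epsilon> = \<bar>?I\<bar> / (?E + 1)"
    have \<epsilon>: "\<epsilon> > 0" unfolding \<epsilon>_def using n0 E0 by (intro divide_pos_pos) linarith+
    obtain p where p: "real_polynomial_function p" "\<And>x. x \<in> K \<Longrightarrow> \<bar>q x - p x\<bar> < \<epsilon>"
      using Stone_Weierstrass_real_polynomial_function[OF cK continuous_on_subset[OF q subset_UNIV] \<epsilon>] by blast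
    have pc: "continuous_on UNIV p" using p(1)
      by (simp add: continuous_on_polymonial_function real_polynomial_function_eq)
    have iq: "integrable lebesgue (\<lambda>x. q x * e x)" and ip: "integrable lebesgue (\<lambda>x. p x * e x)"
      using cont_bound[OF q] cont_bound[OF pc] bdd_int cont_meas[OF q] cont_meas[OF pc] by blast+
    have "?I = (LINT x|lebesgue. q x * e x - p x * e x)" using iq ip poly0[OF p(1)] by simp
    also have "\<bar>\<dots>\<bar> \<le> (LINT x|lebesgue. \<bar>q x * e x - p x * e x\<bar>)"
      using integral_norm_bound[of lebesgue "\<lambda>x. q x * e x - p x * e x"] by simp
    also have "\<dots> \<le> (LINT x|lebesgue. \<epsilon> * \<bar>e x\<bar>)"
    proof (rule integral_mono)
      show "integrable lebesgue (\<lambda>x. \<bar>q x * e x - p x * e x\<bar>)" using iq ip by simp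
      show "integrable lebesgue (\<lambda>x. \<epsilon> * \<bar>e x\<bar>)" using ei by simp
      fix x
      have "\<bar>q x * e x - p x * e x\<bar> = \<bar>q x - p x\<bar> * \<bar>e x\<bar>" by (simp add: abs_mult[symmetric] left_diff_distrib)
      also have "\<dots> \<le> \<epsilon> * \<bar>e x\<bar>"
        using p(2)[of x] eK[of x] by (cases "x \<in> K") (auto intro!: mult_right_mono)
      finally show "\<bar>q x * e x - p x * e x\<bar> \<le> \<epsilon> * \<bar>e x\<bar>" .
    qed
    also have "\<dots> = \<epsilon> * ?E" by simp
    also have "\<dots> < \<epsilon> * (?E + 1)" using \<epsilon> by simp
    also have "\<dots> = \<bar>?I\<bar>"
    proof -
      have "?E + 1 \<noteq> 0" using E0 by linarith
      then show ?thesis unfolding \<epsilon>_def by (metis nonzero_divide_eq_eq)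
    qed
    finally show False by simp
  qed
  have "(\<lambda>x. sgn (e x)) \<in> borel_measurable (lebesgue_on UNIV)" using ei by simp
  then have "(\<lambda>x. sgn (e x)) measurable_on UNIV"
    by (subst measurable_on_iff_borel_measurable) auto
  then obtain N q where N: "negligible N" and q: "\<And>n. continuous_on UNIV (q n)"
      "\<And>x. x \<notin> N \<Longrightarrow> (\<lambda>n. q n x) \<longlonglongrightarrow> sgn (e x)"
    unfolding measurable_on_def by auto
  \<comment> \<open>Continuous approximations of the sign of \<open>e\<close>, clamped so that \<open>\<bar>e\<bar>\<close> dominates.\<close>
  define s where "s = (\<lambda>n x. max (- 1) (min 1 (q n x)))"
  have sc: "continuous_on UNIV (s n)" for n unfolding s_def by (intro continuous_intros q)
  have "(\<lambda>n. LINT x|lebesgue. s n x * e x) \<longlonglongrightarrow> (LINT x|lebesgue. \<bar>e x\<bar>)"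
  proof (rule integral_dominated_convergence)
    show "integrable lebesgue (\<lambda>x. \<bar>e x\<bar>)" using ei by simp
    show "(\<lambda>x. \<bar>e x\<bar>) \<in> borel_measurable lebesgue" using ei by simp
    show "(\<lambda>x. s n x * e x) \<in> borel_measurable lebesgue" for n using cont_meas[OF sc] ei by auto
    show "AE x in lebesgue. norm (s n x * e x) \<le> \<bar>e x\<bar>" for n
      by (intro always_eventually allI) (auto simp: abs_mult s_def intro!: mult_left_le_one_le)
    have "AE x in lebesgue. x \<notin> N" using N by (simp add: AE_not_in negligible_iff_null_sets)
    then show "AE x in lebesgue. (\<lambda>n. s n x * e x) \<longlonglongrightarrow> \<bar>e x\<bar>"
    proof eventually_elim
      case (elim x)
      have "(\<lambda>n. s n x * e x) \<longlonglongrightarrow> max (- 1) (min 1 (sgn (e x))) * e x"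
        unfolding s_def by (intro tendsto_intros q elim)
      moreover have "max (- 1) (min 1 (sgn (e x))) * e x = \<bar>e x\<bar>" by (auto simp: sgn_if)
      ultimately show ?case by simp
    qed
  qed
  then have "(LINT x|lebesgue. \<bar>e x\<bar>) = 0" using cont0[OF sc] by (simp add: LIMSEQ_const_iff)
  then have "AE x in lebesgue. \<bar>e x\<bar> = 0"
    using integral_nonneg_eq_0_iff_AE[of lebesgue "\<lambda>x. \<bar>e x\<bar>"] ei by simp
  then have "negligible {x. e x \<noteq> 0}"
    by (simp add: negligible_iff_null_sets completion.AE_iff_null_sets)
  moreover have "{x \<in> ball c r \<inter> \<Omega>. d x \<noteq> 0} \<subseteq> {x. e x \<noteq> 0}"
    using less_imp_neq[OF \<phi>(3), symmetric] by (auto simp: e_def)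
  ultimately show ?thesis using that \<phi>(1) negligible_subset by blast
qed

lemma AE_lebesgue_on_iff_negligible:
  assumes "\<Omega> \<in> sets lebesgue"
  shows "(AE x in lebesgue_on \<Omega>. P x) \<longleftrightarrow> negligible {x \<in> \<Omega>. \<not> P x}"
proof -
  have "(AE x in lebesgue_on \<Omega>. P x) \<longleftrightarrow> (AE x in lebesgue. x \<in> \<Omega> \<longrightarrow> P x)"
    using assms by (subst AE_restrict_space_iff) auto
  also have "\<dots> \<longleftrightarrow> {x \<in> space lebesgue. \<not> (x \<in> \<Omega> \<longrightarrow> P x)} \<in> null_sets lebesgue"
    by (rule completion.AE_iff_null_sets)
  finally show ?thesis by (simp add: negligible_iff_null_sets)
qed

lemma zero_of_orthogonal_test_fun:
  fixes d :: "'a::euclidean_space \<Rightarrow> real"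
  assumes \<Omega>: "open \<Omega>" and d: "d \<in> L1_loc \<Omega>"
    and orth: "\<And>\<phi>. \<phi> \<in> test_fun \<Omega> \<Longrightarrow> (LINT x|lebesgue_on \<Omega>. \<phi> x * d x) = 0"
  shows "AE x in lebesgue_on \<Omega>. d x = 0"
proof -
  have "negligible {x \<in> \<Omega>. d x \<noteq> 0}"
  proof (subst locally_negligible_alt, intro ballI)
    fix c assume c: "c \<in> {x \<in> \<Omega>. d x \<noteq> 0}"
    then obtain r where r: "r > 0" "negligible {x \<in> ball c r \<inter> \<Omega>. d x \<noteq> 0}"
      using locally_zero_of_orthogonal_test_fun[OF \<Omega> d orth, of c] by blast
    have "openin (top_of_set {x \<in> \<Omega>. d x \<noteq> 0}) ({x \<in> \<Omega>. d x \<noteq> 0} \<inter> ball c r)"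
      by (rule openin_open_Int) simp
    moreover have "{x \<in> \<Omega>. d x \<noteq> 0} \<inter> ball c r = {x \<in> ball c r \<inter> \<Omega>. d x \<noteq> 0}" by auto
    ultimately show "\<exists>U. openin (top_of_set {x \<in> \<Omega>. d x \<noteq> 0}) U \<and> c \<in> U \<and> negligible U"
      using r c by (intro exI[of _ "{x \<in> ball c r \<inter> \<Omega>. d x \<noteq> 0}"]) auto
  qed
  then show ?thesis using \<Omega> by (simp add: AE_lebesgue_on_iff_negligible lebesgue_openin)
qed

lemma weak_gradientD:
  assumes "weak_gradient \<Omega> u g" "\<phi> \<in> test_fun \<Omega>" "\<And>x. GDERIV \<phi> x :> \<psi> x"
  shows "(LINT x|lebesgue_on \<Omega>. u x *\<^sub>R \<psi> x) = - (LINT x|lebesgue_on \<Omega>. \<phi> x *\<^sub>R g x)"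
  using assms unfolding weak_gradient_def by blast

lemma weak_gradient_unique:
  assumes \<Omega>: "open \<Omega>" and g: "weak_gradient \<Omega> u g" and h: "weak_gradient \<Omega> u h"
  shows "AE x in lebesgue_on \<Omega>. g x = h x"
proof -
  have \<Omega>s: "\<Omega> \<in> sets lebesgue" using \<Omega> by (simp add: lebesgue_openin)
  have gL: "g \<in> L1_loc \<Omega>" and hL: "h \<in> L1_loc \<Omega>" using g h by (auto simp: weak_gradient_def)
  have "AE x in lebesgue_on \<Omega>. (g x - h x) \<bullet> b = 0" if b: "b \<in> Basis" for b
  proof (rule zero_of_orthogonal_test_fun[OF \<Omega>])
    show "(\<lambda>x. (g x - h x) \<bullet> b) \<in> L1_loc \<Omega>"
    proof (rule L1_locI)
      fix K :: "'a set" assume "compact K" "K \<subseteq> \<Omega>"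
      from L1_locD[OF L1_loc_diff[OF gL hL] this]
      show "integrable lebesgue (\<lambda>x. indicator K x *\<^sub>R ((g x - h x) \<bullet> b))"
        by (simp add: inner_scaleR_left[symmetric] del: inner_scaleR_left)
    qed
    fix \<phi> assume \<phi>: "\<phi> \<in> test_fun \<Omega>"
    obtain K \<psi> where K: "K \<subseteq> \<Omega>" "\<And>x. GDERIV \<phi> x :> \<psi> x" "cont_supp K \<phi>" "cont_supp K \<psi>"
      using test_fun_cont_suppE[OF \<phi>] by blast
    note i = integrable_cont_supp_scaleR[OF K(3,1) gL \<Omega>s] integrable_cont_supp_scaleR[OF K(3,1) hL \<Omega>s]
    have "(LINT x|lebesgue_on \<Omega>. \<phi> x *\<^sub>R g x) = (LINT x|lebesgue_on \<Omega>. \<phi> x *\<^sub>R h x)"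
      using weak_gradientD[OF g \<phi> K(2)] weak_gradientD[OF h \<phi> K(2)] by simp
    then have "(LINT x|lebesgue_on \<Omega>. \<phi> x *\<^sub>R g x - \<phi> x *\<^sub>R h x) = 0" using i by simp
    then have "(LINT x|lebesgue_on \<Omega>. (\<phi> x *\<^sub>R g x - \<phi> x *\<^sub>R h x) \<bullet> b) = 0" using i by simp
    then show "(LINT x|lebesgue_on \<Omega>. \<phi> x * ((g x - h x) \<bullet> b)) = 0"
      by (simp add: algebra_simps)
  qed
  then have "AE x in lebesgue_on \<Omega>. \<forall>b\<in>Basis. (g x - h x) \<bullet> b = 0"
    by (intro AE_finite_allI) auto
  then show ?thesis
    by eventually_elim (metis eq_iff_diff_eq_0 euclidean_all_zero_iff)
qed

section \<open>Functions with zero boundary values and their gradients\<close>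

text \<open>Lebesgue measure is complete.\<close>
lemma AE_lebesgue_on_measurable_cong:
  fixes f g :: "'a::euclidean_space \<Rightarrow> 'b::euclidean_space"
  assumes "\<Omega> \<in> sets lebesgue" "f \<in> borel_measurable (lebesgue_on \<Omega>)"
    "AE x in lebesgue_on \<Omega>. f x = g x"
  shows "g \<in> borel_measurable (lebesgue_on \<Omega>)"
proof -
  have "f measurable_on \<Omega>" using assms by (simp add: measurable_on_iff_borel_measurable)
  moreover have "negligible {x \<in> \<Omega>. f x \<noteq> g x}"
    using assms by (simp add: AE_lebesgue_on_iff_negligible)
  ultimately have "g measurable_on \<Omega>" by (rule measurable_on_spike) auto
  then show ?thesis using assms by (simp add: measurable_on_iff_borel_measurable)
qed

text \<open>Squared \<open>L\<^sup>2\<close> distances and norms with values in \<open>[0,\<infinity>]\<close>: membership in \<open>L\<^sup>2\<close> is finiteness, and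
  estimates carry no integrability conditions.\<close>
definition L2_dist_sq :: "'a::euclidean_space set \<Rightarrow> ('a \<Rightarrow> 'b::euclidean_space) \<Rightarrow> ('a \<Rightarrow> 'b) \<Rightarrow> ennreal" where
  "L2_dist_sq \<Omega> f g = (\<integral>\<^sup>+x. ennreal ((norm (f x - g x))\<^sup>2) \<partial>lebesgue_on \<Omega>)"

definition L2_norm_sq :: "'a::euclidean_space set \<Rightarrow> ('a \<Rightarrow> 'b::euclidean_space) \<Rightarrow> ennreal" where
  "L2_norm_sq \<Omega> f = (\<integral>\<^sup>+x. ennreal ((norm (f x))\<^sup>2) \<partial>lebesgue_on \<Omega>)"

lemma L2_dist_sq_commute: "L2_dist_sq \<Omega> f g = L2_dist_sq \<Omega> g f"
  by (simp add: L2_dist_sq_def norm_minus_commute)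

lemma L2_dist_sq_eq_L2_norm_sq: "L2_dist_sq \<Omega> f g = L2_norm_sq \<Omega> (\<lambda>x. f x - g x)"
  by (simp add: L2_dist_sq_def L2_norm_sq_def)

lemma L2_dist_sq_zero: "L2_dist_sq \<Omega> f (\<lambda>x. 0) = L2_norm_sq \<Omega> f"
  by (simp add: L2_dist_sq_def L2_norm_sq_def)

lemma L2_dist_sq_cong_AE:
  assumes "AE x in lebesgue_on \<Omega>. f x = f' x" "AE x in lebesgue_on \<Omega>. g x = g' x"
  shows "L2_dist_sq \<Omega> f g = L2_dist_sq \<Omega> f' g'"
  unfolding L2_dist_sq_def by (rule nn_integral_cong_AE) (use assms in eventually_elim, simp)

lemma norm_diff_square_le:
  "(norm (a - c :: 'b::real_normed_vector))\<^sup>2 \<le> 2 * (norm (a - b))\<^sup>2 + 2 * (norm (b - c))\<^sup>2"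
proof -
  have "norm (a - c) \<le> norm (a - b) + norm (b - c)" by (rule norm_diff_triangle_le) auto
  then have "(norm (a - c))\<^sup>2 \<le> (norm (a - b) + norm (b - c))\<^sup>2" by (rule power_mono) simp
  also have "\<dots> \<le> 2 * (norm (a - b))\<^sup>2 + 2 * (norm (b - c))\<^sup>2"
    using sum_squares_bound[of "norm (a - b)" "norm (b - c)"] by (simp add: power2_sum)
  finally show ?thesis .
qed

lemma L2_dist_sq_triangle:
  assumes "f \<in> borel_measurable (lebesgue_on \<Omega>)" "g \<in> borel_measurable (lebesgue_on \<Omega>)"
    "h \<in> borel_measurable (lebesgue_on \<Omega>)"
  shows "L2_dist_sq \<Omega> f h \<le> 2 * L2_dist_sq \<Omega> f g + 2 * L2_dist_sq \<Omega> g h"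
proof -
  have "L2_dist_sq \<Omega> f h \<le> (\<integral>\<^sup>+x. 2 * ennreal ((norm (f x - g x))\<^sup>2) + 2 * ennreal ((norm (g x - h x))\<^sup>2) \<partial>lebesgue_on \<Omega>)"
    unfolding L2_dist_sq_def
  proof (rule nn_integral_mono)
    fix x
    have "ennreal ((norm (f x - h x))\<^sup>2) \<le> ennreal (2 * (norm (f x - g x))\<^sup>2 + 2 * (norm (g x - h x))\<^sup>2)"
      by (intro ennreal_leI norm_diff_square_le)
    then show "ennreal ((norm (f x - h x))\<^sup>2) \<le> 2 * ennreal ((norm (f x - g x))\<^sup>2) + 2 * ennreal ((norm (g x - h x))\<^sup>2)"
      by (simp add: ennreal_plus ennreal_mult)
  qed
  also have "\<dots> = 2 * L2_dist_sq \<Omega> f g + 2 * L2_dist_sq \<Omega> g h"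
    unfolding L2_dist_sq_def using assms by (simp add: nn_integral_add nn_integral_cmult)
  finally show ?thesis .
qed

lemma L2_dist_sq_le_L2_norm_sq:
  assumes "f \<in> borel_measurable (lebesgue_on \<Omega>)" "g \<in> borel_measurable (lebesgue_on \<Omega>)"
  shows "L2_dist_sq \<Omega> f g \<le> 2 * L2_norm_sq \<Omega> f + 2 * L2_norm_sq \<Omega> g"
  using L2_dist_sq_triangle[OF assms(1) borel_measurable_const assms(2), of 0]
  unfolding L2_dist_sq_commute[of \<Omega> "\<lambda>x. 0" g] L2_dist_sq_zero .

lemma L2_dist_sq_triangle_less:
  assumes "f \<in> borel_measurable (lebesgue_on \<Omega>)" "g \<in> borel_measurable (lebesgue_on \<Omega>)"
    "h \<in> borel_measurable (lebesgue_on \<Omega>)" and "L2_dist_sq \<Omega> f g < ennreal (\<epsilon> / 4)" "L2_dist_sq \<Omega> g h < ennreal (\<epsilon> / 4)"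
    and "\<epsilon> > 0"
  shows "L2_dist_sq \<Omega> f h < ennreal \<epsilon>"
proof -
  have "L2_dist_sq \<Omega> f h \<le> 2 * L2_dist_sq \<Omega> f g + 2 * L2_dist_sq \<Omega> g h" by (rule L2_dist_sq_triangle[OF assms(1-3)])
  also have "\<dots> < 2 * ennreal (\<epsilon> / 4) + 2 * ennreal (\<epsilon> / 4)"
    using assms(4,5) by (intro add_strict_mono ennreal_mult_strict_left_mono) auto
  also have "\<dots> = ennreal \<epsilon>"
  proof -
    have "ennreal (2 * (\<epsilon> / 4)) = ennreal 2 * ennreal (\<epsilon> / 4)" by (rule ennreal_mult') simp
    moreover have "ennreal (2 * (\<epsilon> / 4) + 2 * (\<epsilon> / 4)) = ennreal (2 * (\<epsilon> / 4)) + ennreal (2 * (\<epsilon> / 4))"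
      using assms(6) by (intro ennreal_plus) auto
    ultimately show ?thesis by simp
  qed
  finally show ?thesis .
qed

text \<open>Membership of \<open>w\<close> in \<open>H\<^sub>0\<^sup>1\<close> together with its gradient \<open>g\<close>.  In contrast to \<open>H10\<close> this mentions neither
  the choice hidden in \<open>grad\<close> nor norms that are zero for functions with infinite integrals, so that
  closedness, composition and passage to the limit become statements about two functions.  The
  lemmas \<open>H10_pair_H10\<close>, \<open>H10_pair_grad\<close> and \<open>H10_imp_H10_pair\<close> translate.\<close>
definition H10_pair :: "'a::euclidean_space set \<Rightarrow> ('a \<Rightarrow> real) \<Rightarrow> ('a \<Rightarrow> 'a) \<Rightarrow> bool" where
  "H10_pair \<Omega> w g \<longleftrightarrow> w \<in> borel_measurable (lebesgue_on \<Omega>) \<and> g \<in> borel_measurable (lebesgue_on \<Omega>) \<and>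
     (\<forall>\<epsilon>>0. \<exists>\<phi> \<psi>. \<phi> \<in> test_fun \<Omega> \<and> (\<forall>x. GDERIV \<phi> x :> \<psi> x) \<and>
        L2_dist_sq \<Omega> w \<phi> < ennreal \<epsilon> \<and> L2_dist_sq \<Omega> g \<psi> < ennreal \<epsilon>)"

lemma H10_pair_measurable:
  "H10_pair \<Omega> w g \<Longrightarrow> w \<in> borel_measurable (lebesgue_on \<Omega>)"
  "H10_pair \<Omega> w g \<Longrightarrow> g \<in> borel_measurable (lebesgue_on \<Omega>)"
  by (auto simp: H10_pair_def)

lemma H10_pairE:
  assumes "H10_pair \<Omega> w g" "\<epsilon> > 0"
  obtains \<phi> \<psi> where "\<phi> \<in> test_fun \<Omega>" "\<And>x. GDERIV \<phi> x :> \<psi> x"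
    "L2_dist_sq \<Omega> w \<phi> < ennreal \<epsilon>" "L2_dist_sq \<Omega> g \<psi> < ennreal \<epsilon>"
  using assms unfolding H10_pair_def by blast

lemma cont_supp_measurable:
  assumes "cont_supp K f" "\<Omega> \<in> sets lebesgue" shows "f \<in> borel_measurable (lebesgue_on \<Omega>)"
  using cont_supp_integrable[OF assms] by simp

lemma test_fun_measurable:
  assumes "\<Omega> \<in> sets lebesgue" "\<phi> \<in> test_fun \<Omega>" "\<And>x. GDERIV \<phi> x :> \<psi> x"
  shows "\<phi> \<in> borel_measurable (lebesgue_on \<Omega>)" "\<psi> \<in> borel_measurable (lebesgue_on \<Omega>)"
  using test_fun_cont_supp[OF assms(2,3)] cont_supp_measurable[OF _ assms(1)] by metis+

lemma H10_pair_closed: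
  assumes \<Omega>: "\<Omega> \<in> sets lebesgue"
    and m: "w \<in> borel_measurable (lebesgue_on \<Omega>)" "g \<in> borel_measurable (lebesgue_on \<Omega>)"
    and approx: "\<And>\<epsilon>. \<epsilon> > 0 \<Longrightarrow> \<exists>w' g'. H10_pair \<Omega> w' g' \<and> L2_dist_sq \<Omega> w w' < ennreal \<epsilon> \<and> L2_dist_sq \<Omega> g g' < ennreal \<epsilon>"
  shows "H10_pair \<Omega> w g"
  unfolding H10_pair_def
proof (intro conjI allI impI m)
  fix \<epsilon> :: real assume \<epsilon>: "\<epsilon> > 0"
  then have \<epsilon>4: "\<epsilon> / 4 > 0" by simp
  obtain w' g' where w': "H10_pair \<Omega> w' g'" "L2_dist_sq \<Omega> w w' < ennreal (\<epsilon> / 4)" "L2_dist_sq \<Omega> g g' < ennreal (\<epsilon> / 4)"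
    using approx[OF \<epsilon>4] by blast
  obtain \<phi> \<psi> where \<phi>: "\<phi> \<in> test_fun \<Omega>" "\<And>x. GDERIV \<phi> x :> \<psi> x"
    "L2_dist_sq \<Omega> w' \<phi> < ennreal (\<epsilon> / 4)" "L2_dist_sq \<Omega> g' \<psi> < ennreal (\<epsilon> / 4)"
    using H10_pairE[OF w'(1) \<epsilon>4] by blast
  have "L2_dist_sq \<Omega> w \<phi> < ennreal \<epsilon>" "L2_dist_sq \<Omega> g \<psi> < ennreal \<epsilon>"
    using L2_dist_sq_triangle_less[OF m(1) H10_pair_measurable(1)[OF w'(1)] test_fun_measurable(1)[OF \<Omega> \<phi>(1,2)] w'(2) \<phi>(3) \<epsilon>]
      L2_dist_sq_triangle_less[OF m(2) H10_pair_measurable(2)[OF w'(1)] test_fun_measurable(2)[OF \<Omega> \<phi>(1,2)] w'(3) \<phi>(4) \<epsilon>]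
    by auto
  then show "\<exists>\<phi> \<psi>. \<phi> \<in> test_fun \<Omega> \<and> (\<forall>x. GDERIV \<phi> x :> \<psi> x) \<and> L2_dist_sq \<Omega> w \<phi> < ennreal \<epsilon> \<and> L2_dist_sq \<Omega> g \<psi> < ennreal \<epsilon>"
    using \<phi> by blast
qed

lemma H10_pair_cong_AE:
  assumes \<Omega>: "\<Omega> \<in> sets lebesgue" and p: "H10_pair \<Omega> w g"
    and w: "AE x in lebesgue_on \<Omega>. w x = w' x" and g: "AE x in lebesgue_on \<Omega>. g x = g' x"
  shows "H10_pair \<Omega> w' g'"
proof -
  have "L2_dist_sq \<Omega> w \<phi> = L2_dist_sq \<Omega> w' \<phi>" "L2_dist_sq \<Omega> g \<psi> = L2_dist_sq \<Omega> g' \<psi>" for \<phi> \<psi>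
    using L2_dist_sq_cong_AE[OF w, of \<phi> \<phi>] L2_dist_sq_cong_AE[OF g, of \<psi> \<psi>] by auto
  moreover have "w' \<in> borel_measurable (lebesgue_on \<Omega>)" "g' \<in> borel_measurable (lebesgue_on \<Omega>)"
    using AE_lebesgue_on_measurable_cong[OF \<Omega> _ w] AE_lebesgue_on_measurable_cong[OF \<Omega> _ g]
      H10_pair_measurable[OF p] by auto
  ultimately show ?thesis using p unfolding H10_pair_def by simp
qed

lemma L2_norm_sq_cont_supp_finite:
  assumes "cont_supp K f" "\<Omega> \<in> sets lebesgue" shows "L2_norm_sq \<Omega> f < \<infinity>"
proof -
  have "cont_supp K (\<lambda>x. (norm (f x))\<^sup>2)" using assms unfolding cont_supp_def by (auto intro!: continuous_intros)
  from cont_supp_integrable[OF this assms(2)] show ?thesis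
    unfolding L2_norm_sq_def by (simp add: integrable_iff_bounded)
qed

lemma L2_norm_sq_finite_of_L2_dist_sq:
  assumes "f \<in> borel_measurable (lebesgue_on \<Omega>)" "g \<in> borel_measurable (lebesgue_on \<Omega>)"
    "L2_dist_sq \<Omega> f g < \<infinity>" "L2_norm_sq \<Omega> g < \<infinity>"
  shows "L2_norm_sq \<Omega> f < \<infinity>"
proof -
  have "L2_norm_sq \<Omega> f \<le> 2 * L2_dist_sq \<Omega> f g + 2 * L2_norm_sq \<Omega> g"
    using L2_dist_sq_triangle[OF assms(1,2), of "\<lambda>x. 0"] by (simp add: L2_dist_sq_zero)
  also have "\<dots> < \<infinity>" using assms(3,4) by (simp add: ennreal_mult_less_top)
  finally show ?thesis .
qed

lemma H10_pair_finite:
  assumes \<Omega>: "\<Omega> \<in> sets lebesgue" and p: "H10_pair \<Omega> w g"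
  shows "L2_norm_sq \<Omega> w < \<infinity>" "L2_norm_sq \<Omega> g < \<infinity>"
proof -
  obtain \<phi> \<psi> where \<phi>: "\<phi> \<in> test_fun \<Omega>" "\<And>x. GDERIV \<phi> x :> \<psi> x"
    "L2_dist_sq \<Omega> w \<phi> < ennreal 1" "L2_dist_sq \<Omega> g \<psi> < ennreal 1"
    using H10_pairE[OF p, of 1] by auto
  obtain K where K: "cont_supp K \<phi>" "cont_supp K \<psi>" using test_fun_cont_supp[OF \<phi>(1,2)] by blast
  have fin: "L2_dist_sq \<Omega> w \<phi> < \<infinity>" "L2_dist_sq \<Omega> g \<psi> < \<infinity>"
    using \<phi>(3,4) by (auto intro: less_trans)
  show "L2_norm_sq \<Omega> w < \<infinity>"
    by (rule L2_norm_sq_finite_of_L2_dist_sq[OF H10_pair_measurable(1)[OF p] test_fun_measurable(1)[OF \<Omega> \<phi>(1,2)] fin(1) L2_norm_sq_cont_supp_finite[OF K(1) \<Omega>]])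
  show "L2_norm_sq \<Omega> g < \<infinity>"
    by (rule L2_norm_sq_finite_of_L2_dist_sq[OF H10_pair_measurable(2)[OF p] test_fun_measurable(2)[OF \<Omega> \<phi>(1,2)] fin(2) L2_norm_sq_cont_supp_finite[OF K(2) \<Omega>]])
qed

lemma powr_2_norm: "norm x powr 2 = (norm x)\<^sup>2"
  by (cases "x = 0") (auto simp: powr_numeral)

lemma Lp_2_iff: "f \<in> Lp 2 \<Omega> \<longleftrightarrow> f \<in> borel_measurable (lebesgue_on \<Omega>) \<and> L2_norm_sq \<Omega> f < \<infinity>"
  unfolding Lp_def L2_norm_sq_def powr_2_norm
  by (auto simp: integrable_iff_bounded)

lemma Lp_norm_2: "f \<in> borel_measurable (lebesgue_on \<Omega>) \<Longrightarrow> (Lp_norm 2 \<Omega> f)\<^sup>2 = enn2real (L2_norm_sq \<Omega> f)"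
proof -
  assume f: "f \<in> borel_measurable (lebesgue_on \<Omega>)"
  have "(LINT x|lebesgue_on \<Omega>. (norm (f x))\<^sup>2) = enn2real (L2_norm_sq \<Omega> f)"
    unfolding L2_norm_sq_def using f by (intro integral_eq_nn_integral) auto
  moreover have "(y powr (1 / 2))\<^sup>2 = y" if "y \<ge> 0" for y :: real
    using that by (simp add: powr_half_sqrt)
  ultimately show ?thesis unfolding Lp_norm_def powr_2_norm by (simp add: enn2real_nonneg)
qed

lemma L2_L1_loc:
  assumes \<Omega>: "\<Omega> \<in> sets lebesgue" and f: "f \<in> borel_measurable (lebesgue_on \<Omega>)" "L2_norm_sq \<Omega> f < \<infinity>"
  shows "f \<in> L1_loc \<Omega>"
proof (rule L1_locI)
  fix K :: "'a set" assume K: "compact K" "K \<subseteq> \<Omega>"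
  have Ks: "K \<in> sets lebesgue" using K by (simp add: compact_imp_closed lebesgue_closedin borel_compact)
  have "integrable (lebesgue_on \<Omega>) (\<lambda>x. indicator K x *\<^sub>R f x)"
  proof (rule Bochner_Integration.integrable_bound)
    have "integrable (lebesgue_on \<Omega>) (\<lambda>x. (norm (f x))\<^sup>2)"
      using f unfolding L2_norm_sq_def by (simp add: integrable_iff_bounded)
    moreover have "integrable (lebesgue_on \<Omega>) (indicator K :: 'a \<Rightarrow> real)"
    proof -
      have "integrable lebesgue (indicator K :: 'a \<Rightarrow> real)"
        using Ks K emeasure_bounded_finite[of K] compact_imp_bounded[OF K(1)]
        by (intro integrable_real_indicator) (auto simp: emeasure_completion borel_compact)
      from integrable_mult_indicator[OF \<Omega> this] show ?thesis using \<Omega> by (simp add: integrable_restrict_space)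
    qed
    ultimately show "integrable (lebesgue_on \<Omega>) (\<lambda>x. indicator K x + (norm (f x))\<^sup>2)" by simp
    show "(\<lambda>x. indicator K x *\<^sub>R f x) \<in> borel_measurable (lebesgue_on \<Omega>)"
    proof (intro borel_measurable_scaleR f)
      have "(indicator K :: 'a \<Rightarrow> real) \<in> borel_measurable lebesgue" using Ks by simp
      then show "(indicator K :: 'a \<Rightarrow> real) \<in> borel_measurable (lebesgue_on \<Omega>)"
        by (rule measurable_restrict_space1)
    qed
    show "AE x in lebesgue_on \<Omega>. norm (indicator K x *\<^sub>R f x) \<le> norm (indicator K x + (norm (f x))\<^sup>2)"
    proof (intro always_eventually allI)
      fix x
      have "norm (f x) \<le> 1 + (norm (f x))\<^sup>2"
        using sum_squares_bound[of "norm (f x)" 1] norm_ge_zero[of "f x"] unfolding power_one by linarith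
      then show "norm (indicator K x *\<^sub>R f x) \<le> norm (indicator K x + (norm (f x))\<^sup>2)"
        by (auto simp: indicator_def)
    qed
  qed
  then have "integrable lebesgue (\<lambda>x. indicator \<Omega> x *\<^sub>R (indicator K x *\<^sub>R f x))"
    using \<Omega> by (simp add: integrable_restrict_space)
  moreover have "(\<lambda>x. indicator \<Omega> x *\<^sub>R (indicator K x *\<^sub>R f x)) = (\<lambda>x. indicator K x *\<^sub>R f x)"
    using K by (auto simp: fun_eq_iff indicator_def)
  ultimately show "integrable lebesgue (\<lambda>x. indicator K x *\<^sub>R f x)" by simp
qed

lemma integrable_L1_loc_scaleR:
  fixes \<psi> :: "'a::euclidean_space \<Rightarrow> 'b::euclidean_space"
  assumes \<psi>: "cont_supp K \<psi>" "K \<subseteq> \<Omega>" and f: "f \<in> L1_loc \<Omega>" and \<Omega>: "\<Omega> \<in> sets lebesgue"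
  shows "integrable (lebesgue_on \<Omega>) (\<lambda>x. f x *\<^sub>R \<psi> x)"
proof -
  have "integrable (lebesgue_on \<Omega>) (\<lambda>x. \<Sum>b\<in>Basis. ((\<psi> x \<bullet> b) *\<^sub>R f x) *\<^sub>R b)"
  proof (intro Bochner_Integration.integrable_sum integrable_scaleR_left)
    fix b :: 'b
    have "cont_supp K (\<lambda>x. \<psi> x \<bullet> b)" using \<psi> unfolding cont_supp_def by (auto intro!: continuous_intros)
    then show "integrable (lebesgue_on \<Omega>) (\<lambda>x. (\<psi> x \<bullet> b) *\<^sub>R f x)"
      by (rule integrable_cont_supp_scaleR[OF _ \<psi>(2) f \<Omega>])
  qed
  moreover have "(\<Sum>b\<in>Basis. ((\<psi> x \<bullet> b) *\<^sub>R f x) *\<^sub>R b) = f x *\<^sub>R \<psi> x" for x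
  proof -
    have "(\<Sum>b\<in>Basis. ((\<psi> x \<bullet> b) *\<^sub>R f x) *\<^sub>R b) = f x *\<^sub>R (\<Sum>b\<in>Basis. (\<psi> x \<bullet> b) *\<^sub>R b)"
      by (simp add: scaleR_sum_right mult.commute)
    then show ?thesis by (simp add: euclidean_representation)
  qed
  ultimately show ?thesis by simp
qed

lemma integrable_L1_loc:
  assumes \<Omega>: "\<Omega> \<in> sets lebesgue" and f: "integrable (lebesgue_on \<Omega>) f"
  shows "f \<in> L1_loc \<Omega>"
proof (rule L1_locI)
  fix K :: "'a set" assume K: "compact K" "K \<subseteq> \<Omega>"
  have Ks: "K \<in> sets lebesgue" using K by (simp add: compact_imp_closed borel_compact)
  have "integrable lebesgue (\<lambda>x. indicator \<Omega> x *\<^sub>R f x)"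
    using \<Omega> f by (simp add: integrable_restrict_space)
  then have "integrable lebesgue (\<lambda>x. indicator K x *\<^sub>R (indicator \<Omega> x *\<^sub>R f x))"
    by (rule integrable_mult_indicator[OF Ks])
  moreover have "(\<lambda>x. indicator K x *\<^sub>R (indicator \<Omega> x *\<^sub>R f x)) = (\<lambda>x. indicator K x *\<^sub>R f x)"
    using K by (auto simp: fun_eq_iff indicator_def)
  ultimately show "integrable lebesgue (\<lambda>x. indicator K x *\<^sub>R f x)" by simp
qed

lemma weak_gradient_diff:
  assumes \<Omega>: "\<Omega> \<in> sets lebesgue" and u: "weak_gradient \<Omega> u g" and v: "weak_gradient \<Omega> v h"
  shows "weak_gradient \<Omega> (\<lambda>x. u x - v x) (\<lambda>x. g x - h x)"
  unfolding weak_gradient_def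
proof (intro conjI ballI allI impI)
  have L: "u \<in> L1_loc \<Omega>" "v \<in> L1_loc \<Omega>" "g \<in> L1_loc \<Omega>" "h \<in> L1_loc \<Omega>"
    using u v by (auto simp: weak_gradient_def)
  show "(\<lambda>x. u x - v x) \<in> L1_loc \<Omega>" "(\<lambda>x. g x - h x) \<in> L1_loc \<Omega>"
    by (intro L1_loc_diff L)+
  fix \<phi> \<psi> assume \<phi>: "\<phi> \<in> test_fun \<Omega>" and "\<forall>x. GDERIV \<phi> x :> \<psi> x"
  then have \<psi>: "\<And>x. GDERIV \<phi> x :> \<psi> x" by blast
  obtain K where K: "K \<subseteq> \<Omega>" "cont_supp K \<phi>" "cont_supp K \<psi>" using test_fun_cont_supp[OF \<phi> \<psi>] by blast
  show "(LINT x|lebesgue_on \<Omega>. (u x - v x) *\<^sub>R \<psi> x) = - (LINT x|lebesgue_on \<Omega>. \<phi> x *\<^sub>R (g x - h x))"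
    using weak_gradientD[OF u \<phi> \<psi>] weak_gradientD[OF v \<phi> \<psi>]
      integrable_cont_supp_scaleR[OF K(2,1) L(3) \<Omega>] integrable_cont_supp_scaleR[OF K(2,1) L(4) \<Omega>]
      integrable_L1_loc_scaleR[OF K(3,1) L(1) \<Omega>] integrable_L1_loc_scaleR[OF K(3,1) L(2) \<Omega>]
    by (simp add: scaleR_diff_left scaleR_diff_right)
qed

text \<open>A product of two test functions is a test function, so \<open>\<phi> \<theta>\<close> can be used in the definition of the
  weak gradient of \<open>u\<close>.\<close>
lemma weak_gradient_mult_test_fun:
  assumes \<Omega>: "\<Omega> \<in> sets lebesgue" and u: "weak_gradient \<Omega> u g"
    and \<phi>: "\<phi> \<in> test_fun \<Omega>" "\<And>x. GDERIV \<phi> x :> \<psi> x"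
  shows "weak_gradient \<Omega> (\<lambda>x. u x * \<phi> x) (\<lambda>x. u x *\<^sub>R \<psi> x + \<phi> x *\<^sub>R g x)"
  unfolding weak_gradient_def
proof (intro conjI ballI allI impI)
  have L: "u \<in> L1_loc \<Omega>" "g \<in> L1_loc \<Omega>" using u by (auto simp: weak_gradient_def)
  obtain K where K: "K \<subseteq> \<Omega>" "cont_supp K \<phi>" "cont_supp K \<psi>" using test_fun_cont_supp[OF \<phi>] by blast
  show "(\<lambda>x. u x * \<phi> x) \<in> L1_loc \<Omega>"
    using integrable_L1_loc[OF \<Omega> integrable_L1_loc_scaleR[OF K(2,1) L(1) \<Omega>]] by simp
  show "(\<lambda>x. u x *\<^sub>R \<psi> x + \<phi> x *\<^sub>R g x) \<in> L1_loc \<Omega>"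
    by (intro integrable_L1_loc[OF \<Omega>] Bochner_Integration.integrable_add
        integrable_L1_loc_scaleR[OF K(3,1) L(1) \<Omega>] integrable_cont_supp_scaleR[OF K(2,1) L(2) \<Omega>])
  fix \<theta> \<xi> assume \<theta>: "\<theta> \<in> test_fun \<Omega>" and "\<forall>x. GDERIV \<theta> x :> \<xi> x"
  then have \<xi>: "\<And>x. GDERIV \<theta> x :> \<xi> x" by blast
  obtain K' where K': "cont_supp K' \<theta>" "cont_supp K' \<xi>" using test_fun_cont_supp[OF \<theta> \<xi>] by blast
  have c: "cont_supp K (\<lambda>x. \<phi> x *\<^sub>R \<xi> x)" "cont_supp K (\<lambda>x. \<theta> x *\<^sub>R \<psi> x)" "cont_supp K (\<lambda>x. \<theta> x * \<phi> x)"
    using K K' unfolding cont_supp_def by (auto intro!: continuous_intros)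
  note i1 = integrable_L1_loc_scaleR[OF c(1) K(1) L(1) \<Omega>]
  note i2 = integrable_L1_loc_scaleR[OF c(2) K(1) L(1) \<Omega>]
  note i3 = integrable_cont_supp_scaleR[OF c(3) K(1) L(2) \<Omega>]
  have "(LINT x|lebesgue_on \<Omega>. u x *\<^sub>R (\<theta> x *\<^sub>R \<psi> x + \<phi> x *\<^sub>R \<xi> x)) = - (LINT x|lebesgue_on \<Omega>. (\<theta> x * \<phi> x) *\<^sub>R g x)"
    by (rule weak_gradientD[OF u test_fun_product[OF \<theta> \<phi>(1)] GDERIV_mult[OF \<xi> \<phi>(2)]])
  then have "(LINT x|lebesgue_on \<Omega>. u x *\<^sub>R \<phi> x *\<^sub>R \<xi> x) =
      - ((LINT x|lebesgue_on \<Omega>. u x *\<^sub>R \<theta> x *\<^sub>R \<psi> x) + (LINT x|lebesgue_on \<Omega>. (\<theta> x * \<phi> x) *\<^sub>R g x))"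
    unfolding scaleR_add_right using i1 i2 by (simp add: algebra_simps eq_neg_iff_add_eq_0)
  also have "(LINT x|lebesgue_on \<Omega>. u x *\<^sub>R \<theta> x *\<^sub>R \<psi> x) + (LINT x|lebesgue_on \<Omega>. (\<theta> x * \<phi> x) *\<^sub>R g x)
      = (LINT x|lebesgue_on \<Omega>. u x *\<^sub>R \<theta> x *\<^sub>R \<psi> x + (\<theta> x * \<phi> x) *\<^sub>R g x)"
    using i2 i3 by simp
  also have "(\<lambda>x. u x *\<^sub>R \<theta> x *\<^sub>R \<psi> x + (\<theta> x * \<phi> x) *\<^sub>R g x) = (\<lambda>x. \<theta> x *\<^sub>R (u x *\<^sub>R \<psi> x + \<phi> x *\<^sub>R g x))"
    by (simp add: fun_eq_iff scaleR_add_right mult.commute)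
  finally show "(LINT x|lebesgue_on \<Omega>. (u x * \<phi> x) *\<^sub>R \<xi> x) =
      - (LINT x|lebesgue_on \<Omega>. \<theta> x *\<^sub>R (u x *\<^sub>R \<psi> x + \<phi> x *\<^sub>R g x))" by simp
qed

lemma grad_weak_gradient: "weak_gradient \<Omega> u g \<Longrightarrow> weak_gradient \<Omega> u (grad \<Omega> u)"
  unfolding grad_def by (rule someI[of "weak_gradient \<Omega> u"])

lemma grad_AE_eq:
  "open \<Omega> \<Longrightarrow> weak_gradient \<Omega> u g \<Longrightarrow> AE x in lebesgue_on \<Omega>. grad \<Omega> u x = g x"
  by (rule weak_gradient_unique[OF _ grad_weak_gradient])

text \<open>A weighted arithmetic-geometric mean inequality, which takes the role of the Cauchy-Schwarz
  inequality when square-integrable functions are tested against compactly supported ones.\<close>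
lemma nn_integral_cont_supp_le:
  assumes \<Omega>: "\<Omega> \<in> sets lebesgue" and f: "f \<in> borel_measurable (lebesgue_on \<Omega>)"
    and K: "compact K" and \<theta>: "\<And>x. x \<notin> K \<Longrightarrow> \<theta> x = 0" "\<And>x. \<theta> x \<le> B" "\<And>x. 0 \<le> \<theta> x" and B: "B > 0"
    and \<delta>: "\<delta> > 0" "L2_norm_sq \<Omega> f \<le> ennreal (\<delta>\<^sup>2)"
  shows "(\<integral>\<^sup>+x. ennreal (\<theta> x * norm (f x)) \<partial>lebesgue_on \<Omega>) \<le> ennreal (B * \<delta> * (measure lborel K + 1))"
proof -
  have Ks: "K \<in> sets borel" using K by (simp add: borel_compact)
  have fin: "emeasure lborel K < \<infinity>" using K by (intro emeasure_bounded_finite compact_imp_bounded)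
  have Km: "(indicator K :: 'a \<Rightarrow> ennreal) \<in> borel_measurable (lebesgue_on \<Omega>)"
  proof -
    have "(indicator K :: 'a \<Rightarrow> ennreal) \<in> borel_measurable lebesgue" using Ks by (simp add: measurable_completion)
    then show ?thesis by (rule measurable_restrict_space1)
  qed
  have "(\<integral>\<^sup>+x. ennreal (\<theta> x * norm (f x)) \<partial>lebesgue_on \<Omega>)
      \<le> (\<integral>\<^sup>+x. ennreal (B * \<delta>) * indicator K x + ennreal (B / \<delta>) * ennreal ((norm (f x))\<^sup>2) \<partial>lebesgue_on \<Omega>)"
  proof (rule nn_integral_mono)
    fix x
    have *: "norm (f x) \<le> \<delta> + (norm (f x))\<^sup>2 / \<delta>"
    proof -
      have "norm (f x) * \<delta> \<le> \<delta>\<^sup>2 + (norm (f x))\<^sup>2"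
      proof -
        have "0 \<le> norm (f x) * \<delta>" using \<delta> by simp
        then show ?thesis using sum_squares_bound[of "norm (f x)" \<delta>] by linarith
      qed
      then show ?thesis using \<delta> by (simp add: field_simps power2_eq_square)
    qed
    show "ennreal (\<theta> x * norm (f x)) \<le> ennreal (B * \<delta>) * indicator K x + ennreal (B / \<delta>) * ennreal ((norm (f x))\<^sup>2)"
    proof (cases "x \<in> K")
      case True
      have "\<theta> x * norm (f x) \<le> B * (\<delta> + (norm (f x))\<^sup>2 / \<delta>)"
        using * \<theta> B by (intro mult_mono) auto
      then have "ennreal (\<theta> x * norm (f x)) \<le> ennreal (B * \<delta> + B / \<delta> * (norm (f x))\<^sup>2)"
        by (intro ennreal_leI) (simp add: distrib_left)
      then show ?thesis using True B \<delta> by (simp add: ennreal_plus ennreal_mult[symmetric])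
    qed (use \<theta> in simp)
  qed
  also have "\<dots> = ennreal (B * \<delta>) * (\<integral>\<^sup>+x. indicator K x \<partial>lebesgue_on \<Omega>) + ennreal (B / \<delta>) * L2_norm_sq \<Omega> f"
    unfolding L2_norm_sq_def using f Km by (simp add: nn_integral_add nn_integral_cmult)
  also have "\<dots> \<le> ennreal (B * \<delta>) * ennreal (measure lborel K) + ennreal (B / \<delta>) * ennreal (\<delta>\<^sup>2)"
  proof (intro add_mono mult_left_mono \<delta>)
    have "(\<integral>\<^sup>+x. indicator K x \<partial>lebesgue_on \<Omega>) = (\<integral>\<^sup>+x. indicator K x * indicator \<Omega> x \<partial>lebesgue)"
      using \<Omega> by (subst nn_integral_restrict_space) auto
    also have "\<dots> \<le> (\<integral>\<^sup>+x. indicator K x \<partial>lebesgue)"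
      by (rule nn_integral_mono) (auto simp: indicator_def)
    also have "\<dots> = emeasure lborel K" using Ks by (simp add: emeasure_completion)
    also have "\<dots> = ennreal (measure lborel K)" using fin by (intro emeasure_eq_ennreal_measure) auto
    finally show "(\<integral>\<^sup>+x. indicator K x \<partial>lebesgue_on \<Omega>) \<le> ennreal (measure lborel K)" .
  qed auto
  also have "\<dots> = ennreal (B * \<delta> * measure lborel K + B / \<delta> * \<delta>\<^sup>2)"
    using B \<delta> by (simp add: ennreal_plus ennreal_mult[symmetric])
  also have "B * \<delta> * measure lborel K + B / \<delta> * \<delta>\<^sup>2 = B * \<delta> * (measure lborel K + 1)"
    using \<delta> by (simp add: field_simps power2_eq_square)
  finally show ?thesis .
qed

text \<open>The two sides of the defining identity are continuous in \<open>w\<close> and \<open>g\<close> for the \<open>L\<^sup>2\<close> distance, and they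
  agree for the approximating test functions.\<close>
lemma H10_pair_weak_gradient:
  assumes \<Omega>: "\<Omega> \<in> sets lebesgue" and p: "H10_pair \<Omega> w g"
  shows "weak_gradient \<Omega> w g"
  unfolding weak_gradient_def
proof (intro conjI ballI allI impI)
  show Lw: "w \<in> L1_loc \<Omega>" and Lg: "g \<in> L1_loc \<Omega>"
    using L2_L1_loc[OF \<Omega>] H10_pair_measurable[OF p] H10_pair_finite[OF \<Omega> p] by auto
  fix \<theta> \<xi> assume \<theta>: "\<theta> \<in> test_fun \<Omega>" and "\<forall>x. GDERIV \<theta> x :> \<xi> x"
  then have \<xi>: "\<And>x. GDERIV \<theta> x :> \<xi> x" by blast
  obtain K where K: "K \<subseteq> \<Omega>" "cont_supp K \<theta>" "cont_supp K \<xi>" using test_fun_cont_supp[OF \<theta> \<xi>] by blast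
  have cK: "compact K" using K by (simp add: cont_supp_def)
  obtain B1 where B1: "B1 > 0" "\<And>x. norm (\<theta> x) \<le> B1" using cont_supp_bounded[OF K(2)] by blast
  obtain B2 where B2: "B2 > 0" "\<And>x. norm (\<xi> x) \<le> B2" using cont_supp_bounded[OF K(3)] by blast
  let ?X = "(LINT x|lebesgue_on \<Omega>. w x *\<^sub>R \<xi> x) + (LINT x|lebesgue_on \<Omega>. \<theta> x *\<^sub>R g x)"
  define C where "C = (B1 + B2) * (measure lborel K + 1)"
  have C: "C > 0" unfolding C_def using B1 B2 by (intro mult_pos_pos) (auto intro: add_nonneg_pos)
  have bound: "norm ?X \<le> C * \<delta>" if \<delta>: "\<delta> > 0" for \<delta>
  proof -
    have "\<delta>\<^sup>2 > 0" using \<delta> by simp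
    then obtain \<phi> \<psi> where \<phi>: "\<phi> \<in> test_fun \<Omega>" "\<And>x. GDERIV \<phi> x :> \<psi> x"
      "L2_dist_sq \<Omega> w \<phi> < ennreal (\<delta>\<^sup>2)" "L2_dist_sq \<Omega> g \<psi> < ennreal (\<delta>\<^sup>2)"
      using H10_pairE[OF p] by metis
    have wd: "weak_gradient \<Omega> \<phi> \<psi>" by (rule weak_gradient_test_fun[OF \<Omega> \<phi>(1,2)])
    then have L: "\<phi> \<in> L1_loc \<Omega>" "\<psi> \<in> L1_loc \<Omega>" by (auto simp: weak_gradient_def)
    note m = H10_pair_measurable[OF p] test_fun_measurable[OF \<Omega> \<phi>(1,2)]
    have i1: "integrable (lebesgue_on \<Omega>) (\<lambda>x. (w x - \<phi> x) *\<^sub>R \<xi> x)"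
      by (rule integrable_L1_loc_scaleR[OF K(3,1) L1_loc_diff[OF Lw L(1)] \<Omega>])
    have i2: "integrable (lebesgue_on \<Omega>) (\<lambda>x. \<theta> x *\<^sub>R (g x - \<psi> x))"
      by (rule integrable_cont_supp_scaleR[OF K(2,1) L1_loc_diff[OF Lg L(2)] \<Omega>])
    have "?X = (LINT x|lebesgue_on \<Omega>. (w x - \<phi> x) *\<^sub>R \<xi> x) + (LINT x|lebesgue_on \<Omega>. \<theta> x *\<^sub>R (g x - \<psi> x))"
      using weak_gradientD[OF wd \<theta> \<xi>]
        integrable_L1_loc_scaleR[OF K(3,1) Lw \<Omega>] integrable_L1_loc_scaleR[OF K(3,1) L(1) \<Omega>]
        integrable_cont_supp_scaleR[OF K(2,1) Lg \<Omega>] integrable_cont_supp_scaleR[OF K(2,1) L(2) \<Omega>]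
      by (simp add: scaleR_diff_left scaleR_diff_right)
    then have "norm ?X \<le> norm (LINT x|lebesgue_on \<Omega>. (w x - \<phi> x) *\<^sub>R \<xi> x) + norm (LINT x|lebesgue_on \<Omega>. \<theta> x *\<^sub>R (g x - \<psi> x))"
      by (simp add: norm_triangle_ineq)
    also have "\<dots> \<le> B2 * \<delta> * (measure lborel K + 1) + B1 * \<delta> * (measure lborel K + 1)"
    proof (rule add_mono)
      have "ennreal (norm (LINT x|lebesgue_on \<Omega>. (w x - \<phi> x) *\<^sub>R \<xi> x)) \<le> (\<integral>\<^sup>+x. norm ((w x - \<phi> x) *\<^sub>R \<xi> x) \<partial>lebesgue_on \<Omega>)"
        by (rule integral_norm_bound_ennreal[OF i1])
      also have "\<dots> = (\<integral>\<^sup>+x. ennreal (norm (\<xi> x) * norm (w x - \<phi> x)) \<partial>lebesgue_on \<Omega>)"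
        by (simp add: mult.commute)
      also have "\<dots> \<le> ennreal (B2 * \<delta> * (measure lborel K + 1))"
        by (rule nn_integral_cont_supp_le[OF \<Omega> _ cK])
          (use m \<phi>(3) B2 K(3) \<delta> in \<open>auto simp: cont_supp_def L2_dist_sq_eq_L2_norm_sq\<close>)
      finally show "norm (LINT x|lebesgue_on \<Omega>. (w x - \<phi> x) *\<^sub>R \<xi> x) \<le> B2 * \<delta> * (measure lborel K + 1)"
        using B2 \<delta> by (subst (asm) ennreal_le_iff) auto
      have "ennreal (norm (LINT x|lebesgue_on \<Omega>. \<theta> x *\<^sub>R (g x - \<psi> x))) \<le> (\<integral>\<^sup>+x. norm (\<theta> x *\<^sub>R (g x - \<psi> x)) \<partial>lebesgue_on \<Omega>)"
        by (rule integral_norm_bound_ennreal[OF i2])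
      also have "\<dots> = (\<integral>\<^sup>+x. ennreal (norm (\<theta> x) * norm (g x - \<psi> x)) \<partial>lebesgue_on \<Omega>)" by simp
      also have "\<dots> \<le> ennreal (B1 * \<delta> * (measure lborel K + 1))"
        by (rule nn_integral_cont_supp_le[OF \<Omega> _ cK])
          (use m \<phi>(4) B1 K(2) \<delta> in \<open>auto simp: cont_supp_def L2_dist_sq_eq_L2_norm_sq\<close>)
      finally show "norm (LINT x|lebesgue_on \<Omega>. \<theta> x *\<^sub>R (g x - \<psi> x)) \<le> B1 * \<delta> * (measure lborel K + 1)"
        using B1 \<delta> by (subst (asm) ennreal_le_iff) auto
    qed
    also have "\<dots> = C * \<delta>" by (simp add: C_def algebra_simps)
    finally show ?thesis .
  qed
  have "norm ?X \<le> 0"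
  proof (rule field_le_epsilon)
    fix e :: real assume "e > 0"
    then have "norm ?X \<le> C * (e / C)" using C by (intro bound) simp
    then show "norm ?X \<le> 0 + e" using C by simp
  qed
  then show "(LINT x|lebesgue_on \<Omega>. w x *\<^sub>R \<xi> x) = - (LINT x|lebesgue_on \<Omega>. \<theta> x *\<^sub>R g x)"
    by (simp add: eq_neg_iff_add_eq_0)
qed

lemma H10_pair_grad:
  assumes "open \<Omega>" "H10_pair \<Omega> w g"
  shows "AE x in lebesgue_on \<Omega>. grad \<Omega> w x = g x"
  by (rule grad_AE_eq[OF assms(1) H10_pair_weak_gradient[OF _ assms(2)]])
    (use assms in \<open>simp add: lebesgue_openin\<close>)

lemma grad_diff_test_fun:
  assumes \<Omega>: "open \<Omega>" and w: "weak_gradient \<Omega> w g" and \<phi>: "\<phi> \<in> test_fun \<Omega>" "\<And>x. GDERIV \<phi> x :> \<psi> x"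
  shows "AE x in lebesgue_on \<Omega>. grad \<Omega> (\<lambda>x. w x - \<phi> x) x = g x - \<psi> x"
proof -
  have \<Omega>s: "\<Omega> \<in> sets lebesgue" using \<Omega> by (simp add: lebesgue_openin)
  show ?thesis
    by (rule grad_AE_eq[OF \<Omega> weak_gradient_diff[OF \<Omega>s w weak_gradient_test_fun[OF \<Omega>s \<phi>]]])
qed

lemma H1_norm_diff_test_fun:
  assumes \<Omega>: "open \<Omega>" and w: "weak_gradient \<Omega> w g" and \<phi>: "\<phi> \<in> test_fun \<Omega>" "\<And>x. GDERIV \<phi> x :> \<psi> x"
    and m: "w \<in> borel_measurable (lebesgue_on \<Omega>)" "g \<in> borel_measurable (lebesgue_on \<Omega>)"
  shows "H1_norm \<Omega> (\<lambda>x. w x - \<phi> x) = sqrt (enn2real (L2_dist_sq \<Omega> w \<phi>) + enn2real (L2_dist_sq \<Omega> g \<psi>))"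
proof -
  have \<Omega>s: "\<Omega> \<in> sets lebesgue" using \<Omega> by (simp add: lebesgue_openin)
  note m' = test_fun_measurable[OF \<Omega>s \<phi>]
  note ae = grad_diff_test_fun[OF \<Omega> w \<phi>]
  have "(\<lambda>x. g x - \<psi> x) \<in> borel_measurable (lebesgue_on \<Omega>)" using m m' by simp
  then have gm: "grad \<Omega> (\<lambda>x. w x - \<phi> x) \<in> borel_measurable (lebesgue_on \<Omega>)"
    by (rule AE_lebesgue_on_measurable_cong[OF \<Omega>s]) (use ae in eventually_elim, simp)
  have "L2_norm_sq \<Omega> (grad \<Omega> (\<lambda>x. w x - \<phi> x)) = L2_dist_sq \<Omega> g \<psi>"
    unfolding L2_norm_sq_def L2_dist_sq_def by (rule nn_integral_cong_AE) (use ae in eventually_elim, simp)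
  then show ?thesis
    unfolding H1_norm_def using m m' by (simp add: Lp_norm_2[OF gm] Lp_norm_2 L2_dist_sq_eq_L2_norm_sq)
qed

lemma H10_pair_sequence:
  assumes \<Omega>: "\<Omega> \<in> sets lebesgue" and p: "H10_pair \<Omega> w g"
  obtains \<phi> \<psi> where "\<And>n::nat. \<phi> n \<in> test_fun \<Omega>" "\<And>n x. GDERIV (\<phi> n) x :> \<psi> n x"
    "\<And>n. L2_dist_sq \<Omega> w (\<phi> n) < ennreal ((1 / 2) ^ n)" "\<And>n. L2_dist_sq \<Omega> g (\<psi> n) < ennreal ((1 / 2) ^ n)"
proof -
  have "\<forall>n::nat. \<exists>\<phi> \<psi>. \<phi> \<in> test_fun \<Omega> \<and> (\<forall>x. GDERIV \<phi> x :> \<psi> x) \<and>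
      L2_dist_sq \<Omega> w \<phi> < ennreal ((1 / 2) ^ n) \<and> L2_dist_sq \<Omega> g \<psi> < ennreal ((1 / 2) ^ n)"
  proof
    fix n :: nat
    have "0 < (1 / 2 :: real) ^ n" by simp
    then show "\<exists>\<phi> \<psi>. \<phi> \<in> test_fun \<Omega> \<and> (\<forall>x. GDERIV \<phi> x :> \<psi> x) \<and>
      L2_dist_sq \<Omega> w \<phi> < ennreal ((1 / 2) ^ n) \<and> L2_dist_sq \<Omega> g \<psi> < ennreal ((1 / 2) ^ n)"
      using p unfolding H10_pair_def by blast
  qed
  then show ?thesis using that by metis
qed

lemma H10_pair_H10:
  assumes \<Omega>: "open \<Omega>" and p: "H10_pair \<Omega> w g"
  shows "w \<in> H10 \<Omega>"
proof -
  have \<Omega>s: "\<Omega> \<in> sets lebesgue" using \<Omega> by (simp add: lebesgue_openin)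
  note m = H10_pair_measurable[OF p] and fin = H10_pair_finite[OF \<Omega>s p]
  have wg: "weak_gradient \<Omega> w g" by (rule H10_pair_weak_gradient[OF \<Omega>s p])
  have "w \<in> H1 \<Omega>" unfolding H1_def using wg m fin by (auto simp: Lp_2_iff)
  obtain \<phi> \<psi> where \<phi>: "\<And>n. \<phi> n \<in> test_fun \<Omega>" "\<And>n x. GDERIV (\<phi> n) x :> \<psi> n x"
      "\<And>n. L2_dist_sq \<Omega> w (\<phi> n) < ennreal ((1 / 2) ^ n)" "\<And>n. L2_dist_sq \<Omega> g (\<psi> n) < ennreal ((1 / 2) ^ n)"
    using H10_pair_sequence[OF \<Omega>s p] by blast
  have small: "enn2real a \<le> e" if "a < ennreal e" "e > 0" for a e
    using enn2real_mono[of a "ennreal e"] that by simp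
  have bound: "H1_norm \<Omega> (\<lambda>x. w x - \<phi> n x) \<le> sqrt (2 * (1 / 2) ^ n)" for n
  proof -
    have "H1_norm \<Omega> (\<lambda>x. w x - \<phi> n x) = sqrt (enn2real (L2_dist_sq \<Omega> w (\<phi> n)) + enn2real (L2_dist_sq \<Omega> g (\<psi> n)))"
      by (rule H1_norm_diff_test_fun[OF \<Omega> wg \<phi>(1,2) m])
    also have "\<dots> \<le> sqrt (2 * (1 / 2) ^ n)"
      using small[OF \<phi>(3)[of n]] small[OF \<phi>(4)[of n]] by simp
    finally show ?thesis .
  qed
  have "(\<lambda>n. sqrt (2 * (1 / 2) ^ n)) \<longlonglongrightarrow> sqrt (2 * 0)"
    by (intro tendsto_intros LIMSEQ_power_zero) simp
  then have up: "(\<lambda>n. sqrt (2 * (1 / 2) ^ n)) \<longlonglongrightarrow> 0" by simp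
  have "(\<lambda>n. H1_norm \<Omega> (\<lambda>x. w x - \<phi> n x)) \<longlonglongrightarrow> 0"
    by (rule tendsto_sandwich[OF _ _ tendsto_const up])
      (use bound in \<open>auto simp: H1_norm_def intro!: always_eventually\<close>)
  then show ?thesis unfolding H10_def using \<open>w \<in> H1 \<Omega>\<close> \<phi>(1) by blast
qed

lemma H10_imp_H10_pair:
  assumes \<Omega>: "open \<Omega>" and w: "w \<in> H10 \<Omega>"
  shows "H10_pair \<Omega> w (grad \<Omega> w)"
proof -
  have \<Omega>s: "\<Omega> \<in> sets lebesgue" using \<Omega> by (simp add: lebesgue_openin)
  from w obtain g \<phi> where wL: "w \<in> Lp 2 \<Omega>" and g: "weak_gradient \<Omega> w g" "g \<in> Lp 2 \<Omega>"
    and \<phi>: "\<And>n::nat. \<phi> n \<in> test_fun \<Omega>" and lim: "(\<lambda>n. H1_norm \<Omega> (\<lambda>x. w x - \<phi> n x)) \<longlonglongrightarrow> 0"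
    unfolding H10_def H1_def by blast
  have ae: "AE x in lebesgue_on \<Omega>. g x = grad \<Omega> w x"
    by (rule weak_gradient_unique[OF \<Omega> g(1) grad_weak_gradient[OF g(1)]])
  have m: "w \<in> borel_measurable (lebesgue_on \<Omega>)" "g \<in> borel_measurable (lebesgue_on \<Omega>)"
    and fin: "L2_norm_sq \<Omega> w < \<infinity>" "L2_norm_sq \<Omega> g < \<infinity>"
    using wL g(2) by (auto simp: Lp_2_iff)
  have "H10_pair \<Omega> w g"
    unfolding H10_pair_def
  proof (intro conjI m allI impI)
    fix \<epsilon> :: real assume \<epsilon>: "\<epsilon> > 0"
    then have "sqrt \<epsilon> > 0" by simp
    with lim have "\<forall>\<^sub>F n in sequentially. dist (H1_norm \<Omega> (\<lambda>x. w x - \<phi> n x)) 0 < sqrt \<epsilon>" by (rule tendstoD)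
    then obtain n where n: "\<bar>H1_norm \<Omega> (\<lambda>x. w x - \<phi> n x)\<bar> < sqrt \<epsilon>"
      by (auto simp: eventually_sequentially)
    define f where "f = \<phi> n"
    have f: "f \<in> test_fun \<Omega>" using \<phi> by (simp add: f_def)
    obtain K \<psi> where K0: "K \<subseteq> \<Omega>" and K: "\<And>x. GDERIV f x :> \<psi> x" "cont_supp K f" "cont_supp K \<psi>"
      using test_fun_cont_suppE[OF f] by blast
    note m' = test_fun_measurable[OF \<Omega>s f K(1)]
    have lt: "sqrt (enn2real (L2_dist_sq \<Omega> w f) + enn2real (L2_dist_sq \<Omega> g \<psi>)) < sqrt \<epsilon>"
      using n[folded f_def] H1_norm_diff_test_fun[OF \<Omega> g(1) f K(1) m] by simp
    have "L2_dist_sq \<Omega> w f \<le> 2 * L2_norm_sq \<Omega> w + 2 * L2_norm_sq \<Omega> f"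
      by (rule L2_dist_sq_le_L2_norm_sq[OF m(1) m'(1)])
    also have "\<dots> < \<infinity>" using fin L2_norm_sq_cont_supp_finite[OF K(2) \<Omega>s] by (simp add: ennreal_mult_less_top)
    finally have f1: "L2_dist_sq \<Omega> w f = ennreal (enn2real (L2_dist_sq \<Omega> w f))" by (simp add: less_top)
    have "L2_dist_sq \<Omega> g \<psi> \<le> 2 * L2_norm_sq \<Omega> g + 2 * L2_norm_sq \<Omega> \<psi>"
      by (rule L2_dist_sq_le_L2_norm_sq[OF m(2) m'(2)])
    also have "\<dots> < \<infinity>" using fin L2_norm_sq_cont_supp_finite[OF K(3) \<Omega>s] by (simp add: ennreal_mult_less_top)
    finally have f2: "L2_dist_sq \<Omega> g \<psi> = ennreal (enn2real (L2_dist_sq \<Omega> g \<psi>))" by (simp add: less_top)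
    have "enn2real (L2_dist_sq \<Omega> w f) < \<epsilon>" "enn2real (L2_dist_sq \<Omega> g \<psi>) < \<epsilon>"
      using lt[unfolded real_sqrt_less_iff] enn2real_nonneg[of "L2_dist_sq \<Omega> w f"] enn2real_nonneg[of "L2_dist_sq \<Omega> g \<psi>"]
      by linarith+
    then have "L2_dist_sq \<Omega> w f < ennreal \<epsilon>" "L2_dist_sq \<Omega> g \<psi> < ennreal \<epsilon>"
      using \<epsilon> by (metis f1 ennreal_lessI, metis f2 ennreal_lessI)
    then show "\<exists>\<phi> \<psi>. \<phi> \<in> test_fun \<Omega> \<and> (\<forall>x. GDERIV \<phi> x :> \<psi> x) \<and> L2_dist_sq \<Omega> w \<phi> < ennreal \<epsilon> \<and> L2_dist_sq \<Omega> g \<psi> < ennreal \<epsilon>"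
      using f K(1) by blast
  qed
  then show ?thesis by (rule H10_pair_cong_AE[OF \<Omega>s _ _ ae]) simp
qed

section \<open>Chain rule and Poincare inequality\<close>

lemma L2_dist_sq_le_cmult:
  assumes "\<And>x. norm (f x - g x) \<le> c * norm (k x)" "0 \<le> c" "k \<in> borel_measurable (lebesgue_on \<Omega>)"
  shows "L2_dist_sq \<Omega> f g \<le> ennreal (c\<^sup>2) * L2_norm_sq \<Omega> k"
proof -
  have "L2_dist_sq \<Omega> f g \<le> (\<integral>\<^sup>+x. ennreal (c\<^sup>2) * ennreal ((norm (k x))\<^sup>2) \<partial>lebesgue_on \<Omega>)"
    unfolding L2_dist_sq_def
  proof (rule nn_integral_mono)
    fix x
    have "(norm (f x - g x))\<^sup>2 \<le> (c * norm (k x))\<^sup>2" by (rule power_mono[OF assms(1)]) simp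
    then show "ennreal ((norm (f x - g x))\<^sup>2) \<le> ennreal (c\<^sup>2) * ennreal ((norm (k x))\<^sup>2)"
      by (simp add: ennreal_mult[symmetric] power_mult_distrib ennreal_leI)
  qed
  also have "\<dots> = ennreal (c\<^sup>2) * L2_norm_sq \<Omega> k"
    unfolding L2_norm_sq_def using assms(3) by (simp add: nn_integral_cmult)
  finally show ?thesis .
qed

text \<open>Approximate the derivative by a polynomial and integrate; vanishing at \<open>0\<close> turns the bound for the
  derivatives into a bound proportional to \<open>\<bar>t\<bar>\<close>, which stays square integrable on unbounded domains.\<close>
lemma C1_approx_by_polynomial:
  fixes \<Phi> \<Phi>' :: "real \<Rightarrow> real"
  assumes "\<And>t. DERIV \<Phi> t :> \<Phi>' t" "continuous_on UNIV \<Phi>'" "\<Phi> 0 = 0" "\<eta> > 0" "M > 0"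
  obtains P Q where "real_polynomial_function P" "P 0 = 0" "\<And>t. DERIV P t :> Q t"
    "\<And>t. \<bar>t\<bar> \<le> M \<Longrightarrow> \<bar>\<Phi>' t - Q t\<bar> \<le> \<eta>" "\<And>t. \<bar>t\<bar> \<le> M \<Longrightarrow> \<bar>\<Phi> t - P t\<bar> \<le> \<eta> * \<bar>t\<bar>"
proof -
  have "compact {-M..M}" "continuous_on {-M..M} \<Phi>'"
    using assms(2) by (auto intro: continuous_on_subset)
  then obtain Q where Q: "real_polynomial_function Q" "\<And>t. t \<in> {-M..M} \<Longrightarrow> \<bar>\<Phi>' t - Q t\<bar> < \<eta>"
    using Stone_Weierstrass_real_polynomial_function assms(4) by blast
  obtain a n where an: "Q = (\<lambda>x. \<Sum>i\<le>n. a i * x ^ i)"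
    using Q(1) by (auto simp: real_polynomial_function_iff_sum)
  define P where "P = (\<lambda>x::real. \<Sum>i\<le>n. (a i / real (Suc i)) * x ^ Suc i)"
  have P: "real_polynomial_function P"
    unfolding P_def
    by (intro real_polynomial_function_sum real_polynomial_function.intros(4) real_polynomial_function_power
        real_polynomial_function.intros(2) real_polynomial_function.intros(1) bounded_linear_ident) auto
  have P0: "P 0 = 0" by (simp add: P_def)
  have dP: "DERIV P t :> Q t" for t
    unfolding P_def an
  proof (rule DERIV_sum)
    fix i
    have "DERIV (\<lambda>x. a i / real (Suc i) * x ^ Suc i) t :> a i / real (Suc i) * (real (Suc i) * t ^ i)"
      by (rule DERIV_cmult) (use DERIV_pow[of "Suc i" t] in \<open>simp del: power_Suc of_nat_Suc\<close>)
    then show "DERIV (\<lambda>x. a i / real (Suc i) * x ^ Suc i) t :> a i * t ^ i"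
      by (simp del: of_nat_Suc power_Suc)
  qed
  have "\<bar>\<Phi> t - P t\<bar> \<le> \<eta> * \<bar>t\<bar>" if t: "\<bar>t\<bar> \<le> M" for t
  proof -
    have "norm ((\<Phi> t - P t) - (\<Phi> 0 - P 0)) \<le> \<eta> * norm (t - 0)"
    proof (rule field_differentiable_bound[where S = "{-M..M}" and f = "\<lambda>t. \<Phi> t - P t" and f' = "\<lambda>t. \<Phi>' t - Q t"])
      show "((\<lambda>t. \<Phi> t - P t) has_field_derivative \<Phi>' z - Q z) (at z within {-M..M})" for z
        by (intro DERIV_diff has_field_derivative_at_within[OF assms(1)] has_field_derivative_at_within[OF dP])
      show "norm (\<Phi>' z - Q z) \<le> \<eta>" if "z \<in> {-M..M}" for z using Q(2)[OF that] by simp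
    qed (use t assms(5) in auto)
    then show ?thesis using P0 assms(3) by simp
  qed
  moreover have "\<bar>\<Phi>' t - Q t\<bar> \<le> \<eta>" if "\<bar>t\<bar> \<le> M" for t
    using Q(2)[of t] that by (simp add: abs_le_iff less_imp_le)
  ultimately show ?thesis using that P P0 dP by blast
qed

text \<open>A test function has a bounded range, on which \<open>\<Phi>\<close> is close to a polynomial in the \<open>C\<^sup>1\<close> sense.\<close>
lemma H10_pair_chain_test_fun:
  fixes \<Phi> \<Phi>' :: "real \<Rightarrow> real"
  assumes \<Omega>: "\<Omega> \<in> sets lebesgue" and d\<Phi>: "\<And>t. DERIV \<Phi> t :> \<Phi>' t" "continuous_on UNIV \<Phi>'" "\<Phi> 0 = 0"
    and \<phi>: "\<phi> \<in> test_fun \<Omega>" "\<And>x. GDERIV \<phi> x :> \<psi> x"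
  shows "H10_pair \<Omega> (\<lambda>x. \<Phi> (\<phi> x)) (\<lambda>x. \<Phi>' (\<phi> x) *\<^sub>R \<psi> x)"
  unfolding H10_pair_def
proof (intro conjI allI impI)
  obtain K where K: "cont_supp K \<phi>" "cont_supp K \<psi>" using test_fun_cont_supp[OF \<phi>] by blast
  have "continuous_on UNIV \<Phi>" using d\<Phi>(1) by (intro DERIV_continuous_on) auto
  then have "continuous_on UNIV (\<lambda>x. \<Phi> (\<phi> x))" "continuous_on UNIV (\<lambda>x. \<Phi>' (\<phi> x))"
    using K d\<Phi>(2) unfolding cont_supp_def by (auto intro: continuous_on_compose2)
  then have c: "cont_supp K (\<lambda>x. \<Phi> (\<phi> x))" "cont_supp K (\<lambda>x. \<Phi>' (\<phi> x) *\<^sub>R \<psi> x)"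
    using K d\<Phi>(3) unfolding cont_supp_def by (auto intro!: continuous_intros)
  show "(\<lambda>x. \<Phi> (\<phi> x)) \<in> borel_measurable (lebesgue_on \<Omega>)"
    "(\<lambda>x. \<Phi>' (\<phi> x) *\<^sub>R \<psi> x) \<in> borel_measurable (lebesgue_on \<Omega>)"
    using cont_supp_measurable[OF _ \<Omega>] c by auto
  obtain M where M: "M > 0" "\<And>x. norm (\<phi> x) \<le> M" using cont_supp_bounded[OF K(1)] by blast
  fix \<epsilon> :: real assume \<epsilon>: "\<epsilon> > 0"
  define s1 s2 where "s1 = enn2real (L2_norm_sq \<Omega> \<phi>)" and "s2 = enn2real (L2_norm_sq \<Omega> \<psi>)"
  have s: "L2_norm_sq \<Omega> \<phi> = ennreal s1" "L2_norm_sq \<Omega> \<psi> = ennreal s2" "s1 \<ge> 0" "s2 \<ge> 0"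
    using L2_norm_sq_cont_supp_finite[OF K(1) \<Omega>] L2_norm_sq_cont_supp_finite[OF K(2) \<Omega>] by (simp_all add: s1_def s2_def less_top)
  \<comment> \<open>The accuracy for which \<open>\<eta>\<^sup>2\<close> times either squared norm is below \<open>\<epsilon>\<close>.\<close>
  define \<eta> where "\<eta> = sqrt (\<epsilon> / (s1 + s2 + 1))"
  have pos: "s1 + s2 + 1 > 0" using s by linarith
  have \<eta>: "\<eta> > 0" using pos \<epsilon> by (simp add: \<eta>_def)
  have \<eta>2: "\<eta>\<^sup>2 = \<epsilon> / (s1 + s2 + 1)" using pos \<epsilon> by (simp add: \<eta>_def)
  have lt: "\<eta>\<^sup>2 * s1 < \<epsilon>" "\<eta>\<^sup>2 * s2 < \<epsilon>"
  proof -
    have "\<eta>\<^sup>2 * s1 < \<eta>\<^sup>2 * (s1 + s2 + 1)" "\<eta>\<^sup>2 * s2 < \<eta>\<^sup>2 * (s1 + s2 + 1)"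
      using \<eta> s by (intro mult_strict_left_mono; simp)+
    moreover have "\<eta>\<^sup>2 * (s1 + s2 + 1) = \<epsilon>" unfolding \<eta>2 using pos by simp
    ultimately show "\<eta>\<^sup>2 * s1 < \<epsilon>" "\<eta>\<^sup>2 * s2 < \<epsilon>" by linarith+
  qed
  obtain P Q where P: "real_polynomial_function P" "P 0 = 0" "\<And>t. DERIV P t :> Q t"
    and PQ: "\<And>t. \<bar>t\<bar> \<le> M \<Longrightarrow> \<bar>\<Phi>' t - Q t\<bar> \<le> \<eta>" "\<And>t. \<bar>t\<bar> \<le> M \<Longrightarrow> \<bar>\<Phi> t - P t\<bar> \<le> \<eta> * \<bar>t\<bar>"
    using C1_approx_by_polynomial[OF d\<Phi> \<eta> M(1)] by blast
  have "L2_dist_sq \<Omega> (\<lambda>x. \<Phi> (\<phi> x)) (\<lambda>x. P (\<phi> x)) \<le> ennreal (\<eta>\<^sup>2) * L2_norm_sq \<Omega> \<phi>"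
    by (rule L2_dist_sq_le_cmult) (use PQ(2) M \<eta> cont_supp_measurable[OF K(1) \<Omega>] in auto)
  also have "\<dots> = ennreal (\<eta>\<^sup>2 * s1)" using s by (simp add: ennreal_mult)
  also have "\<dots> < ennreal \<epsilon>" using lt(1) \<epsilon> by (simp add: ennreal_lessI)
  finally have 1: "L2_dist_sq \<Omega> (\<lambda>x. \<Phi> (\<phi> x)) (\<lambda>x. P (\<phi> x)) < ennreal \<epsilon>" .
  have "L2_dist_sq \<Omega> (\<lambda>x. \<Phi>' (\<phi> x) *\<^sub>R \<psi> x) (\<lambda>x. Q (\<phi> x) *\<^sub>R \<psi> x) \<le> ennreal (\<eta>\<^sup>2) * L2_norm_sq \<Omega> \<psi>"
  proof (rule L2_dist_sq_le_cmult)
    fix x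
    have "norm (\<Phi>' (\<phi> x) *\<^sub>R \<psi> x - Q (\<phi> x) *\<^sub>R \<psi> x) = \<bar>\<Phi>' (\<phi> x) - Q (\<phi> x)\<bar> * norm (\<psi> x)"
      by (simp add: scaleR_diff_left[symmetric])
    also have "\<dots> \<le> \<eta> * norm (\<psi> x)" using PQ(1) M by (intro mult_right_mono) auto
    finally show "norm (\<Phi>' (\<phi> x) *\<^sub>R \<psi> x - Q (\<phi> x) *\<^sub>R \<psi> x) \<le> \<eta> * norm (\<psi> x)" .
  qed (use \<eta> cont_supp_measurable[OF K(2) \<Omega>] in auto)
  also have "\<dots> = ennreal (\<eta>\<^sup>2 * s2)" using s by (simp add: ennreal_mult)
  also have "\<dots> < ennreal \<epsilon>" using lt(2) \<epsilon> by (simp add: ennreal_lessI)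
  finally have 2: "L2_dist_sq \<Omega> (\<lambda>x. \<Phi>' (\<phi> x) *\<^sub>R \<psi> x) (\<lambda>x. Q (\<phi> x) *\<^sub>R \<psi> x) < ennreal \<epsilon>" .
  have "(\<lambda>x. P (\<phi> x)) \<in> test_fun \<Omega>" by (rule test_fun_polynomial[OF \<phi>(1) P(1,2)])
  moreover have "GDERIV (\<lambda>x. P (\<phi> x)) x :> Q (\<phi> x) *\<^sub>R \<psi> x" for x
    by (rule GDERIV_DERIV_compose[OF \<phi>(2) P(3)])
  ultimately show "\<exists>\<phi>' \<psi>'. \<phi>' \<in> test_fun \<Omega> \<and> (\<forall>x. GDERIV \<phi>' x :> \<psi>' x) \<and>
      L2_dist_sq \<Omega> (\<lambda>x. \<Phi> (\<phi> x)) \<phi>' < ennreal \<epsilon> \<and> L2_dist_sq \<Omega> (\<lambda>x. \<Phi>' (\<phi> x) *\<^sub>R \<psi> x) \<psi>' < ennreal \<epsilon>"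
    using 1 2 by (intro exI[of _ "\<lambda>x. P (\<phi> x)"] exI[of _ "\<lambda>x. Q (\<phi> x) *\<^sub>R \<psi> x"]) simp
qed

text \<open>Summable squared distances make the series of squared differences finite almost everywhere, so
  its terms tend to zero.\<close>
lemma L2_dist_sq_summable_AE_tendsto:
  assumes f: "\<And>n. f n \<in> borel_measurable (lebesgue_on \<Omega>)" "g \<in> borel_measurable (lebesgue_on \<Omega>)"
    and small: "\<And>n. L2_dist_sq \<Omega> g (f n) < ennreal ((1 / 2) ^ n)"
  shows "AE x in lebesgue_on \<Omega>. (\<lambda>n. f n x) \<longlonglongrightarrow> g x"
proof -
  have "(\<integral>\<^sup>+x. (\<Sum>n. ennreal ((norm (g x - f n x))\<^sup>2)) \<partial>lebesgue_on \<Omega>) = (\<Sum>n. L2_dist_sq \<Omega> g (f n))"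
    unfolding L2_dist_sq_def using f by (intro nn_integral_suminf) simp
  also have "\<dots> \<le> (\<Sum>n. ennreal ((1 / 2) ^ n))"
    using small by (intro suminf_le less_imp_le) auto
  also have "\<dots> = ennreal (\<Sum>n. (1 / 2) ^ n)"
    by (rule suminf_ennreal2) (auto intro: summable_geometric)
  also have "\<dots> < \<infinity>" unfolding infinity_ennreal_def by (rule ennreal_less_top)
  finally have "AE x in lebesgue_on \<Omega>. (\<Sum>n. ennreal ((norm (g x - f n x))\<^sup>2)) \<noteq> \<infinity>"
    using f by (intro nn_integral_PInf_AE) auto
  then show ?thesis
  proof eventually_elim
    case (elim x)
    then have "summable (\<lambda>n. (norm (g x - f n x))\<^sup>2)"
      by (intro summable_suminf_not_top) auto
    then have "(\<lambda>n. (norm (g x - f n x))\<^sup>2) \<longlonglongrightarrow> 0" by (rule summable_LIMSEQ_zero)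
    from tendsto_real_sqrt[OF this] have "(\<lambda>n. norm (f n x - g x)) \<longlonglongrightarrow> 0"
      by (simp add: norm_minus_commute)
    then show ?case by (rule LIM_zero_cancel[OF tendsto_norm_zero_cancel])
  qed
qed

text \<open>The chain rule.  Along test functions \<open>\<phi>\<^sub>n\<close> that converge to \<open>w\<close> almost everywhere,
  \<open>\<Phi>'(\<phi>\<^sub>n) \<psi>\<^sub>n - \<Phi>'(w) g = \<Phi>'(\<phi>\<^sub>n) (\<psi>\<^sub>n - g) + (\<Phi>'(\<phi>\<^sub>n) - \<Phi>'(w)) g\<close>; the first term is small because \<open>\<Phi>'\<close> is
  bounded, the second by dominated convergence.\<close>
lemma H10_pair_chain:
  fixes \<Phi> \<Phi>' :: "real \<Rightarrow> real"
  assumes \<Omega>: "\<Omega> \<in> sets lebesgue" and d\<Phi>: "\<And>t. DERIV \<Phi> t :> \<Phi>' t" "continuous_on UNIV \<Phi>'" "\<Phi> 0 = 0"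
    and C: "\<And>t. \<bar>\<Phi>' t\<bar> \<le> C" and p: "H10_pair \<Omega> w g"
  shows "H10_pair \<Omega> (\<lambda>x. \<Phi> (w x)) (\<lambda>x. \<Phi>' (w x) *\<^sub>R g x)"
proof -
  obtain \<phi> \<psi> where \<phi>: "\<And>n::nat. \<phi> n \<in> test_fun \<Omega>" "\<And>n x. GDERIV (\<phi> n) x :> \<psi> n x"
    and sm: "\<And>n. L2_dist_sq \<Omega> w (\<phi> n) < ennreal ((1 / 2) ^ n)" "\<And>n. L2_dist_sq \<Omega> g (\<psi> n) < ennreal ((1 / 2) ^ n)"
    using H10_pair_sequence[OF \<Omega> p] by blast
  have C0: "C \<ge> 0" using C[of 0] by linarith
  note wm = H10_pair_measurable[OF p]
  note \<phi>m = test_fun_measurable[OF \<Omega> \<phi>]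
  have c\<Phi>: "continuous_on UNIV \<Phi>" using d\<Phi>(1) by (intro DERIV_continuous_on) auto
  have bm: "\<Phi> \<in> borel_measurable borel" "\<Phi>' \<in> borel_measurable borel"
    using c\<Phi> d\<Phi>(2) by (auto intro: borel_measurable_continuous_onI)
  have m1: "(\<lambda>x. \<Phi> (v x)) \<in> borel_measurable (lebesgue_on \<Omega>)"
    "(\<lambda>x. \<Phi>' (v x)) \<in> borel_measurable (lebesgue_on \<Omega>)"
    if "v \<in> borel_measurable (lebesgue_on \<Omega>)" for v
    using measurable_compose[OF that bm(1)] measurable_compose[OF that bm(2)] by auto
  have small: "\<forall>\<^sub>F n in sequentially. C\<^sup>2 * (1 / 2) ^ n < \<epsilon>" if "\<epsilon> > 0" for \<epsilon> :: real
  proof -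
    have "(\<lambda>n. C\<^sup>2 * (1 / 2) ^ n) \<longlonglongrightarrow> C\<^sup>2 * 0"
      by (intro tendsto_intros LIMSEQ_power_zero) simp
    then show ?thesis using that by (intro order_tendstoD(2)) auto
  qed
  have lip: "\<bar>\<Phi> s - \<Phi> t\<bar> \<le> C * \<bar>s - t\<bar>" for s t
    using field_differentiable_bound[where S = UNIV and f = \<Phi> and f' = \<Phi>' and B = C and x = s and y = t] d\<Phi>(1) C
    by simp
  have A: "L2_dist_sq \<Omega> (\<lambda>x. \<Phi> (w x)) (\<lambda>x. \<Phi> (\<phi> n x)) \<le> ennreal (C\<^sup>2 * (1 / 2) ^ n)" for n
  proof -
    have "L2_dist_sq \<Omega> (\<lambda>x. \<Phi> (w x)) (\<lambda>x. \<Phi> (\<phi> n x)) \<le> ennreal (C\<^sup>2) * L2_norm_sq \<Omega> (\<lambda>x. w x - \<phi> n x)"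
      by (rule L2_dist_sq_le_cmult) (use lip C0 wm \<phi>m in auto)
    also have "\<dots> \<le> ennreal (C\<^sup>2) * ennreal ((1 / 2) ^ n)"
      using sm(1)[of n] by (intro mult_left_mono) (auto simp: L2_dist_sq_eq_L2_norm_sq)
    also have "\<dots> = ennreal (C\<^sup>2 * (1 / 2) ^ n)" by (simp add: ennreal_mult)
    finally show ?thesis .
  qed
  have B: "L2_dist_sq \<Omega> (\<lambda>x. \<Phi>' (\<phi> n x) *\<^sub>R g x) (\<lambda>x. \<Phi>' (\<phi> n x) *\<^sub>R \<psi> n x) \<le> ennreal (C\<^sup>2 * (1 / 2) ^ n)" for n
  proof -
    have "L2_dist_sq \<Omega> (\<lambda>x. \<Phi>' (\<phi> n x) *\<^sub>R g x) (\<lambda>x. \<Phi>' (\<phi> n x) *\<^sub>R \<psi> n x) \<le> ennreal (C\<^sup>2) * L2_norm_sq \<Omega> (\<lambda>x. g x - \<psi> n x)"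
    proof (rule L2_dist_sq_le_cmult)
      fix x
      show "norm (\<Phi>' (\<phi> n x) *\<^sub>R g x - \<Phi>' (\<phi> n x) *\<^sub>R \<psi> n x) \<le> C * norm (g x - \<psi> n x)"
        unfolding scaleR_diff_right[symmetric] norm_scaleR by (intro mult_right_mono C) simp
    qed (use C0 wm \<phi>m in auto)
    also have "\<dots> \<le> ennreal (C\<^sup>2) * ennreal ((1 / 2) ^ n)"
      using sm(2)[of n] by (intro mult_left_mono) (auto simp: L2_dist_sq_eq_L2_norm_sq)
    also have "\<dots> = ennreal (C\<^sup>2 * (1 / 2) ^ n)" by (simp add: ennreal_mult)
    finally show ?thesis .
  qed
  have gfin: "(\<integral>\<^sup>+x. ennreal (4 * C\<^sup>2 * (norm (g x))\<^sup>2) \<partial>lebesgue_on \<Omega>) < \<infinity>"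
  proof -
    have "(\<integral>\<^sup>+x. ennreal (4 * C\<^sup>2 * (norm (g x))\<^sup>2) \<partial>lebesgue_on \<Omega>) = ennreal (4 * C\<^sup>2) * L2_norm_sq \<Omega> g"
      unfolding L2_norm_sq_def using wm by (simp add: ennreal_mult nn_integral_cmult)
    then show ?thesis using H10_pair_finite(2)[OF \<Omega> p] by (simp add: ennreal_mult_less_top)
  qed
  have D: "(\<lambda>n. L2_dist_sq \<Omega> (\<lambda>x. \<Phi>' (w x) *\<^sub>R g x) (\<lambda>x. \<Phi>' (\<phi> n x) *\<^sub>R g x)) \<longlonglongrightarrow> (\<integral>\<^sup>+x. 0 \<partial>lebesgue_on \<Omega>)"
    unfolding L2_dist_sq_def
  proof (rule nn_integral_dominated_convergence[OF _ _ _ _ gfin])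
    show "(\<lambda>x. ennreal ((norm (\<Phi>' (w x) *\<^sub>R g x - \<Phi>' (\<phi> n x) *\<^sub>R g x))\<^sup>2)) \<in> borel_measurable (lebesgue_on \<Omega>)" for n
      using m1(2)[OF wm(1)] m1(2)[OF \<phi>m(1)[of n]] wm(2) by auto
    show "(\<lambda>x. ennreal (4 * C\<^sup>2 * (norm (g x))\<^sup>2)) \<in> borel_measurable (lebesgue_on \<Omega>)" using wm by auto
    show "AE x in lebesgue_on \<Omega>. ennreal ((norm (\<Phi>' (w x) *\<^sub>R g x - \<Phi>' (\<phi> n x) *\<^sub>R g x))\<^sup>2) \<le> ennreal (4 * C\<^sup>2 * (norm (g x))\<^sup>2)" for n
    proof (intro always_eventually allI ennreal_leI)
      fix x
      have "norm (\<Phi>' (w x) *\<^sub>R g x - \<Phi>' (\<phi> n x) *\<^sub>R g x) = \<bar>\<Phi>' (w x) - \<Phi>' (\<phi> n x)\<bar> * norm (g x)"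
        by (simp add: scaleR_diff_left[symmetric])
      also have "\<dots> \<le> (2 * C) * norm (g x)"
        using C[of "w x"] C[of "\<phi> n x"] by (intro mult_right_mono) auto
      finally have "(norm (\<Phi>' (w x) *\<^sub>R g x - \<Phi>' (\<phi> n x) *\<^sub>R g x))\<^sup>2 \<le> ((2 * C) * norm (g x))\<^sup>2"
        by (rule power_mono) simp
      then show "(norm (\<Phi>' (w x) *\<^sub>R g x - \<Phi>' (\<phi> n x) *\<^sub>R g x))\<^sup>2 \<le> 4 * C\<^sup>2 * (norm (g x))\<^sup>2"
        by (simp add: power_mult_distrib)
    qed
    have "AE x in lebesgue_on \<Omega>. (\<lambda>n. \<phi> n x) \<longlonglongrightarrow> w x"
      by (rule L2_dist_sq_summable_AE_tendsto[OF \<phi>m(1) wm(1) sm(1)])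
    then show "AE x in lebesgue_on \<Omega>. (\<lambda>n. ennreal ((norm (\<Phi>' (w x) *\<^sub>R g x - \<Phi>' (\<phi> n x) *\<^sub>R g x))\<^sup>2)) \<longlonglongrightarrow> 0"
    proof eventually_elim
      case (elim x)
      have "(\<lambda>n. \<Phi>' (\<phi> n x)) \<longlonglongrightarrow> \<Phi>' (w x)"
        by (rule isCont_tendsto_compose[OF _ elim]) (use d\<Phi>(2) in \<open>simp add: continuous_on_eq_continuous_at\<close>)
      then have "(\<lambda>n. (norm (\<Phi>' (w x) *\<^sub>R g x - \<Phi>' (\<phi> n x) *\<^sub>R g x))\<^sup>2) \<longlonglongrightarrow> (norm (\<Phi>' (w x) *\<^sub>R g x - \<Phi>' (w x) *\<^sub>R g x))\<^sup>2"
        by (intro tendsto_intros)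
      from tendsto_ennrealI[OF this] show ?case by simp
    qed
  qed simp
  show ?thesis
  proof (rule H10_pair_closed[OF \<Omega>])
    show "(\<lambda>x. \<Phi> (w x)) \<in> borel_measurable (lebesgue_on \<Omega>)" by (rule m1(1)[OF wm(1)])
    show gm: "(\<lambda>x. \<Phi>' (w x) *\<^sub>R g x) \<in> borel_measurable (lebesgue_on \<Omega>)"
      using m1(2)[OF wm(1)] wm(2) by simp
    fix \<epsilon> :: real assume \<epsilon>: "\<epsilon> > 0"
    then have \<epsilon>4: "\<epsilon> / 4 > 0" by simp
    have "\<forall>\<^sub>F n in sequentially. L2_dist_sq \<Omega> (\<lambda>x. \<Phi>' (w x) *\<^sub>R g x) (\<lambda>x. \<Phi>' (\<phi> n x) *\<^sub>R g x) < ennreal (\<epsilon> / 4)"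
      by (rule order_tendstoD(2)[OF D]) (use \<epsilon> in simp)
    with small[OF \<epsilon>] small[OF \<epsilon>4]
    have "\<forall>\<^sub>F n in sequentially. C\<^sup>2 * (1 / 2) ^ n < \<epsilon> \<and> C\<^sup>2 * (1 / 2) ^ n < \<epsilon> / 4 \<and>
        L2_dist_sq \<Omega> (\<lambda>x. \<Phi>' (w x) *\<^sub>R g x) (\<lambda>x. \<Phi>' (\<phi> n x) *\<^sub>R g x) < ennreal (\<epsilon> / 4)"
      by eventually_elim simp
    then obtain n where n: "C\<^sup>2 * (1 / 2) ^ n < \<epsilon>" "C\<^sup>2 * (1 / 2) ^ n < \<epsilon> / 4"
        "L2_dist_sq \<Omega> (\<lambda>x. \<Phi>' (w x) *\<^sub>R g x) (\<lambda>x. \<Phi>' (\<phi> n x) *\<^sub>R g x) < ennreal (\<epsilon> / 4)"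
      using eventually_happens'[OF sequentially_bot] by blast
    have "L2_dist_sq \<Omega> (\<lambda>x. \<Phi> (w x)) (\<lambda>x. \<Phi> (\<phi> n x)) < ennreal \<epsilon>"
      using A[of n] n(1) \<epsilon> by (elim order_le_less_trans) (simp add: ennreal_lessI)
    moreover have "L2_dist_sq \<Omega> (\<lambda>x. \<Phi>' (w x) *\<^sub>R g x) (\<lambda>x. \<Phi>' (\<phi> n x) *\<^sub>R \<psi> n x) < ennreal \<epsilon>"
    proof (rule L2_dist_sq_triangle_less[OF gm _ _ n(3) _ \<epsilon>])
      show "(\<lambda>x. \<Phi>' (\<phi> n x) *\<^sub>R g x) \<in> borel_measurable (lebesgue_on \<Omega>)"
        "(\<lambda>x. \<Phi>' (\<phi> n x) *\<^sub>R \<psi> n x) \<in> borel_measurable (lebesgue_on \<Omega>)"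
        using m1(2)[OF \<phi>m(1)[of n]] wm(2) \<phi>m(2)[of n] by auto
      show "L2_dist_sq \<Omega> (\<lambda>x. \<Phi>' (\<phi> n x) *\<^sub>R g x) (\<lambda>x. \<Phi>' (\<phi> n x) *\<^sub>R \<psi> n x) < ennreal (\<epsilon> / 4)"
        using B[of n] n(2) \<epsilon>4 by (elim order_le_less_trans) (simp add: ennreal_lessI)
    qed
    moreover have "H10_pair \<Omega> (\<lambda>x. \<Phi> (\<phi> n x)) (\<lambda>x. \<Phi>' (\<phi> n x) *\<^sub>R \<psi> n x)"
      by (rule H10_pair_chain_test_fun[OF \<Omega> d\<Phi> \<phi>])
    ultimately show "\<exists>w' g'. H10_pair \<Omega> w' g' \<and> L2_dist_sq \<Omega> (\<lambda>x. \<Phi> (w x)) w' < ennreal \<epsilon> \<and>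
        L2_dist_sq \<Omega> (\<lambda>x. \<Phi>' (w x) *\<^sub>R g x) g' < ennreal \<epsilon>" by blast
  qed
qed

text \<open>The derivative of \<open>(x \<bullet> b) \<phi>\<^sup>2\<close> in a coordinate direction \<open>b\<close> integrates to zero.  As \<open>\<bar>x \<bullet> b\<bar> \<le> R\<close>, this
  bounds \<open>\<integral> \<phi>\<^sup>2\<close> by \<open>2 R \<integral> \<bar>\<phi>\<bar> \<bar>\<psi>\<bar>\<close>, of which half of \<open>\<integral> \<phi>\<^sup>2\<close> can be absorbed.\<close>
lemma Poincare_test_fun:
  assumes \<Omega>: "\<Omega> \<in> sets lebesgue" and R: "R > 0" "\<And>x. x \<in> \<Omega> \<Longrightarrow> norm x \<le> R"
    and \<phi>: "\<phi> \<in> test_fun \<Omega>" "\<And>x. GDERIV \<phi> x :> \<psi> x"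
  shows "L2_norm_sq \<Omega> \<phi> \<le> ennreal (4 * R\<^sup>2) * L2_norm_sq \<Omega> \<psi>"
proof -
  obtain b :: 'a where b: "b \<in> Basis" using nonempty_Basis by blast
  obtain K where K: "K \<subseteq> \<Omega>" "cont_supp K \<phi>" "cont_supp K \<psi>" using test_fun_cont_supp[OF \<phi>] by blast
  let ?f = "\<lambda>x. (x \<bullet> b) * \<phi> x" and ?f' = "\<lambda>x. (x \<bullet> b) *\<^sub>R \<psi> x + \<phi> x *\<^sub>R b"
  have cf: "continuous_on UNIV ?f" "continuous_on UNIV ?f'"
    using K unfolding cont_supp_def by (auto intro!: continuous_intros)
  have df: "GDERIV ?f x :> ?f' x" for x
  proof -
    have "GDERIV (\<lambda>x. x \<bullet> b) x :> b"
      unfolding gderiv_def by (rule bounded_linear_imp_has_derivative[OF bounded_linear_inner_left])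
    from GDERIV_mult[OF this \<phi>(2)] show ?thesis .
  qed
  have c: "cont_supp K (\<lambda>x. ?f x *\<^sub>R \<psi> x)" "cont_supp K (\<lambda>x. \<phi> x *\<^sub>R ?f' x)" "cont_supp K (\<lambda>x. (\<phi> x)\<^sup>2)" "cont_supp K (\<lambda>x. (norm (\<psi> x))\<^sup>2)"
     "cont_supp K (\<lambda>x. - (2 * (x \<bullet> b) * \<phi> x * (\<psi> x \<bullet> b)))"
    using K unfolding cont_supp_def by (auto intro!: continuous_intros)
  note i = cont_supp_integrable[OF c(1) \<Omega>] cont_supp_integrable[OF c(2) \<Omega>] cont_supp_integrable[OF c(3) \<Omega>] cont_supp_integrable[OF c(4) \<Omega>]
    cont_supp_integrable[OF c(5) \<Omega>]
  have "(LINT x|lebesgue_on \<Omega>. ?f x *\<^sub>R \<psi> x) \<bullet> b = - (LINT x|lebesgue_on \<Omega>. \<phi> x *\<^sub>R ?f' x) \<bullet> b"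
    by (simp only: integral_by_parts_test_fun[OF \<Omega> \<phi> cf(1) df cf(2)])
  then have "(LINT x|lebesgue_on \<Omega>. (?f x *\<^sub>R \<psi> x) \<bullet> b) + (LINT x|lebesgue_on \<Omega>. (\<phi> x *\<^sub>R ?f' x) \<bullet> b) = 0"
    by (simp only: integral_inner_left[OF i(1)] integral_inner_left[OF i(2)] inner_minus_left)
  then have "(LINT x|lebesgue_on \<Omega>. (?f x *\<^sub>R \<psi> x) \<bullet> b + (\<phi> x *\<^sub>R ?f' x) \<bullet> b) = 0"
    by (subst Bochner_Integration.integral_add) (intro integrable_inner_left i)+
  also have "(\<lambda>x. (?f x *\<^sub>R \<psi> x) \<bullet> b + (\<phi> x *\<^sub>R ?f' x) \<bullet> b) = (\<lambda>x. (\<phi> x)\<^sup>2 - - (2 * (x \<bullet> b) * \<phi> x * (\<psi> x \<bullet> b)))"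
    using b by (simp add: fun_eq_iff algebra_simps power2_eq_square inner_add_left)
  finally have "(LINT x|lebesgue_on \<Omega>. (\<phi> x)\<^sup>2) = (LINT x|lebesgue_on \<Omega>. - (2 * (x \<bullet> b) * \<phi> x * (\<psi> x \<bullet> b)))"
    by (subst (asm) Bochner_Integration.integral_diff[OF i(3,5)]) simp
  also have "\<dots> \<le> (LINT x|lebesgue_on \<Omega>. (\<phi> x)\<^sup>2 / 2 + 2 * R\<^sup>2 * (norm (\<psi> x))\<^sup>2)"
  proof (rule integral_mono[OF i(5)])
    show "integrable (lebesgue_on \<Omega>) (\<lambda>x. (\<phi> x)\<^sup>2 / 2 + 2 * R\<^sup>2 * (norm (\<psi> x))\<^sup>2)" using i(3,4) by simp
    fix x assume "x \<in> space (lebesgue_on \<Omega>)"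
    then have x: "norm x \<le> R" using R(2) \<Omega> by (simp add: space_restrict_space)
    have "\<bar>x \<bullet> b\<bar> \<le> R" using Basis_le_norm[OF b, of x] x by linarith
    moreover have "\<bar>\<psi> x \<bullet> b\<bar> \<le> norm (\<psi> x)" by (rule Basis_le_norm[OF b])
    ultimately have "\<bar>x \<bullet> b\<bar> * \<bar>\<psi> x \<bullet> b\<bar> \<le> R * norm (\<psi> x)" using R(1) by (intro mult_mono) auto
    then have "2 * \<bar>\<phi> x\<bar> * (\<bar>x \<bullet> b\<bar> * \<bar>\<psi> x \<bullet> b\<bar>) \<le> 2 * \<bar>\<phi> x\<bar> * (R * norm (\<psi> x))"
      by (intro mult_left_mono) auto
    moreover have "- (2 * (x \<bullet> b) * \<phi> x * (\<psi> x \<bullet> b)) \<le> 2 * \<bar>\<phi> x\<bar> * (\<bar>x \<bullet> b\<bar> * \<bar>\<psi> x \<bullet> b\<bar>)"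
    proof -
      have "- (2 * (x \<bullet> b) * \<phi> x * (\<psi> x \<bullet> b)) \<le> \<bar>2 * (x \<bullet> b) * \<phi> x * (\<psi> x \<bullet> b)\<bar>"
        by (rule abs_ge_minus_self)
      also have "\<dots> = 2 * \<bar>\<phi> x\<bar> * (\<bar>x \<bullet> b\<bar> * \<bar>\<psi> x \<bullet> b\<bar>)" by (simp add: abs_mult)
      finally show ?thesis .
    qed
    moreover have "2 * \<bar>\<phi> x\<bar> * (R * norm (\<psi> x)) \<le> (\<phi> x)\<^sup>2 / 2 + 2 * R\<^sup>2 * (norm (\<psi> x))\<^sup>2"
    proof -
      have "2 * \<bar>\<phi> x\<bar> * (2 * (R * norm (\<psi> x))) \<le> \<bar>\<phi> x\<bar>\<^sup>2 + (2 * (R * norm (\<psi> x)))\<^sup>2"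
        by (rule sum_squares_bound)
      then show ?thesis by (simp add: power_mult_distrib)
    qed
    ultimately show "- (2 * (x \<bullet> b) * \<phi> x * (\<psi> x \<bullet> b)) \<le> (\<phi> x)\<^sup>2 / 2 + 2 * R\<^sup>2 * (norm (\<psi> x))\<^sup>2" by linarith
  qed
  also have "\<dots> = (LINT x|lebesgue_on \<Omega>. (\<phi> x)\<^sup>2) / 2 + 2 * R\<^sup>2 * (LINT x|lebesgue_on \<Omega>. (norm (\<psi> x))\<^sup>2)"
    using i(3,4) by simp
  finally have "(LINT x|lebesgue_on \<Omega>. (\<phi> x)\<^sup>2) \<le> 4 * R\<^sup>2 * (LINT x|lebesgue_on \<Omega>. (norm (\<psi> x))\<^sup>2)" by simp
  then have "ennreal (LINT x|lebesgue_on \<Omega>. (\<phi> x)\<^sup>2) \<le> ennreal (4 * R\<^sup>2) * ennreal (LINT x|lebesgue_on \<Omega>. (norm (\<psi> x))\<^sup>2)"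
    by (simp add: ennreal_mult[symmetric] ennreal_leI)
  moreover have "L2_norm_sq \<Omega> \<phi> = ennreal (LINT x|lebesgue_on \<Omega>. (\<phi> x)\<^sup>2)"
    unfolding L2_norm_sq_def using nn_integral_eq_integral[OF i(3)] by simp
  moreover have "L2_norm_sq \<Omega> \<psi> = ennreal (LINT x|lebesgue_on \<Omega>. (norm (\<psi> x))\<^sup>2)"
    unfolding L2_norm_sq_def using nn_integral_eq_integral[OF i(4)] by simp
  ultimately show ?thesis by simp
qed

lemma Poincare:
  fixes \<Omega> :: "'a::euclidean_space set"
  assumes \<Omega>: "\<Omega> \<in> sets lebesgue" and bd: "bounded \<Omega>"
  obtains C where "C > 0" "\<And>w g. H10_pair \<Omega> w g \<Longrightarrow> L2_norm_sq \<Omega> w \<le> ennreal C * L2_norm_sq \<Omega> g"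
proof -
  obtain R where R: "R > 0" "\<And>x. x \<in> \<Omega> \<Longrightarrow> norm x \<le> R" using bd by (auto simp: bounded_pos)
  have "L2_norm_sq \<Omega> w \<le> ennreal (16 * R\<^sup>2) * L2_norm_sq \<Omega> g" if p: "H10_pair \<Omega> w g" for w g
  proof (rule ennreal_le_epsilon)
    fix e :: real assume e: "e > 0"
    define \<epsilon> where "\<epsilon> = e / (2 + 16 * R\<^sup>2)"
    have pos: "2 + 16 * R\<^sup>2 > 0" by (simp add: add_pos_nonneg)
    then have \<epsilon>: "\<epsilon> > 0" using e by (simp add: \<epsilon>_def)
    have \<epsilon>e: "2 * \<epsilon> + 16 * R\<^sup>2 * \<epsilon> = e"
    proof -
      have "2 * \<epsilon> + 16 * R\<^sup>2 * \<epsilon> = (2 + 16 * R\<^sup>2) * \<epsilon>" by (simp only: distrib_right)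
      also have "\<dots> = e" using pos unfolding \<epsilon>_def by simp
      finally show ?thesis .
    qed
    obtain \<phi> \<psi> where \<phi>: "\<phi> \<in> test_fun \<Omega>" "\<And>x. GDERIV \<phi> x :> \<psi> x"
      "L2_dist_sq \<Omega> w \<phi> < ennreal \<epsilon>" "L2_dist_sq \<Omega> g \<psi> < ennreal \<epsilon>" using H10_pairE[OF p \<epsilon>] by blast
    note m = H10_pair_measurable[OF p] test_fun_measurable[OF \<Omega> \<phi>(1,2)]
    have "L2_norm_sq \<Omega> w \<le> 2 * L2_dist_sq \<Omega> w \<phi> + 2 * L2_norm_sq \<Omega> \<phi>"
      using L2_dist_sq_triangle[OF m(1,3), of "\<lambda>x. 0"] by (simp add: L2_dist_sq_zero)
    also have "\<dots> \<le> 2 * ennreal \<epsilon> + 2 * (ennreal (4 * R\<^sup>2) * L2_norm_sq \<Omega> \<psi>)"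
      using \<phi>(3) Poincare_test_fun[OF \<Omega> R \<phi>(1,2)] by (intro add_mono mult_left_mono) auto
    also have "\<dots> \<le> 2 * ennreal \<epsilon> + 2 * (ennreal (4 * R\<^sup>2) * (2 * ennreal \<epsilon> + 2 * L2_norm_sq \<Omega> g))"
    proof (intro add_mono mult_left_mono)
      have "L2_norm_sq \<Omega> \<psi> \<le> 2 * L2_dist_sq \<Omega> \<psi> g + 2 * L2_norm_sq \<Omega> g"
        using L2_dist_sq_triangle[OF m(4,2), of "\<lambda>x. 0"] by (simp add: L2_dist_sq_zero)
      also have "\<dots> \<le> 2 * ennreal \<epsilon> + 2 * L2_norm_sq \<Omega> g"
        using \<phi>(4) by (intro add_mono mult_left_mono) (auto simp: L2_dist_sq_commute)
      finally show "L2_norm_sq \<Omega> \<psi> \<le> 2 * ennreal \<epsilon> + 2 * L2_norm_sq \<Omega> g" .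
    qed auto
    also have "\<dots> = ennreal (16 * R\<^sup>2) * L2_norm_sq \<Omega> g + (2 * ennreal \<epsilon> + 4 * (ennreal (4 * R\<^sup>2) * ennreal \<epsilon>))"
    proof -
      have "ennreal (16 * R\<^sup>2) = ennreal 4 * ennreal (4 * R\<^sup>2)"
        by (subst ennreal_mult'[symmetric]) auto
      moreover have "2 * e + 2 * (c * (2 * e + 2 * s)) = 4 * (c * s) + (2 * e + 4 * (c * e))" for c e s :: ennreal
        by (simp add: distrib_left mult.left_commute[of c] add_ac)
      ultimately show ?thesis by (simp add: mult.assoc)
    qed
    also have "2 * ennreal \<epsilon> + 4 * (ennreal (4 * R\<^sup>2) * ennreal \<epsilon>) = ennreal (2 * \<epsilon> + 16 * R\<^sup>2 * \<epsilon>)"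
    proof -
      have "ennreal (2 * \<epsilon> + 16 * R\<^sup>2 * \<epsilon>) = ennreal (2 * \<epsilon>) + ennreal (4 * ((4 * R\<^sup>2) * \<epsilon>))"
        using \<epsilon> by (subst ennreal_plus[symmetric]) auto
      also have "ennreal (2 * \<epsilon>) = ennreal 2 * ennreal \<epsilon>" by (rule ennreal_mult') simp
      also have "ennreal (4 * ((4 * R\<^sup>2) * \<epsilon>)) = ennreal 4 * ennreal ((4 * R\<^sup>2) * \<epsilon>)" by (rule ennreal_mult') simp
      also have "ennreal ((4 * R\<^sup>2) * \<epsilon>) = ennreal (4 * R\<^sup>2) * ennreal \<epsilon>" by (rule ennreal_mult') simp
      finally show ?thesis by simp
    qed
    finally show "L2_norm_sq \<Omega> w \<le> ennreal (16 * R\<^sup>2) * L2_norm_sq \<Omega> g + ennreal e" unfolding \<epsilon>e .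
  qed
  then show ?thesis using that[of "16 * R\<^sup>2"] R(1) by simp
qed

section \<open>The energy estimate\<close>

lemma DERIV_const_right:
  fixes K :: "real \<Rightarrow> real"
  assumes "\<And>t. DERIV K t :> \<kappa> t" "\<And>t. b < t \<Longrightarrow> \<kappa> t = 0" "b \<le> s"
  shows "K s = K b"
proof (cases "b = s")
  case False
  then have "b < s" using assms(3) by simp
  moreover have "continuous_on {b..s} K" using assms(1) DERIV_isCont continuous_at_imp_continuous_on by blast
  moreover have "DERIV K x :> 0" if "b < x" for x using assms(1)[of x] assms(2)[OF that] by simp
  ultimately show ?thesis by (intro DERIV_isconst_end) auto
qed simp

lemma DERIV_const_left:
  fixes K :: "real \<Rightarrow> real"
  assumes "\<And>t. DERIV K t :> \<kappa> t" "\<And>t. t < a \<Longrightarrow> \<kappa> t = 0" "s \<le> a"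
  shows "K s = K a"
proof (cases "a = s")
  case False
  then have "s < a" using assms(3) by simp
  moreover have "continuous_on {s..a} K" using assms(1) DERIV_isCont continuous_at_imp_continuous_on by blast
  moreover have "DERIV K x :> 0" if "x < a" for x using assms(1)[of x] assms(2)[OF that] by simp
  ultimately have "K a = K s" by (intro DERIV_isconst_end) auto
  then show ?thesis by simp
qed simp

text \<open>The antiderivative that vanishes to the left of the support of \<open>\<kappa>\<close>; it is constant to the right of it
  and hence bounded.\<close>
lemma antiderivative_compact_support:
  fixes \<kappa> :: "real \<Rightarrow> real"
  assumes \<kappa>: "continuous_on UNIV \<kappa>" "\<And>t. t \<le> a \<Longrightarrow> \<kappa> t = 0" "\<And>t. b \<le> t \<Longrightarrow> \<kappa> t = 0"
  obtains K B where "\<And>t. DERIV K t :> \<kappa> t" "\<And>t. t \<le> a \<Longrightarrow> K t = 0" "\<And>t. \<bar>K t\<bar> \<le> B" "\<And>t. \<bar>\<kappa> t\<bar> \<le> B"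
proof -
  have "\<exists>F. \<forall>x :: real. (-\<infinity>::ereal) < x \<longrightarrow> x < (\<infinity>::ereal) \<longrightarrow> (F has_vector_derivative \<kappa> x) (at x)"
    using \<kappa>(1) by (intro einterval_antiderivative) (auto simp: continuous_on_eq_continuous_at)
  then obtain F where F: "\<And>x. DERIV F x :> \<kappa> x"
    by (auto simp: has_real_derivative_iff_has_vector_derivative)
  define K where "K = (\<lambda>t. F t - F a)"
  have K: "DERIV K t :> \<kappa> t" for t
    unfolding K_def using DERIV_diff[OF F[of t] DERIV_const[of "F a"]] by simp
  have K0: "K t = 0" if "t \<le> a" for t
    using DERIV_const_left[OF K _ that] \<kappa>(2) by (simp add: K_def)
  have Kb: "K t = K b" if "b \<le> t" for t
    using DERIV_const_right[OF K _ that] \<kappa>(3) by simp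
  have cK: "continuous_on S K" for S using K DERIV_isCont continuous_at_imp_continuous_on by blast
  have "compact (K ` {a..b})" "compact (\<kappa> ` {a..b})"
    using cK continuous_on_subset[OF \<kappa>(1)] by (auto intro: compact_continuous_image)
  then have "bounded (K ` {a..b} \<union> \<kappa> ` {a..b})" by (simp add: compact_imp_bounded)
  then obtain B where B: "\<And>y. y \<in> K ` {a..b} \<union> \<kappa> ` {a..b} \<Longrightarrow> \<bar>y\<bar> \<le> B"
    unfolding bounded_real by blast
  define B' where "B' = max B 0 + \<bar>K b\<bar>"
  have "\<bar>K t\<bar> \<le> B'" "\<bar>\<kappa> t\<bar> \<le> B'" for t
  proof -
    consider "t \<le> a" | "b \<le> t" | "t \<in> {a..b}" by force
    then have "\<bar>K t\<bar> \<le> B' \<and> \<bar>\<kappa> t\<bar> \<le> B'"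
    proof cases
      case 1 then show ?thesis using K0 \<kappa>(2) by (simp add: B'_def)
    next
      case 2 then show ?thesis using Kb[of t] \<kappa>(3) by (simp add: B'_def)
    next
      case 3
      then have "\<bar>K t\<bar> \<le> B" "\<bar>\<kappa> t\<bar> \<le> B" using B by auto
      then show ?thesis unfolding B'_def by linarith
    qed
    then show "\<bar>K t\<bar> \<le> B'" "\<bar>\<kappa> t\<bar> \<le> B'" by auto
  qed
  then show ?thesis using that[of K B'] K K0 by blast
qed

lemma C1_step:
  assumes ab: "a < (b::real)"
  obtains \<Phi> \<Phi>' B where "\<And>t. DERIV \<Phi> t :> \<Phi>' t" "continuous_on UNIV \<Phi>'" "\<And>t. t \<le> a \<Longrightarrow> \<Phi> t = 0"
    "\<And>t. t \<le> a \<Longrightarrow> \<Phi>' t = 0" "\<And>t. b \<le> t \<Longrightarrow> \<Phi> t = 1" "\<And>t. b \<le> t \<Longrightarrow> \<Phi>' t = 0" "\<And>t. \<bar>\<Phi> t\<bar> \<le> B"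
    "\<And>t. \<bar>\<Phi>' t\<bar> \<le> B"
proof -
  define \<kappa> where "\<kappa> = (\<lambda>t. max 0 (min (t - a) (b - t)))"
  have \<kappa>: "continuous_on UNIV \<kappa>" unfolding \<kappa>_def by (intro continuous_intros)
  have z: "\<kappa> t = 0" if "t \<le> a \<or> b \<le> t" for t using that by (auto simp: \<kappa>_def)
  obtain K B where K: "\<And>t. DERIV K t :> \<kappa> t" "\<And>t. t \<le> a \<Longrightarrow> K t = 0" "\<And>t. \<bar>K t\<bar> \<le> B" "\<And>t. \<bar>\<kappa> t\<bar> \<le> B"
    using antiderivative_compact_support[OF \<kappa>, of a b] z by metis
  have "K a < K b"
  proof (rule DERIV_pos_imp_increasing_open[OF ab])
    show "\<exists>y. DERIV K x :> y \<and> 0 < y" if "a < x" "x < b" for x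
      using K(1)[of x] that by (intro exI[of _ "\<kappa> x"]) (auto simp: \<kappa>_def)
    show "continuous_on {a..b} K" using K(1) DERIV_isCont continuous_at_imp_continuous_on by blast
  qed
  then have pos: "K b > 0" using K(2)[of a] by simp
  show ?thesis
  proof (rule that[of "\<lambda>t. K t / K b" "\<lambda>t. \<kappa> t / K b" "B / K b"])
    show "((\<lambda>t. K t / K b) has_real_derivative \<kappa> t / K b) (at t)" for t by (rule DERIV_cdivide[OF K(1)])
    show "continuous_on UNIV (\<lambda>t. \<kappa> t / K b)" using pos by (intro continuous_intros \<kappa>) simp
    show "K t / K b = 1" if "b \<le> t" for t
    proof -
      have "K t = K b" by (rule DERIV_const_right[OF K(1) _ that]) (simp add: z)
      then show ?thesis using pos by simp
    qed
    show "\<bar>K t / K b\<bar> \<le> B / K b" "\<bar>\<kappa> t / K b\<bar> \<le> B / K b" for t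
      using K(3)[of t] K(4)[of t] pos by (simp_all add: abs_divide divide_right_mono)
  qed (use K(2) z in simp_all)
qed

text \<open>By completeness \<open>f\<close> and \<open>g\<close> are measurable together; if they are not, both integrals are zero.\<close>
lemma LINT_lebesgue_on_cong_AE:
  fixes f g :: "'a::euclidean_space \<Rightarrow> 'b::euclidean_space"
  assumes \<Omega>: "\<Omega> \<in> sets lebesgue" and ae: "AE x in lebesgue_on \<Omega>. f x = g x"
  shows "(LINT x|lebesgue_on \<Omega>. f x) = (LINT x|lebesgue_on \<Omega>. g x)"
proof (cases "f \<in> borel_measurable (lebesgue_on \<Omega>)")
  case True
  then show ?thesis
    by (rule integral_cong_AE[OF _ AE_lebesgue_on_measurable_cong[OF \<Omega> True ae] ae])
next
  case False
  have "AE x in lebesgue_on \<Omega>. g x = f x" using ae by eventually_elim simp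
  then have "g \<notin> borel_measurable (lebesgue_on \<Omega>)"
    using False AE_lebesgue_on_measurable_cong[OF \<Omega>] by blast
  then have "\<not> integrable (lebesgue_on \<Omega>) g" "\<not> integrable (lebesgue_on \<Omega>) f"
    using False borel_measurable_integrable by blast+
  then show ?thesis by (simp add: not_integrable_integral_eq)
qed

text \<open>The function \<open>u\<close> itself need not be in \<open>H\<^sub>0\<^sup>1\<close>, but a function of \<open>u\<close> that vanishes below \<open>\<delta>\<close> is a
  function of \<open>excess \<delta> u\<close>, because \<open>u\<close> and \<open>excess \<delta> u + \<delta>\<close> agree where \<open>u \<ge> \<delta>\<close>.\<close>
lemma H10_pair_chain_excess:
  fixes u :: "'a::euclidean_space \<Rightarrow> real" and K \<kappa> :: "real \<Rightarrow> real"
  assumes \<Omega>: "\<Omega> \<in> sets lebesgue" and u: "AE x in lebesgue_on \<Omega>. 0 \<le> u x" and \<delta>: "\<delta> > 0"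
    and p: "H10_pair \<Omega> (\<lambda>x. excess \<delta> (u x)) g"
    and K: "\<And>t. DERIV K t :> \<kappa> t" "continuous_on UNIV \<kappa>" "\<And>t. \<bar>\<kappa> t\<bar> \<le> B"
      "\<And>t. t \<le> \<delta> \<Longrightarrow> K t = 0" "\<And>t. t \<le> \<delta> \<Longrightarrow> \<kappa> t = 0"
  shows "H10_pair \<Omega> (\<lambda>x. K (u x)) (\<lambda>x. \<kappa> (u x) *\<^sub>R g x)"
proof -
  have 1: "H10_pair \<Omega> (\<lambda>x. K (excess \<delta> (u x) + \<delta>)) (\<lambda>x. \<kappa> (excess \<delta> (u x) + \<delta>) *\<^sub>R g x)"
  proof (rule H10_pair_chain[OF \<Omega> _ _ _ _ p])
    show "((\<lambda>t. K (t + \<delta>)) has_real_derivative \<kappa> (t + \<delta>)) (at t)" for t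
      using K(1)[of "t + \<delta>"] by (simp add: DERIV_shift)
    show "continuous_on UNIV (\<lambda>t. \<kappa> (t + \<delta>))"
      by (rule continuous_on_compose2[OF K(2)]) (auto intro: continuous_intros)
  qed (use K in auto)
  have eq: "f (excess \<delta> s + \<delta>) = f s" if "\<And>t. t \<le> \<delta> \<Longrightarrow> f t = 0" "0 \<le> s" for f :: "real \<Rightarrow> real" and s
  proof (cases "s \<le> \<delta>")
    case True
    then have "excess \<delta> s + \<delta> = \<delta>" using that(2) \<delta> by (simp add: excess_def trunc_def)
    then show ?thesis using that(1) True by simp
  next
    case False
    then have "excess \<delta> s + \<delta> = s" using that(2) \<delta> by (simp add: excess_def trunc_def)
    then show ?thesis by simp
  qed
  show ?thesis
  proof (rule H10_pair_cong_AE[OF \<Omega> 1])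
    show "AE x in lebesgue_on \<Omega>. K (excess \<delta> (u x) + \<delta>) = K (u x)"
      using u by eventually_elim (rule eq[OF K(4)])
    show "AE x in lebesgue_on \<Omega>. \<kappa> (excess \<delta> (u x) + \<delta>) *\<^sub>R g x = \<kappa> (u x) *\<^sub>R g x"
      using u
    proof eventually_elim
      case (elim x)
      have "\<kappa> (excess \<delta> (u x) + \<delta>) = \<kappa> (u x)" by (rule eq[OF K(5) elim])
      then show ?case by simp
    qed
  qed
qed

lemma transpose_mult_vec_component:
  fixes M :: "real^'n^'n" shows "(transpose M *v z) $ i = (\<Sum>j\<in>UNIV. M $ j $ i * z $ j)"
  by (simp add: matrix_vector_mult_def transpose_def)

lemma Linf_matrix_Lp_2:
  fixes A :: "real^'n \<Rightarrow> real^'n^'n"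
  assumes A: "\<forall>i j. (\<lambda>x. A x $ i $ j) \<in> Linf \<Omega>" and z: "z \<in> Lp 2 \<Omega>"
  shows "(\<lambda>x. transpose (A x) *v z x) \<in> Lp 2 \<Omega>"
proof -
  have zm: "z \<in> borel_measurable (lebesgue_on \<Omega>)" and zf: "L2_norm_sq \<Omega> z < \<infinity>"
    using z by (auto simp: Lp_2_iff)
  have Am: "(\<lambda>x. A x $ i $ j) \<in> borel_measurable (lebesgue_on \<Omega>)" for i j
    using A by (simp add: Linf_def)
  have zc: "(\<lambda>x. z x $ j) \<in> borel_measurable (lebesgue_on \<Omega>)" for j
    using borel_measurable_inner[OF zm borel_measurable_const[of "axis j 1"]] by (simp add: inner_axis)
  have m: "(\<lambda>x. transpose (A x) *v z x) \<in> borel_measurable (lebesgue_on \<Omega>)"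
  proof (subst borel_measurable_euclidean_space, intro ballI)
    fix b :: "real^'n" assume "b \<in> Basis"
    then obtain i where b: "b = axis i 1" by (auto simp: Basis_vec_def)
    have "(\<lambda>x. \<Sum>j\<in>UNIV. A x $ j $ i * z x $ j) \<in> borel_measurable (lebesgue_on \<Omega>)"
      by (intro borel_measurable_sum borel_measurable_times Am zc)
    then show "(\<lambda>x. (transpose (A x) *v z x) \<bullet> b) \<in> borel_measurable (lebesgue_on \<Omega>)"
      by (simp add: b inner_axis transpose_mult_vec_component del: transpose_matrix_vector)
  qed
  have "\<forall>i j. \<exists>C. AE x in lebesgue_on \<Omega>. \<bar>A x $ i $ j\<bar> \<le> C" using A by (simp add: Linf_def)
  then obtain C where C: "\<And>i j. AE x in lebesgue_on \<Omega>. \<bar>A x $ i $ j\<bar> \<le> C i j" by metis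
  have "AE x in lebesgue_on \<Omega>. \<forall>p\<in>UNIV. \<bar>A x $ (fst p) $ (snd p)\<bar> \<le> C (fst p) (snd p)"
    by (rule AE_finite_allI) (auto intro: C)
  then have ae: "AE x in lebesgue_on \<Omega>. \<forall>i j. \<bar>A x $ i $ j\<bar> \<le> C i j"
    by eventually_elim auto
  define S where "S = (\<Sum>i\<in>UNIV. \<Sum>j\<in>UNIV. \<bar>C j i\<bar>)"
  have S0: "S \<ge> 0" unfolding S_def by (intro sum_nonneg) auto
  have bound: "AE x in lebesgue_on \<Omega>. norm (transpose (A x) *v z x) \<le> S * norm (z x)"
    using ae
  proof eventually_elim
    case (elim x)
    have "norm (transpose (A x) *v z x) \<le> (\<Sum>i\<in>UNIV. \<bar>(transpose (A x) *v z x) $ i\<bar>)"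
      by (rule norm_le_l1_cart)
    also have "\<dots> \<le> (\<Sum>i\<in>UNIV. \<Sum>j\<in>UNIV. \<bar>C j i\<bar> * norm (z x))"
    proof (rule sum_mono)
      fix i
      have "\<bar>(transpose (A x) *v z x) $ i\<bar> \<le> (\<Sum>j\<in>UNIV. \<bar>A x $ j $ i * z x $ j\<bar>)"
        unfolding transpose_mult_vec_component by (rule sum_abs)
      also have "\<dots> \<le> (\<Sum>j\<in>UNIV. \<bar>C j i\<bar> * norm (z x))"
      proof (rule sum_mono)
        fix j
        have "\<bar>A x $ j $ i\<bar> \<le> \<bar>C j i\<bar>" using elim by (meson abs_ge_self order_trans)
        then show "\<bar>A x $ j $ i * z x $ j\<bar> \<le> \<bar>C j i\<bar> * norm (z x)"
          unfolding abs_mult by (intro mult_mono component_le_norm_cart) auto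
      qed
      finally show "\<bar>(transpose (A x) *v z x) $ i\<bar> \<le> (\<Sum>j\<in>UNIV. \<bar>C j i\<bar> * norm (z x))" .
    qed
    also have "\<dots> = S * norm (z x)" by (simp add: S_def sum_distrib_right)
    finally show ?case .
  qed
  have "L2_norm_sq \<Omega> (\<lambda>x. transpose (A x) *v z x) \<le> (\<integral>\<^sup>+x. ennreal (S\<^sup>2) * ennreal ((norm (z x))\<^sup>2) \<partial>lebesgue_on \<Omega>)"
    unfolding L2_norm_sq_def
  proof (rule nn_integral_mono_AE)
    show "AE x in lebesgue_on \<Omega>. ennreal ((norm (transpose (A x) *v z x))\<^sup>2) \<le> ennreal (S\<^sup>2) * ennreal ((norm (z x))\<^sup>2)"
      using bound
    proof eventually_elim
      case (elim x)
      then have "(norm (transpose (A x) *v z x))\<^sup>2 \<le> (S * norm (z x))\<^sup>2" by (rule power_mono) simp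
      then show ?case by (simp add: ennreal_mult[symmetric] power_mult_distrib ennreal_leI)
    qed
  qed
  also have "\<dots> = ennreal (S\<^sup>2) * L2_norm_sq \<Omega> z" unfolding L2_norm_sq_def using zm by (simp add: nn_integral_cmult)
  also have "\<dots> < \<infinity>" using zf by (simp add: ennreal_mult_less_top)
  finally show ?thesis using m by (simp add: Lp_2_iff)
qed

lemma integrable_inner_Lp_2:
  assumes "f \<in> Lp 2 \<Omega>" "g \<in> Lp 2 \<Omega>"
  shows "integrable (lebesgue_on \<Omega>) (\<lambda>x. f x \<bullet> g x)"
proof (rule Bochner_Integration.integrable_bound)
  have "integrable (lebesgue_on \<Omega>) (\<lambda>x. (norm (f x))\<^sup>2)" "integrable (lebesgue_on \<Omega>) (\<lambda>x. (norm (g x))\<^sup>2)"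
    using assms by (auto simp: Lp_def powr_2_norm)
  then show "integrable (lebesgue_on \<Omega>) (\<lambda>x. (norm (f x))\<^sup>2 + (norm (g x))\<^sup>2)" by simp
  show "(\<lambda>x. f x \<bullet> g x) \<in> borel_measurable (lebesgue_on \<Omega>)"
    using assms by (auto simp: Lp_def)
  show "AE x in lebesgue_on \<Omega>. norm (f x \<bullet> g x) \<le> norm ((norm (f x))\<^sup>2 + (norm (g x))\<^sup>2)"
  proof (intro always_eventually allI)
    fix x
    have "\<bar>f x \<bullet> g x\<bar> \<le> norm (f x) * norm (g x)" by (rule Cauchy_Schwarz_ineq2)
    moreover have "0 \<le> norm (f x) * norm (g x)" by simp
    ultimately have "\<bar>f x \<bullet> g x\<bar> \<le> (norm (f x))\<^sup>2 + (norm (g x))\<^sup>2"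
      using sum_squares_bound[of "norm (f x)" "norm (g x)"] by linarith
    then show "norm (f x \<bullet> g x) \<le> norm ((norm (f x))\<^sup>2 + (norm (g x))\<^sup>2)" by simp
  qed
qed

lemma transpose_scaleR_mult_vec:
  fixes M :: "real^'n^'n" shows "transpose M *v (c *\<^sub>R z) = c *\<^sub>R (transpose M *v z)"
  by (simp add: matrix_vector_mult_scaleR)

text \<open>The test function is \<open>v = K(u)\<close>.  It belongs to the class of test functions of the definition of
  solution through the one-term representation with
  \<open>\<phi> = \<Phi>(u)\<close> and \<open>f = \<^sup>tA Dv\<close>, where the step function \<open>\<Phi>\<close> rises from
  \<open>0\<close> to \<open>1\<close> between \<open>\<delta>\<close> and \<open>2 \<delta>\<close>: where \<open>Dv\<close> is nonzero, \<open>u \<ge> 2 \<delta>\<close>, and so \<open>\<phi> = 1\<close> and \<open>D\<phi> = 0\<close>.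
  At the truncation level \<open>k = \<delta>\<close> one has \<open>\<phi> T\<^sub>k(u) = \<delta> \<phi>\<close>, whose gradient is zero wherever \<open>f\<close> is not, and
  only the term with \<open>G\<^sub>k(u)\<close> survives.\<close>
lemma energy_identity:
  fixes \<Omega> :: "(real^'n) set" and A :: "real^'n \<Rightarrow> real^'n^'n" and u :: "real^'n \<Rightarrow> real"
  assumes \<Omega>: "open \<Omega>" and A: "\<forall>i j. (\<lambda>x. A x $ i $ j) \<in> Linf \<Omega>"
    and sol: "is_solution \<Omega> A F u" and \<delta>: "\<delta> > 0"
    and K: "\<And>t. DERIV K t :> \<kappa> t" "continuous_on UNIV \<kappa>" "\<And>t. \<bar>\<kappa> t\<bar> \<le> B" "\<And>t. \<bar>K t\<bar> \<le> B"
      "\<And>t. t \<le> 2 * \<delta> \<Longrightarrow> K t = 0" "\<And>t. t \<le> 2 * \<delta> \<Longrightarrow> \<kappa> t = 0" "\<And>t. 0 \<le> K t"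
  defines "g \<equiv> grad \<Omega> (\<lambda>x. excess \<delta> (u x))"
  shows "(\<integral>\<^sup>+x. F x (u x) * ennreal (K (u x)) \<partial>lebesgue_on \<Omega>) < \<infinity>"
    and "(LINT x|lebesgue_on \<Omega>. \<kappa> (u x) * ((transpose (A x) *v g x) \<bullet> g x)) =
      enn2real (\<integral>\<^sup>+x. F x (u x) * ennreal (K (u x)) \<partial>lebesgue_on \<Omega>)"
proof -
  have \<Omega>s: "\<Omega> \<in> sets lebesgue" using \<Omega> by (simp add: lebesgue_openin)
  have u0: "AE x in lebesgue_on \<Omega>. 0 \<le> u x" and w: "(\<lambda>x. excess \<delta> (u x)) \<in> H10 \<Omega>"
    using sol \<delta> unfolding is_solution_def by auto
  have pw: "H10_pair \<Omega> (\<lambda>x. excess \<delta> (u x)) g"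
    unfolding g_def by (rule H10_imp_H10_pair[OF \<Omega> w])
  define v where "v = (\<lambda>x. K (u x))"
  have pv: "H10_pair \<Omega> v (\<lambda>x. \<kappa> (u x) *\<^sub>R g x)"
    unfolding v_def using \<delta> by (intro H10_pair_chain_excess[OF \<Omega>s u0 \<delta> pw K(1-3)] K(5,6)) auto
  have gv: "AE x in lebesgue_on \<Omega>. grad \<Omega> v x = \<kappa> (u x) *\<^sub>R g x" by (rule H10_pair_grad[OF \<Omega> pv])
  obtain \<Phi> \<Phi>' M where \<Phi>: "\<And>t. DERIV \<Phi> t :> \<Phi>' t" "continuous_on UNIV \<Phi>'" "\<And>t. t \<le> \<delta> \<Longrightarrow> \<Phi> t = 0"
    "\<And>t. t \<le> \<delta> \<Longrightarrow> \<Phi>' t = 0" "\<And>t. 2 * \<delta> \<le> t \<Longrightarrow> \<Phi> t = 1" "\<And>t. 2 * \<delta> \<le> t \<Longrightarrow> \<Phi>' t = 0"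
    "\<And>t. \<bar>\<Phi> t\<bar> \<le> M" "\<And>t. \<bar>\<Phi>' t\<bar> \<le> M"
    using C1_step[of \<delta> "2 * \<delta>"] \<delta> by auto
  define \<phi> where "\<phi> = (\<lambda>x. \<Phi> (u x))"
  have p\<phi>: "H10_pair \<Omega> \<phi> (\<lambda>x. \<Phi>' (u x) *\<^sub>R g x)"
    unfolding \<phi>_def by (rule H10_pair_chain_excess[OF \<Omega>s u0 \<delta> pw \<Phi>(1,2,8,3,4)])
  have \<kappa>\<Phi>: "\<kappa> t * \<Phi> t = \<kappa> t" "\<kappa> t * \<Phi>' t = 0" for t
    using K(6)[of t] \<Phi>(5,6)[of t] by (cases "t \<le> 2 * \<delta>"; simp)+
  define f where "f = (\<lambda>x. transpose (A x) *v grad \<Omega> v x)"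
  have fae: "AE x in lebesgue_on \<Omega>. f x = \<kappa> (u x) *\<^sub>R (transpose (A x) *v g x)"
    using gv by eventually_elim (simp only: f_def transpose_scaleR_mult_vec)
  have fL: "f \<in> Lp 2 \<Omega>"
    unfolding f_def
  proof (rule Linf_matrix_Lp_2[OF A])
    have "AE x in lebesgue_on \<Omega>. \<kappa> (u x) *\<^sub>R g x = grad \<Omega> v x" using gv by eventually_elim simp
    then have "H10_pair \<Omega> v (grad \<Omega> v)" by (intro H10_pair_cong_AE[OF \<Omega>s pv]) simp
    then show "grad \<Omega> v \<in> Lp 2 \<Omega>"
      using H10_pair_measurable H10_pair_finite[OF \<Omega>s] by (auto simp: Lp_2_iff)
  qed
  have vL: "v \<in> H10 \<Omega> \<inter> Linf \<Omega>"
    using H10_pair_H10[OF \<Omega> pv] H10_pair_measurable[OF pv] K(4) by (auto simp: Linf_def v_def)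
  have \<phi>L: "\<phi> \<in> H10 \<Omega> \<inter> Linf \<Omega>"
    using H10_pair_H10[OF \<Omega> p\<phi>] H10_pair_measurable[OF p\<phi>] \<Phi>(7) by (auto simp: Linf_def \<phi>_def)
  have distr: "neg_div \<Omega> f \<psi> = mult_neg_div \<Omega> \<phi> f \<psi>" if \<psi>: "\<psi> \<in> test_fun \<Omega>" for \<psi>
  proof -
    obtain \<psi>' where \<psi>': "\<And>x. GDERIV \<psi> x :> \<psi>' x" using test_funE[OF \<psi>] by metis
    have 1: "AE x in lebesgue_on \<Omega>. grad \<Omega> \<psi> x = \<psi>' x"
      by (rule grad_AE_eq[OF \<Omega> weak_gradient_test_fun[OF \<Omega>s \<psi> \<psi>']])
    have 2: "AE x in lebesgue_on \<Omega>. grad \<Omega> (\<lambda>y. \<phi> y * \<psi> y) x = \<phi> x *\<^sub>R \<psi>' x + \<psi> x *\<^sub>R (\<Phi>' (u x) *\<^sub>R g x)"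
      by (rule grad_AE_eq[OF \<Omega> weak_gradient_mult_test_fun[OF \<Omega>s H10_pair_weak_gradient[OF \<Omega>s p\<phi>] \<psi> \<psi>']])
    show ?thesis
      unfolding neg_div_def mult_neg_div_def
    proof (rule LINT_lebesgue_on_cong_AE[OF \<Omega>s])
      show "AE x in lebesgue_on \<Omega>. f x \<bullet> grad \<Omega> \<psi> x = f x \<bullet> grad \<Omega> (\<lambda>y. \<phi> y * \<psi> y) x"
        using 1 2 fae
      proof eventually_elim
        case (elim x)
        have "f x \<bullet> grad \<Omega> (\<lambda>y. \<phi> y * \<psi> y) x = (\<kappa> (u x) * \<Phi> (u x)) * ((transpose (A x) *v g x) \<bullet> \<psi>' x)
            + (\<kappa> (u x) * \<Phi>' (u x)) * (\<psi> x * ((transpose (A x) *v g x) \<bullet> g x))"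
          unfolding elim by (simp add: inner_add_right \<phi>_def algebra_simps)
        moreover have "f x \<bullet> grad \<Omega> \<psi> x = \<kappa> (u x) * ((transpose (A x) *v g x) \<bullet> \<psi>' x)"
          unfolding elim by simp
        ultimately show ?case by (simp only: \<kappa>\<Phi> mult_zero_left add_0_right)
      qed
    qed
  qed
  have rep: "dual_rep \<Omega> A v {0} (\<lambda>_. \<phi>) (\<lambda>_. f) (\<lambda>_. 0)"
    unfolding dual_rep_def eq_distr_def
    using \<phi>L fL distr by (auto simp: fun_distr_def Lp_def f_def)
  then have vV: "v \<in> V_space \<Omega> A" using vL unfolding V_space_def by blast
  have v0: "AE x in lebesgue_on \<Omega>. 0 \<le> v x" using K(7) by (simp add: v_def)
  have S: "(\<integral>\<^sup>+x. F x (u x) * ennreal (v x) \<partial>lebesgue_on \<Omega>) < \<infinity> \<and>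
          (\<forall>k>0. (LINT x|lebesgue_on \<Omega>. (transpose (A x) *v grad \<Omega> v x) \<bullet> grad \<Omega> (\<lambda>y. excess k (u y)) x)
             + (\<Sum>i\<in>{0::nat}. LINT x|lebesgue_on \<Omega>. f x \<bullet> grad \<Omega> (\<lambda>y. \<phi> y * trunc k (u y)) x)
             + (LINT x|lebesgue_on \<Omega>. 0 * trunc k (u x))
             = enn2real (\<integral>\<^sup>+x. F x (u x) * ennreal (v x) \<partial>lebesgue_on \<Omega>))"
    using sol vV v0 rep unfolding is_solution_def by blast
  show "(\<integral>\<^sup>+x. F x (u x) * ennreal (K (u x)) \<partial>lebesgue_on \<Omega>) < \<infinity>" using S by (simp add: v_def)
  have eq: "(LINT x|lebesgue_on \<Omega>. f x \<bullet> g x) + (LINT x|lebesgue_on \<Omega>. f x \<bullet> grad \<Omega> (\<lambda>y. \<phi> y * trunc \<delta> (u y)) x)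
      = enn2real (\<integral>\<^sup>+x. F x (u x) * ennreal (K (u x)) \<partial>lebesgue_on \<Omega>)"
    using S \<delta> by (simp add: f_def g_def v_def)
  have p\<delta>: "H10_pair \<Omega> (\<lambda>x. \<phi> x * trunc \<delta> (u x)) (\<lambda>x. \<delta> *\<^sub>R (\<Phi>' (u x) *\<^sub>R g x))"
  proof (rule H10_pair_cong_AE[OF \<Omega>s H10_pair_chain[OF \<Omega>s _ _ _ _ p\<phi>, where \<Phi> = "\<lambda>t. \<delta> * t" and \<Phi>' = "\<lambda>_. \<delta>" and C = "\<bar>\<delta>\<bar>"]])
    show "((\<lambda>t. \<delta> * t) has_real_derivative \<delta>) (at t)" for t
      using DERIV_cmult[OF DERIV_ident, of \<delta> t UNIV] by simp
    show "AE x in lebesgue_on \<Omega>. \<delta> * \<phi> x = \<phi> x * trunc \<delta> (u x)"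
      using u0
    proof eventually_elim
      case (elim x)
      then show ?case using \<Phi>(3)[of "u x"] \<delta> by (cases "u x \<le> \<delta>") (auto simp: \<phi>_def trunc_def)
    qed
  qed auto
  have "(LINT x|lebesgue_on \<Omega>. f x \<bullet> grad \<Omega> (\<lambda>y. \<phi> y * trunc \<delta> (u y)) x) = (LINT x|lebesgue_on \<Omega>. 0)"
  proof (rule LINT_lebesgue_on_cong_AE[OF \<Omega>s])
    show "AE x in lebesgue_on \<Omega>. f x \<bullet> grad \<Omega> (\<lambda>y. \<phi> y * trunc \<delta> (u y)) x = 0"
      using fae H10_pair_grad[OF \<Omega> p\<delta>]
    proof eventually_elim
      case (elim x)
      have "f x \<bullet> grad \<Omega> (\<lambda>y. \<phi> y * trunc \<delta> (u y)) x = (\<kappa> (u x) * \<Phi>' (u x)) * (\<delta> * ((transpose (A x) *v g x) \<bullet> g x))"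
        unfolding elim by (simp add: algebra_simps)
      then show ?case unfolding \<kappa>\<Phi> by simp
    qed
  qed
  moreover have "(LINT x|lebesgue_on \<Omega>. f x \<bullet> g x) = (LINT x|lebesgue_on \<Omega>. \<kappa> (u x) * ((transpose (A x) *v g x) \<bullet> g x))"
    by (rule LINT_lebesgue_on_cong_AE[OF \<Omega>s]) (use fae in eventually_elim, simp)
  ultimately show "(LINT x|lebesgue_on \<Omega>. \<kappa> (u x) * ((transpose (A x) *v g x) \<bullet> g x)) =
      enn2real (\<integral>\<^sup>+x. F x (u x) * ennreal (K (u x)) \<partial>lebesgue_on \<Omega>)"
    using eq by simp
qed

text \<open>The ellipticity bounds the integrand on the left of the energy identity from below.\<close>
lemma energy_estimate:
  fixes \<Omega> :: "(real^'n) set" and A :: "real^'n \<Rightarrow> real^'n^'n" and u :: "real^'n \<Rightarrow> real"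
  assumes \<Omega>: "open \<Omega>" and A: "\<forall>i j. (\<lambda>x. A x $ i $ j) \<in> Linf \<Omega>" and \<alpha>: "\<alpha> > 0"
    and ell: "AE x in lebesgue_on \<Omega>. \<forall>\<xi>. (A x *v \<xi>) \<bullet> \<xi> \<ge> \<alpha> * (norm \<xi>)\<^sup>2"
    and sol: "is_solution \<Omega> A F u" and \<delta>: "\<delta> > 0"
    and K: "\<And>t. DERIV K t :> \<kappa> t" "continuous_on UNIV \<kappa>" "\<And>t. \<bar>\<kappa> t\<bar> \<le> B" "\<And>t. \<bar>K t\<bar> \<le> B"
      "\<And>t. t \<le> 2 * \<delta> \<Longrightarrow> K t = 0" "\<And>t. t \<le> 2 * \<delta> \<Longrightarrow> \<kappa> t = 0" "\<And>t. 0 \<le> K t" "\<And>t. 0 \<le> \<kappa> t"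
  defines "g \<equiv> grad \<Omega> (\<lambda>x. excess \<delta> (u x))"
  shows "(\<integral>\<^sup>+x. ennreal (\<alpha> * (\<kappa> (u x) * (norm (g x))\<^sup>2)) \<partial>lebesgue_on \<Omega>)
    \<le> (\<integral>\<^sup>+x. F x (u x) * ennreal (K (u x)) \<partial>lebesgue_on \<Omega>)"
proof -
  have \<Omega>s: "\<Omega> \<in> sets lebesgue" using \<Omega> by (simp add: lebesgue_openin)
  have u0: "AE x in lebesgue_on \<Omega>. 0 \<le> u x" and w: "(\<lambda>x. excess \<delta> (u x)) \<in> H10 \<Omega>"
    using sol \<delta> unfolding is_solution_def by auto
  have pw: "H10_pair \<Omega> (\<lambda>x. excess \<delta> (u x)) g"
    unfolding g_def by (rule H10_imp_H10_pair[OF \<Omega> w])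
  have pv: "H10_pair \<Omega> (\<lambda>x. K (u x)) (\<lambda>x. \<kappa> (u x) *\<^sub>R g x)"
    using \<delta> by (intro H10_pair_chain_excess[OF \<Omega>s u0 \<delta> pw K(1-3)] K(5,6)) auto
  have gL: "g \<in> Lp 2 \<Omega>" "(\<lambda>x. \<kappa> (u x) *\<^sub>R g x) \<in> Lp 2 \<Omega>"
    using H10_pair_measurable(2)[OF pw] H10_pair_finite(2)[OF \<Omega>s pw]
      H10_pair_measurable(2)[OF pv] H10_pair_finite(2)[OF \<Omega>s pv] by (simp_all add: Lp_2_iff)
  let ?q = "\<lambda>x. \<kappa> (u x) * ((transpose (A x) *v g x) \<bullet> g x)"
  have "integrable (lebesgue_on \<Omega>) (\<lambda>x. (transpose (A x) *v (\<kappa> (u x) *\<^sub>R g x)) \<bullet> g x)"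
    by (rule integrable_inner_Lp_2[OF Linf_matrix_Lp_2[OF A gL(2)] gL(1)])
  then have qi: "integrable (lebesgue_on \<Omega>) ?q" by (simp only: transpose_scaleR_mult_vec inner_scaleR_left)
  have le: "AE x in lebesgue_on \<Omega>. \<alpha> * (\<kappa> (u x) * (norm (g x))\<^sup>2) \<le> ?q x"
    using ell
  proof eventually_elim
    case (elim x)
    have "\<alpha> * (norm (g x))\<^sup>2 \<le> (A x *v g x) \<bullet> g x" using elim by blast
    also have "\<dots> = (transpose (A x) *v g x) \<bullet> g x"
      unfolding transpose_matrix_vector dot_lmul_matrix by (rule inner_commute)
    finally have "\<kappa> (u x) * (\<alpha> * (norm (g x))\<^sup>2) \<le> ?q x" by (rule mult_left_mono[OF _ K(8)])
    then show ?case by (simp add: mult.left_commute)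
  qed
  have q0: "AE x in lebesgue_on \<Omega>. 0 \<le> ?q x"
    using le
  proof eventually_elim
    case (elim x)
    have "0 \<le> \<alpha> * (\<kappa> (u x) * (norm (g x))\<^sup>2)" using \<alpha> K(8) by simp
    then show ?case using elim by linarith
  qed
  note id = energy_identity[OF \<Omega> A sol \<delta> K(1-7), folded g_def]
  have "(\<integral>\<^sup>+x. ennreal (\<alpha> * (\<kappa> (u x) * (norm (g x))\<^sup>2)) \<partial>lebesgue_on \<Omega>) \<le> (\<integral>\<^sup>+x. ennreal (?q x) \<partial>lebesgue_on \<Omega>)"
    by (rule nn_integral_mono_AE) (use le in eventually_elim, rule ennreal_leI)
  also have "\<dots> = ennreal (LINT x|lebesgue_on \<Omega>. ?q x)" by (rule nn_integral_eq_integral[OF qi q0])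
  also have "\<dots> = (\<integral>\<^sup>+x. F x (u x) * ennreal (K (u x)) \<partial>lebesgue_on \<Omega>)"
    using id(1) by (simp only: id(2)) (simp add: less_top)
  finally show ?thesis .
qed

section \<open>Passing to the limit\<close>

lemma L2_norm_sq_Fatou:
  assumes "\<And>n. f n \<in> borel_measurable (lebesgue_on \<Omega>)"
    and "AE x in lebesgue_on \<Omega>. (\<lambda>n. f n x) \<longlonglongrightarrow> g x" and "\<And>n. L2_norm_sq \<Omega> (f n) \<le> c"
  shows "L2_norm_sq \<Omega> g \<le> c"
proof -
  have "L2_norm_sq \<Omega> g = (\<integral>\<^sup>+x. liminf (\<lambda>n. ennreal ((norm (f n x))\<^sup>2)) \<partial>lebesgue_on \<Omega>)"
    unfolding L2_norm_sq_def
  proof (rule nn_integral_cong_AE)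
    show "AE x in lebesgue_on \<Omega>. ennreal ((norm (g x))\<^sup>2) = liminf (\<lambda>n. ennreal ((norm (f n x))\<^sup>2))"
      using assms(2)
    proof eventually_elim
      case (elim x)
      have "(\<lambda>n. ennreal ((norm (f n x))\<^sup>2)) \<longlonglongrightarrow> ennreal ((norm (g x))\<^sup>2)"
        by (intro tendsto_ennrealI tendsto_intros elim)
      then show ?case by (intro lim_imp_Liminf[symmetric]) auto
    qed
  qed
  also have "\<dots> \<le> liminf (\<lambda>n. L2_norm_sq \<Omega> (f n))"
    unfolding L2_norm_sq_def using assms(1) by (intro nn_integral_liminf) simp
  also have "\<dots> \<le> liminf (\<lambda>n::nat. c)" by (rule Liminf_mono) (simp add: assms(3))
  also have "\<dots> = c" by (rule Liminf_const) simp
  finally show ?thesis .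
qed

lemma L2_dist_sq_dominated_convergence:
  assumes f: "\<And>n. f n \<in> borel_measurable (lebesgue_on \<Omega>)" and g: "g \<in> borel_measurable (lebesgue_on \<Omega>)"
    and lim: "AE x in lebesgue_on \<Omega>. (\<lambda>n. f n x) \<longlonglongrightarrow> g x"
    and dom: "AE x in lebesgue_on \<Omega>. \<forall>n. norm (f n x) \<le> norm (g x)" and fin: "L2_norm_sq \<Omega> g < \<infinity>"
  shows "(\<lambda>n. L2_dist_sq \<Omega> g (f n)) \<longlonglongrightarrow> 0"
proof -
  have fin4: "(\<integral>\<^sup>+x. ennreal (4 * (norm (g x))\<^sup>2) \<partial>lebesgue_on \<Omega>) < \<infinity>"
  proof -
    have "(\<integral>\<^sup>+x. ennreal (4 * (norm (g x))\<^sup>2) \<partial>lebesgue_on \<Omega>) = ennreal 4 * L2_norm_sq \<Omega> g"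
      unfolding L2_norm_sq_def using g by (simp add: ennreal_mult nn_integral_cmult del: ennreal_numeral)
    then show ?thesis using fin by (simp add: ennreal_mult_less_top)
  qed
  have "(\<lambda>n. \<integral>\<^sup>+x. ennreal ((norm (g x - f n x))\<^sup>2) \<partial>lebesgue_on \<Omega>) \<longlonglongrightarrow> (\<integral>\<^sup>+x. 0 \<partial>lebesgue_on \<Omega>)"
  proof (rule nn_integral_dominated_convergence[OF _ _ _ _ fin4])
    show "AE x in lebesgue_on \<Omega>. ennreal ((norm (g x - f n x))\<^sup>2) \<le> ennreal (4 * (norm (g x))\<^sup>2)" for n
      using dom
    proof eventually_elim
      case (elim x)
      have "norm (g x - f n x) \<le> norm (g x) + norm (f n x)" by (rule norm_triangle_ineq4)
      also have "\<dots> \<le> 2 * norm (g x)" using elim[rule_format, of n] by simp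
      finally have "(norm (g x - f n x))\<^sup>2 \<le> (2 * norm (g x))\<^sup>2" by (rule power_mono) simp
      then show ?case by (intro ennreal_leI) (simp add: power_mult_distrib)
    qed
    show "AE x in lebesgue_on \<Omega>. (\<lambda>n. ennreal ((norm (g x - f n x))\<^sup>2)) \<longlonglongrightarrow> 0"
      using lim
    proof eventually_elim
      case (elim x)
      have "(\<lambda>n. (norm (g x - f n x))\<^sup>2) \<longlonglongrightarrow> (norm (g x - g x))\<^sup>2" by (intro tendsto_intros elim)
      from tendsto_ennrealI[OF this] show ?case by simp
    qed
  qed (use f g in auto)
  then show ?thesis by (simp add: L2_dist_sq_def)
qed

lemma measurable_AE_limit:
  fixes f :: "nat \<Rightarrow> 'a::euclidean_space \<Rightarrow> 'b::euclidean_space"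
  assumes \<Omega>: "\<Omega> \<in> sets lebesgue" and f: "\<And>n. f n \<in> borel_measurable (lebesgue_on \<Omega>)"
    and lim: "AE x in lebesgue_on \<Omega>. (\<lambda>n. f n x) \<longlonglongrightarrow> g x"
  shows "g \<in> borel_measurable (lebesgue_on \<Omega>)"
proof (rule AE_lebesgue_on_measurable_cong[OF \<Omega>])
  show "(\<lambda>x. lim (\<lambda>n. f n x)) \<in> borel_measurable (lebesgue_on \<Omega>)"
    using f by (rule borel_measurable_lim_metric)
  show "AE x in lebesgue_on \<Omega>. lim (\<lambda>n. f n x) = g x"
    using lim by eventually_elim (rule limI)
qed

text \<open>With \<open>n = j + 1\<close>, the cutoff is supported in \<open>[2/n, n + 1]\<close> and equal to one on \<open>[3/n, n]\<close>.  It vanishes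
  up to twice the level \<open>\<delta> = 1/n\<close>, as the energy estimate demands.\<close>
definition cutoff :: "nat \<Rightarrow> real \<Rightarrow> real" where
  "cutoff j s = max 0 (min 1 (real (Suc j) * s - 2)) * max 0 (min 1 (real (Suc j) + 1 - s))"

lemma cutoff_continuous: "continuous_on S (cutoff j)"
  unfolding cutoff_def by (intro continuous_intros)

lemma cutoff_nonneg: "0 \<le> cutoff j s"
  unfolding cutoff_def by (intro mult_nonneg_nonneg) auto

lemma cutoff_le_1: "cutoff j s \<le> 1"
  unfolding cutoff_def by (intro mult_le_one) auto

lemma cutoff_near_0: "s \<le> 2 * inverse (real (Suc j)) \<Longrightarrow> cutoff j s = 0"
proof -
  assume "s \<le> 2 * inverse (real (Suc j))"
  then have "real (Suc j) * s \<le> real (Suc j) * (2 * inverse (real (Suc j)))" by (intro mult_left_mono) auto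
  also have "\<dots> = 2" by simp
  finally show ?thesis by (simp add: cutoff_def)
qed

lemma cutoff_large: "real (Suc j) + 1 \<le> s \<Longrightarrow> cutoff j s = 0"
  by (simp add: cutoff_def)

lemma cutoff_eventually_1:
  assumes "s > 0" shows "\<forall>\<^sub>F j in sequentially. cutoff j s = 1"
proof -
  obtain N :: nat where N: "3 / s < real N" "s < real N"
    using reals_Archimedean2[of "max (3 / s) s"] by auto
  have "cutoff j s = 1" if "N \<le> j" for j
  proof -
    have j: "3 / s \<le> real (Suc j)" "s \<le> real (Suc j)" using N that by linarith+
    from j(1) have "3 \<le> real (Suc j) * s" using assms by (simp add: field_simps del: of_nat_Suc)
    then show ?thesis using j(2) by (simp add: cutoff_def del: of_nat_Suc)
  qed
  then show ?thesis unfolding eventually_sequentially by blast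
qed

lemma antiderivative_nonneg:
  fixes K :: "real \<Rightarrow> real"
  assumes "\<And>t. DERIV K t :> \<kappa> t" "\<And>t. 0 \<le> \<kappa> t" "\<And>t. t \<le> a \<Longrightarrow> K t = 0"
  shows "0 \<le> K t"
proof (cases "t \<le> a")
  case False
  have "K a \<le> K t"
  proof (rule DERIV_nonneg_imp_nondecreasing[where f = K])
    show "\<exists>y. DERIV K x :> y \<and> 0 \<le> y" for x using assms(1)[of x] assms(2)[of x] by blast
  qed (use False in simp)
  then show ?thesis using assms(3)[of a] by simp
qed (simp add: assms(3))

lemma DERIV_at_of_within_nonneg:
  fixes \<Gamma> :: "real \<Rightarrow> real"
  assumes "\<forall>s\<ge>0. (\<Gamma> has_real_derivative \<Gamma>' s) (at s within {0..})" "s > 0"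
  shows "DERIV \<Gamma> s :> \<Gamma>' s"
proof -
  have "(\<Gamma> has_real_derivative \<Gamma>' s) (at s within {0<..})"
    by (rule has_field_derivative_subset[of _ _ _ "{0..}"]) (use assms in auto)
  then show ?thesis using at_within_open[of s "{0<..}"] assms(2) by simp
qed

lemma continuous_of_one_sided_derivative:
  fixes \<Gamma> :: "real \<Rightarrow> real"
  assumes "\<forall>s\<ge>0. (\<Gamma> has_real_derivative \<Gamma>' s) (at s within {0..})"
  shows "continuous_on {0..s} \<Gamma>"
proof (rule continuous_on_subset)
  show "continuous_on {0..} \<Gamma>"
    by (rule DERIV_continuous_on[where D = \<Gamma>']) (use assms in auto)
qed auto

lemma pos_of_one_sided_derivative:
  fixes \<Gamma> :: "real \<Rightarrow> real"
  assumes d: "\<forall>s\<ge>0. (\<Gamma> has_real_derivative \<Gamma>' s) (at s within {0..})" and "\<Gamma> 0 = 0"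
    and pos: "\<forall>s>0. \<Gamma>' s > 0" and s: "s > 0"
  shows "0 < \<Gamma> s"
proof -
  have "\<Gamma> 0 < \<Gamma> s"
  proof (rule DERIV_pos_imp_increasing_open[OF s])
    show "\<exists>y. DERIV \<Gamma> x :> y \<and> 0 < y" if "0 < x" "x < s" for x
      using DERIV_at_of_within_nonneg[OF d that(1)] pos that by blast
  qed (rule continuous_of_one_sided_derivative[OF d])
  then show ?thesis using assms(2) by simp
qed

lemma antiderivative_le_of_one_sided_derivative:
  fixes \<Gamma> K :: "real \<Rightarrow> real"
  assumes d: "\<forall>s\<ge>0. (\<Gamma> has_real_derivative \<Gamma>' s) (at s within {0..})" and "\<Gamma> 0 = 0"
    and K: "\<And>t. DERIV K t :> \<kappa> t" "K 0 = 0" "\<And>t. 0 < t \<Longrightarrow> \<kappa> t \<le> \<Gamma>' t" and s: "0 \<le> s"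
  shows "K s \<le> \<Gamma> s"
proof -
  have "(\<lambda>t. \<Gamma> t - K t) 0 \<le> (\<lambda>t. \<Gamma> t - K t) s"
  proof (rule DERIV_nonneg_imp_increasing_open[OF s])
    show "\<exists>y. DERIV (\<lambda>t. \<Gamma> t - K t) x :> y \<and> 0 \<le> y" if "0 < x" "x < s" for x
      using DERIV_diff[OF DERIV_at_of_within_nonneg[OF d that(1)] K(1)[of x]] K(3)[OF that(1)]
      by (intro exI[of _ "\<Gamma>' x - \<kappa> x"]) simp
    have "continuous_on {0..s} K" using K(1) DERIV_isCont continuous_at_imp_continuous_on by blast
    then show "continuous_on {0..s} (\<lambda>t. \<Gamma> t - K t)"
      by (intro continuous_on_diff continuous_of_one_sided_derivative[OF d])
  qed
  then show ?thesis using assms(2) K(2) by simp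
qed

lemma limit_nonneg_at_0:
  fixes f :: "real \<Rightarrow> real"
  assumes "continuous_on {0..} f" "\<forall>s>0. f s > 0"
  shows "0 \<le> f 0"
proof -
  have "(\<lambda>n. f (inverse (real (Suc n)))) \<longlonglongrightarrow> f 0"
    by (rule continuous_on_tendsto_compose[OF assms(1) LIMSEQ_inverse_real_of_nat]) auto
  then show ?thesis
    by (rule LIMSEQ_le_const) (use assms(2) in \<open>auto intro!: exI[of _ 0] less_imp_le simp del: of_nat_Suc\<close>)
qed

lemma cutoff_integral_le:
  fixes \<sigma> b \<beta> :: "real \<Rightarrow> real"
  assumes \<sigma>: "continuous_on {0..} \<sigma>" "\<And>t. 0 \<le> t \<Longrightarrow> 0 \<le> \<sigma> t"
    and b: "\<And>t. DERIV b t :> \<sigma> (max 0 t) * cutoff j t" "b 0 = 0"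
    and s: "0 \<le> s"
  shows "b s \<le> integral {0..s} \<sigma>" "((\<lambda>t. \<sigma> t * cutoff j t) has_integral b s) {0..s}"
proof -
  have "((\<lambda>t. \<sigma> (max 0 t) * cutoff j t) has_integral b s - b 0) {0..s}"
  proof (rule fundamental_theorem_of_calculus[OF s])
    show "(b has_vector_derivative \<sigma> (max 0 t) * cutoff j t) (at t within {0..s})" for t
      using has_field_derivative_at_within[OF b(1)]
      unfolding has_real_derivative_iff_has_vector_derivative .
  qed
  then show hi: "((\<lambda>t. \<sigma> t * cutoff j t) has_integral b s) {0..s}"
    using b(2) by (subst has_integral_cong[where g = "\<lambda>t. \<sigma> (max 0 t) * cutoff j t"]) (auto simp: max_def)
  have \<sigma>i: "\<sigma> integrable_on {0..s}"
    by (intro integrable_continuous_real continuous_on_subset[OF \<sigma>(1)]) auto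
  show "b s \<le> integral {0..s} \<sigma>"
  proof (rule has_integral_le[OF hi integrable_integral[OF \<sigma>i]])
    show "\<sigma> t * cutoff j t \<le> \<sigma> t" if "t \<in> {0..s}" for t
      using \<sigma>(2)[of t] cutoff_le_1[of j t] that by (intro mult_left_le) auto
  qed
qed

text \<open>Dominated convergence on \<open>[0,s]\<close>; all cutoffs vanish at \<open>0\<close>, where the limit is changed on a null
  set.\<close>
lemma cutoff_integral_tendsto:
  fixes \<sigma> :: "real \<Rightarrow> real" and b :: "nat \<Rightarrow> real \<Rightarrow> real"
  assumes \<sigma>: "continuous_on {0..} \<sigma>" "\<And>t. 0 \<le> t \<Longrightarrow> 0 \<le> \<sigma> t"
    and b: "\<And>j t. DERIV (b j) t :> \<sigma> (max 0 t) * cutoff j t" "\<And>j. b j 0 = 0"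
    and s: "0 \<le> s"
  shows "(\<lambda>j. b j s) \<longlonglongrightarrow> integral {0..s} \<sigma>"
proof -
  note hi = cutoff_integral_le(2)[OF \<sigma> b s]
  have \<sigma>i: "\<sigma> integrable_on {0..s}"
    by (intro integrable_continuous_real continuous_on_subset[OF \<sigma>(1)]) auto
  have "(\<lambda>j. integral {0..s} (\<lambda>t. \<sigma> t * cutoff j t)) \<longlonglongrightarrow> integral {0..s} (\<lambda>t. if t = 0 then 0 else \<sigma> t)"
  proof (rule dominated_convergence(2)[OF _ \<sigma>i])
    show "(\<lambda>t. \<sigma> t * cutoff j t) integrable_on {0..s}" for j using hi by blast
    show "norm (\<sigma> t * cutoff j t) \<le> \<sigma> t" if "t \<in> {0..s}" for j t
      using \<sigma>(2)[of t] cutoff_le_1[of j t] cutoff_nonneg[of j t] that by (simp add: abs_mult mult_left_le)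
    show "(\<lambda>j. \<sigma> t * cutoff j t) \<longlonglongrightarrow> (if t = 0 then 0 else \<sigma> t)" if "t \<in> {0..s}" for t
    proof (cases "t = 0")
      case True
      then show ?thesis by (simp add: cutoff_near_0)
    next
      case False
      then have "t > 0" using that by simp
      from cutoff_eventually_1[OF this] have "(\<lambda>j. \<sigma> t * cutoff j t) \<longlonglongrightarrow> \<sigma> t * 1"
        by (intro tendsto_intros tendsto_eventually)
      then show ?thesis using False by simp
    qed
  qed
  moreover have "integral {0..s} (\<lambda>t. if t = 0 then 0 else \<sigma> t) = integral {0..s} \<sigma>"
    by (rule integral_spike[of "{0}"]) auto
  moreover have "integral {0..s} (\<lambda>t. \<sigma> t * cutoff j t) = b j s" for j using hi by blast
  ultimately show ?thesis by simp
qed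

text \<open>\<open>\<bar>h\<bar> \<le> 1 + \<bar>h\<bar>\<^sup>r\<close>, and constants are integrable on a bounded set.\<close>
lemma Lp_bounded_domain_integrable:
  fixes h :: "'a::euclidean_space \<Rightarrow> real"
  assumes \<Omega>: "\<Omega> \<in> sets lebesgue" "bounded \<Omega>" and h: "h \<in> Lp r \<Omega>" and r: "1 \<le> r"
  shows "integrable (lebesgue_on \<Omega>) h"
proof (rule Bochner_Integration.integrable_bound)
  have "\<Omega> \<in> lmeasurable" using \<Omega> by (simp add: bounded_set_imp_lmeasurable)
  then have "emeasure (lebesgue_on \<Omega>) (space (lebesgue_on \<Omega>)) < \<infinity>"
    using \<Omega> by (simp add: emeasure_restrict_space fmeasurable_def space_restrict_space)
  then have "finite_measure (lebesgue_on \<Omega>)" by (intro finite_measureI) auto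
  then have "integrable (lebesgue_on \<Omega>) (\<lambda>x. 1::real)" by (rule finite_measure.integrable_const)
  then show "integrable (lebesgue_on \<Omega>) (\<lambda>x. 1 + norm (h x) powr r)" using h by (simp add: Lp_def)
  show "h \<in> borel_measurable (lebesgue_on \<Omega>)" using h by (simp add: Lp_def)
  show "AE x in lebesgue_on \<Omega>. norm (h x) \<le> norm (1 + norm (h x) powr r)"
  proof (intro always_eventually allI)
    fix x
    have "norm (h x) \<le> 1 + norm (h x) powr r"
    proof (cases "norm (h x) \<le> 1")
      case False
      then have "norm (h x) powr 1 \<le> norm (h x) powr r" using r by (intro powr_mono) auto
      then show ?thesis using False by simp
    qed (simp add: add_increasing2)
    then show "norm (h x) \<le> norm (1 + norm (h x) powr r)" by simp
  qed
qed

theorem proposition5p13: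
  fixes \<Omega> :: "(real^'n) set" and A :: "real^'n \<Rightarrow> real^'n^'n" and \<alpha> :: real
    and F :: "real^'n \<Rightarrow> real \<Rightarrow> ennreal" and h :: "real^'n \<Rightarrow> real" and r :: real
    and \<Gamma> \<Gamma>' \<beta> :: "real \<Rightarrow> real" and u :: "real^'n \<Rightarrow> real"
  assumes "bounded \<Omega>" and "open \<Omega>"
    and "\<forall>i j. (\<lambda>x. A x $ i $ j) \<in> Linf \<Omega>"
    and "\<alpha> > 0"
    and "AE x in lebesgue_on \<Omega>. \<forall>\<xi>. (A x *v \<xi>) \<bullet> \<xi> \<ge> \<alpha> * (norm \<xi>)\<^sup>2"
    and "\<forall>s\<ge>0. (\<lambda>x. F x s) \<in> borel_measurable (lebesgue_on \<Omega>)"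
    and "AE x in lebesgue_on \<Omega>. continuous_on {0..} (F x)"
    and "AE x in lebesgue_on \<Omega>. 0 \<le> h x"
    and "CARD('n) \<ge> 3 \<Longrightarrow> r = 2 * real CARD('n) / (real CARD('n) + 2)"
    and "CARD('n) = 2 \<Longrightarrow> r > 1"
    and "CARD('n) = 1 \<Longrightarrow> r = 1"
    and "h \<in> Lp r \<Omega>"
    and "\<forall>s\<ge>0. \<Gamma> s \<ge> 0"
    and "\<forall>s\<ge>0. (\<Gamma> has_real_derivative \<Gamma>' s) (at s within {0..})"
    and "continuous_on {0..} \<Gamma>'"
    and "\<Gamma> 0 = 0"
    and "\<forall>s>0. \<Gamma>' s > 0"
    and "AE x in lebesgue_on \<Omega>. \<forall>s>0. F x s \<le> ennreal (h x / \<Gamma> s)"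
    and "\<forall>s\<ge>0. \<beta> s = integral {0..s} (\<lambda>t. sqrt (\<Gamma>' t))"
    and "is_solution \<Omega> A F u"
  shows "(\<lambda>x. \<beta> (u x)) \<in> H10 \<Omega> \<and>
    \<alpha> * (Lp_norm 2 \<Omega> (grad \<Omega> (\<lambda>x. \<beta> (u x))))\<^sup>2 \<le> Lp_norm 1 \<Omega> h"
proof -
  note bd = assms(1) and \<Omega> = assms(2) and A = assms(3) and \<alpha> = assms(4) and ell = assms(5)
    and h0 = assms(8) and hr = assms(12) and d\<Gamma> = assms(14) and \<Gamma>'c = assms(15) and \<Gamma>0 = assms(16)
    and \<Gamma>'pos = assms(17) and Fle = assms(18) and \<beta> = assms(19) and sol = assms(20)
  have \<Omega>s: "\<Omega> \<in> sets lebesgue" using \<Omega> by (simp add: lebesgue_openin)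
  have u0: "AE x in lebesgue_on \<Omega>. 0 \<le> u x" using sol by (simp add: is_solution_def)
  have r1: "1 \<le> r"
  proof -
    consider "CARD('n) = 1" | "CARD('n) = 2" | "CARD('n) \<ge> 3"
      using zero_less_card_finite[where 'a = 'n] by linarith
    then show ?thesis
    proof cases
      case 3
      then have "1 \<le> 2 * real CARD('n) / (real CARD('n) + 2)" by (simp add: le_divide_eq)
      then show ?thesis using assms(9)[OF 3] by simp
    qed (use assms(10,11) in simp_all)
  qed
  have hi: "integrable (lebesgue_on \<Omega>) h" by (rule Lp_bounded_domain_integrable[OF \<Omega>s bd hr r1])
  define H where "H = (\<integral>\<^sup>+x. ennreal (h x) \<partial>lebesgue_on \<Omega>)"
  have H: "H = ennreal (LINT x|lebesgue_on \<Omega>. h x)"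
    unfolding H_def by (rule nn_integral_eq_integral[OF hi h0])

  \<comment> \<open>\<open>\<sigma>\<close> is the derivative of \<open>\<beta>\<close>, and \<open>\<rho> j\<close> is its cut-off version, extended by zero to the negative axis.\<close>
  define \<sigma> where "\<sigma> = (\<lambda>t. sqrt (\<Gamma>' t))"
  have \<Gamma>'0: "0 \<le> \<Gamma>' t" if "0 \<le> t" for t
    using limit_nonneg_at_0[OF \<Gamma>'c \<Gamma>'pos] \<Gamma>'pos that by (cases "t = 0") (auto intro: less_imp_le)
  have \<sigma>c: "continuous_on {0..} \<sigma>" unfolding \<sigma>_def by (intro continuous_intros \<Gamma>'c)
  have \<sigma>0: "0 \<le> \<sigma> t" if "0 \<le> t" for t using \<Gamma>'0[OF that] by (simp add: \<sigma>_def)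
  have \<sigma>pos: "0 < \<sigma> t" if "0 < t" for t using \<Gamma>'pos that by (simp add: \<sigma>_def)
  have \<sigma>2: "(\<sigma> t)\<^sup>2 = \<Gamma>' t" if "0 \<le> t" for t using \<Gamma>'0[OF that] by (simp add: \<sigma>_def)

  define \<delta> where "\<delta> = (\<lambda>j. inverse (real (Suc j)))"
  have \<delta>: "\<delta> j > 0" for j by (simp add: \<delta>_def)
  define \<rho> where "\<rho> = (\<lambda>j t. \<sigma> (max 0 t) * cutoff j t)"
  have \<rho>c: "continuous_on UNIV (\<rho> j)" for j
    unfolding \<rho>_def
    by (intro continuous_on_mult cutoff_continuous continuous_on_compose2[OF \<sigma>c])
      (auto intro!: continuous_intros)
  have \<rho>0: "0 \<le> \<rho> j t" for j t unfolding \<rho>_def by (intro mult_nonneg_nonneg \<sigma>0 cutoff_nonneg) simp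
  have \<rho>\<sigma>: "\<rho> j t \<le> \<sigma> t" if "0 \<le> t" for j t
    unfolding \<rho>_def using that \<sigma>0[OF that] cutoff_le_1[of j t] by (simp add: max_def mult_left_le)
  have \<rho>l: "\<rho> j t = 0" if "t \<le> 2 * \<delta> j" for j t using cutoff_near_0 that by (simp add: \<rho>_def \<delta>_def)
  have \<rho>r: "\<rho> j t = 0" if "real (Suc j) + 1 \<le> t" for j t using cutoff_large[OF that] by (simp add: \<rho>_def)
  have \<rho>_antiderivative: "\<exists>K. (\<forall>t. DERIV K t :> \<rho> j t) \<and> (\<forall>t\<le>2 * \<delta> j. K t = 0)"
    and \<rho>_bounded: "\<exists>B. \<forall>t. \<bar>\<rho> j t\<bar> \<le> B" for j
  proof -
    obtain K B where "\<And>t. DERIV K t :> \<rho> j t" "\<And>t. t \<le> 2 * \<delta> j \<Longrightarrow> K t = 0"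
        "\<And>t. \<bar>K t\<bar> \<le> B" "\<And>t. \<bar>\<rho> j t\<bar> \<le> B"
      by (rule antiderivative_compact_support[of "\<rho> j" "2 * \<delta> j" "real (Suc j) + 1", OF \<rho>c \<rho>l \<rho>r])
        (assumption+, rule that)
    then show "\<exists>K. (\<forall>t. DERIV K t :> \<rho> j t) \<and> (\<forall>t\<le>2 * \<delta> j. K t = 0)" "\<exists>B. \<forall>t. \<bar>\<rho> j t\<bar> \<le> B"
      by blast+
  qed
  have "\<forall>j. \<exists>K. (\<forall>t. DERIV K t :> \<rho> j t) \<and> (\<forall>t\<le>2 * \<delta> j. K t = 0)" using \<rho>_antiderivative ..
  from choice[OF this] obtain b where
    b: "\<And>j t. DERIV (b j) t :> \<rho> j t" "\<And>j t. t \<le> 2 * \<delta> j \<Longrightarrow> b j t = 0" by blast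
  define g where "g = (\<lambda>j. grad \<Omega> (\<lambda>x. excess (\<delta> j) (u x)))"
  have pw: "H10_pair \<Omega> (\<lambda>x. excess (\<delta> j) (u x)) (g j)" for j
    unfolding g_def using sol \<delta>[of j] by (intro H10_imp_H10_pair[OF \<Omega>]) (simp add: is_solution_def)
  have pb: "H10_pair \<Omega> (\<lambda>x. b i (u x)) (\<lambda>x. \<rho> i (u x) *\<^sub>R g j x)" if "i \<le> j" for i j
  proof -
    obtain B where B: "\<And>t. \<bar>\<rho> i t\<bar> \<le> B" using \<rho>_bounded[of i] by blast
    have "\<delta> j \<le> \<delta> i" unfolding \<delta>_def using that by (intro le_imp_inverse_le) auto
    then have "\<delta> j \<le> 2 * \<delta> i" using \<delta>[of i] by linarith
    then have z: "b i t = 0" "\<rho> i t = 0" if "t \<le> \<delta> j" for t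
      using that b(2)[of t i] \<rho>l[of t i] by auto
    show ?thesis by (rule H10_pair_chain_excess[OF \<Omega>s u0 \<delta> pw b(1) \<rho>c B z])
  qed
  \<comment> \<open>\<open>b i (u)\<close> is a function of both excesses, and its weak gradient is unique.\<close>
  have "AE x in lebesgue_on \<Omega>. \<rho> i (u x) *\<^sub>R g i x = \<rho> i (u x) *\<^sub>R g j x" if "i \<le> j" for i j
    by (rule weak_gradient_unique[OF \<Omega> H10_pair_weak_gradient[OF \<Omega>s pb] H10_pair_weak_gradient[OF \<Omega>s pb[OF that]]]) simp
  then have "AE x in lebesgue_on \<Omega>. i \<le> j \<longrightarrow> \<rho> i (u x) *\<^sub>R g i x = \<rho> i (u x) *\<^sub>R g j x" for i j
    by (cases "i \<le> j") auto
  then have cons: "AE x in lebesgue_on \<Omega>. \<forall>i j. i \<le> j \<longrightarrow> \<rho> i (u x) *\<^sub>R g i x = \<rho> i (u x) *\<^sub>R g j x"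
    by (simp add: AE_all_countable)

  \<comment> \<open>Here \<open>K\<close> is the bounded substitute for \<open>\<Gamma>\<close>: its derivative is \<open>(\<rho> j)\<^sup>2 \<le> \<Gamma>'\<close>, hence \<open>F(x,u) K(u) \<le> h\<close>.\<close>
  have est: "ennreal \<alpha> * L2_norm_sq \<Omega> (\<lambda>x. \<rho> j (u x) *\<^sub>R g j x) \<le> H" for j
  proof -
    have c2: "continuous_on UNIV (\<lambda>t. (\<rho> j t)\<^sup>2)" by (intro continuous_intros \<rho>c)
    have z: "(\<rho> j t)\<^sup>2 = 0" if "t \<le> 2 * \<delta> j" for t using \<rho>l[OF that] by simp
    have z': "(\<rho> j t)\<^sup>2 = 0" if "real (Suc j) + 1 \<le> t" for t using \<rho>r[OF that] by simp
    obtain K M where K: "\<And>t. DERIV K t :> (\<rho> j t)\<^sup>2" "\<And>t. t \<le> 2 * \<delta> j \<Longrightarrow> K t = 0" "\<And>t. \<bar>K t\<bar> \<le> M"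
        "\<And>t. \<bar>(\<rho> j t)\<^sup>2\<bar> \<le> M"
      by (rule antiderivative_compact_support[of _ "2 * \<delta> j" "real (Suc j) + 1", OF c2 z z'])
        (assumption+, rule that)
    have K0: "0 \<le> K t" for t by (rule antiderivative_nonneg[OF K(1) zero_le_power2 K(2)])
    have K\<Gamma>: "K t \<le> \<Gamma> t" if "0 \<le> t" for t
    proof (rule antiderivative_le_of_one_sided_derivative[OF d\<Gamma> \<Gamma>0 K(1) _ _ that])
      show "K 0 = 0" using K(2)[of 0] \<delta>[of j] by simp
      show "(\<rho> j t)\<^sup>2 \<le> \<Gamma>' t" if "0 < t" for t
        using power_mono[OF \<rho>\<sigma> \<rho>0, of t j 2] \<sigma>2[of t] that by simp
    qed
    have "ennreal \<alpha> * L2_norm_sq \<Omega> (\<lambda>x. \<rho> j (u x) *\<^sub>R g j x) = (\<integral>\<^sup>+x. ennreal (\<alpha> * ((\<rho> j (u x))\<^sup>2 * (norm (g j x))\<^sup>2)) \<partial>lebesgue_on \<Omega>)"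
    proof -
      have "ennreal (\<alpha> * ((\<rho> j (u x))\<^sup>2 * (norm (g j x))\<^sup>2)) = ennreal \<alpha> * ennreal ((norm (\<rho> j (u x) *\<^sub>R g j x))\<^sup>2)" for x
        using \<alpha> by (simp add: ennreal_mult[symmetric] power_mult_distrib)
      moreover have "(\<lambda>x. ennreal ((norm (\<rho> j (u x) *\<^sub>R g j x))\<^sup>2)) \<in> borel_measurable (lebesgue_on \<Omega>)"
        using H10_pair_measurable(2)[OF pb[of j j]] by measurable
      ultimately show ?thesis unfolding L2_norm_sq_def by (simp only: nn_integral_cmult)
    qed
    also have "\<dots> \<le> (\<integral>\<^sup>+x. F x (u x) * ennreal (K (u x)) \<partial>lebesgue_on \<Omega>)"
      unfolding g_def
      by (rule energy_estimate[OF \<Omega> A \<alpha> ell sol \<delta> K(1) c2 K(4) K(3) K(2) z K0]) auto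
    also have "\<dots> \<le> H"
      unfolding H_def
    proof (rule nn_integral_mono_AE)
      show "AE x in lebesgue_on \<Omega>. F x (u x) * ennreal (K (u x)) \<le> ennreal (h x)"
        using Fle h0 u0
      proof eventually_elim
        case (elim x)
        show ?case
        proof (cases "u x = 0")
          case True
          then show ?thesis using K(2)[of 0] \<delta>[of j] by simp
        next
          case False
          then have ux: "u x > 0" using elim by simp
          have \<Gamma>p: "0 < \<Gamma> (u x)" by (rule pos_of_one_sided_derivative[OF d\<Gamma> \<Gamma>0 \<Gamma>'pos ux])
          have "F x (u x) * ennreal (K (u x)) \<le> ennreal (h x / \<Gamma> (u x)) * ennreal (K (u x))"
            using elim ux by (intro mult_right_mono) auto
          also have "\<dots> = ennreal (h x / \<Gamma> (u x) * K (u x))"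
            using elim \<Gamma>p K0 by (intro ennreal_mult[symmetric]) auto
          also have "\<dots> \<le> ennreal (h x)"
          proof (rule ennreal_leI)
            have "h x / \<Gamma> (u x) * K (u x) \<le> h x / \<Gamma> (u x) * \<Gamma> (u x)"
              using elim \<Gamma>p K\<Gamma> by (intro mult_left_mono) auto
            then show "h x / \<Gamma> (u x) * K (u x) \<le> h x" using \<Gamma>p by simp
          qed
          finally show ?thesis .
        qed
      qed
    qed
    finally show ?thesis .
  qed

  define f where "f = (\<lambda>j x. \<rho> j (u x) *\<^sub>R g j x)"
  have fm: "f j \<in> borel_measurable (lebesgue_on \<Omega>)" for j
    unfolding f_def by (rule H10_pair_measurable(2)[OF pb]) simp
  have bm: "(\<lambda>x. b j (u x)) \<in> borel_measurable (lebesgue_on \<Omega>)" for j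
    by (rule H10_pair_measurable(1)[OF pb[OF order_refl]])
  define G where "G = (\<lambda>x. lim (\<lambda>j. f j x))"
  \<comment> \<open>Where \<open>u > 0\<close> the cutoff is eventually one and the gradients \<open>g j\<close> no longer depend on \<open>j\<close>, so
    \<open>f j\<close> is eventually equal to \<open>G\<close>; it never exceeds \<open>G\<close> in norm.\<close>
  have stab: "AE x in lebesgue_on \<Omega>. (\<lambda>j. f j x) \<longlonglongrightarrow> G x \<and> (\<forall>j. norm (f j x) \<le> norm (G x))"
    using u0 cons
  proof eventually_elim
    case (elim x)
    show ?case
    proof (cases "u x = 0")
      case True
      have "\<rho> j 0 = 0" for j using \<rho>l[of 0 j] \<delta>[of j] by simp
      then have "f j x = 0" for j using True by (simp add: f_def)
      then show ?thesis by (simp add: G_def)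
    next
      case False
      then have ux: "u x > 0" using elim by simp
      obtain i where i: "\<And>j. i \<le> j \<Longrightarrow> cutoff j (u x) = 1"
        using cutoff_eventually_1[OF ux] unfolding eventually_sequentially by blast
      have \<rho>1: "\<rho> j (u x) = \<sigma> (u x)" if "i \<le> j" for j using i[OF that] ux by (simp add: \<rho>_def)
      have gi: "g j x = g i x" if "i \<le> j" for j
      proof -
        have "\<rho> i (u x) *\<^sub>R g i x = \<rho> i (u x) *\<^sub>R g j x" using elim that by blast
        then show ?thesis using \<rho>1[of i] \<sigma>pos[OF ux] by simp
      qed
      have fj: "f j x = \<sigma> (u x) *\<^sub>R g i x" if "i \<le> j" for j
        unfolding f_def \<rho>1[OF that] gi[OF that] by (rule refl)
      then have "\<forall>\<^sub>F j in sequentially. f j x = \<sigma> (u x) *\<^sub>R g i x"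
        unfolding eventually_sequentially by blast
      then have lim: "(\<lambda>j. f j x) \<longlonglongrightarrow> \<sigma> (u x) *\<^sub>R g i x" by (rule tendsto_eventually)
      then have G: "G x = \<sigma> (u x) *\<^sub>R g i x" unfolding G_def by (rule limI)
      have "norm (f j x) \<le> norm (G x)" for j
      proof (cases "i \<le> j")
        case True
        then show ?thesis using fj G by simp
      next
        case False
        then have "f j x = \<rho> j (u x) *\<^sub>R g i x" using elim unfolding f_def by (meson nat_le_linear)
        then have "norm (f j x) = \<rho> j (u x) * norm (g i x)" using \<rho>0[of j "u x"] by simp
        also have "\<dots> \<le> \<sigma> (u x) * norm (g i x)" using \<rho>\<sigma>[of "u x" j] ux by (intro mult_right_mono) auto
        also have "\<dots> = norm (G x)" using \<sigma>0[of "u x"] ux G by simp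
        finally show ?thesis .
      qed
      then show ?thesis using lim G by simp
    qed
  qed
  then have limG: "AE x in lebesgue_on \<Omega>. (\<lambda>j. f j x) \<longlonglongrightarrow> G x"
    and domG: "AE x in lebesgue_on \<Omega>. \<forall>j. norm (f j x) \<le> norm (G x)"
    by (auto elim: eventually_mono)
  have Gm: "G \<in> borel_measurable (lebesgue_on \<Omega>)" by (rule measurable_AE_limit[OF \<Omega>s fm limG])
  have estG: "L2_norm_sq \<Omega> (f j) \<le> H / ennreal \<alpha>" for j
  proof -
    have "L2_norm_sq \<Omega> (f j) = (L2_norm_sq \<Omega> (f j) * ennreal \<alpha>) / ennreal \<alpha>"
      using \<alpha> by (intro mult_divide_eq_ennreal[symmetric]) auto
    also have "\<dots> \<le> H / ennreal \<alpha>"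
      using est[of j] unfolding f_def by (intro divide_right_mono_ennreal) (simp add: mult.commute)
    finally show ?thesis .
  qed
  have sG: "L2_norm_sq \<Omega> G \<le> H / ennreal \<alpha>" by (rule L2_norm_sq_Fatou[OF fm limG estG])
  have Hfin: "H / ennreal \<alpha> < \<infinity>" unfolding H using \<alpha> h0 by (subst divide_ennreal) (auto intro: integral_nonneg_AE)
  have sGfin: "L2_norm_sq \<Omega> G < \<infinity>" using sG Hfin by (rule order.strict_trans1)

  have b\<beta>: "(\<lambda>j. b j s) \<longlonglongrightarrow> \<beta> s" "\<And>j. b j s \<le> \<beta> s" "\<And>j. 0 \<le> b j s" if "0 \<le> s" for s
  proof -
    have b0: "b j 0 = 0" for j using b(2)[of 0 j] \<delta>[of j] by simp
    have \<beta>s: "\<beta> s = integral {0..s} \<sigma>" using \<beta> that by (simp add: \<sigma>_def)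
    show "(\<lambda>j. b j s) \<longlonglongrightarrow> \<beta> s"
      unfolding \<beta>s by (rule cutoff_integral_tendsto[OF \<sigma>c \<sigma>0 b(1)[unfolded \<rho>_def] b0 that])
    show "b j s \<le> \<beta> s" for j
      unfolding \<beta>s by (rule cutoff_integral_le(1)[OF \<sigma>c \<sigma>0 b(1)[unfolded \<rho>_def] b0 that])
    show "0 \<le> b j s" for j by (rule antiderivative_nonneg[OF b(1) \<rho>0 b(2)])
  qed
  have lim\<beta>: "AE x in lebesgue_on \<Omega>. (\<lambda>j. b j (u x)) \<longlonglongrightarrow> \<beta> (u x)"
    using u0 by eventually_elim (rule b\<beta>(1))
  have dom\<beta>: "AE x in lebesgue_on \<Omega>. \<forall>j. norm (b j (u x)) \<le> norm (\<beta> (u x))"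
    using u0
  proof eventually_elim
    case (elim x)
    show ?case
    proof
      fix j show "norm (b j (u x)) \<le> norm (\<beta> (u x))" using b\<beta>(2,3)[OF elim, of j] by simp
    qed
  qed
  have \<beta>m: "(\<lambda>x. \<beta> (u x)) \<in> borel_measurable (lebesgue_on \<Omega>)" by (rule measurable_AE_limit[OF \<Omega>s bm lim\<beta>])
  obtain C where C: "C > 0" "\<And>w g. H10_pair \<Omega> w g \<Longrightarrow> L2_norm_sq \<Omega> w \<le> ennreal C * L2_norm_sq \<Omega> g"
    using Poincare[OF \<Omega>s bd] by blast
  \<comment> \<open>The square integrability of \<open>\<beta>(u)\<close> comes from the gradient bound through the Poincare inequality.\<close>
  have "L2_norm_sq \<Omega> (\<lambda>x. b j (u x)) \<le> ennreal C * (H / ennreal \<alpha>)" for j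
  proof -
    have "L2_norm_sq \<Omega> (\<lambda>x. b j (u x)) \<le> ennreal C * L2_norm_sq \<Omega> (f j)"
      unfolding f_def by (rule C(2)[OF pb]) simp
    also have "\<dots> \<le> ennreal C * (H / ennreal \<alpha>)" by (intro mult_left_mono estG) simp
    finally show ?thesis .
  qed
  then have "L2_norm_sq \<Omega> (\<lambda>x. \<beta> (u x)) \<le> ennreal C * (H / ennreal \<alpha>)"
    by (rule L2_norm_sq_Fatou[OF bm lim\<beta>])
  also have "\<dots> < \<infinity>" using Hfin by (simp add: ennreal_mult_less_top)
  finally have s\<beta>fin: "L2_norm_sq \<Omega> (\<lambda>x. \<beta> (u x)) < \<infinity>" .
  note conv = L2_dist_sq_dominated_convergence[OF bm \<beta>m lim\<beta> dom\<beta> s\<beta>fin] L2_dist_sq_dominated_convergence[OF fm Gm limG domG sGfin]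
  have p\<beta>: "H10_pair \<Omega> (\<lambda>x. \<beta> (u x)) G"
  proof (rule H10_pair_closed[OF \<Omega>s \<beta>m Gm])
    fix \<epsilon> :: real assume "\<epsilon> > 0"
    then have "0 < ennreal \<epsilon>" by simp
    from order_tendstoD(2)[OF conv(1) this] order_tendstoD(2)[OF conv(2) this]
    have "\<forall>\<^sub>F j in sequentially. L2_dist_sq \<Omega> (\<lambda>x. \<beta> (u x)) (\<lambda>x. b j (u x)) < ennreal \<epsilon> \<and> L2_dist_sq \<Omega> G (f j) < ennreal \<epsilon>"
      by (rule eventually_conj)
    then obtain j where "L2_dist_sq \<Omega> (\<lambda>x. \<beta> (u x)) (\<lambda>x. b j (u x)) < ennreal \<epsilon>" "L2_dist_sq \<Omega> G (f j) < ennreal \<epsilon>"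
      using eventually_happens'[OF sequentially_bot] by blast
    moreover have "H10_pair \<Omega> (\<lambda>x. b j (u x)) (f j)" unfolding f_def by (rule pb) simp
    ultimately show "\<exists>w' g'. H10_pair \<Omega> w' g' \<and> L2_dist_sq \<Omega> (\<lambda>x. \<beta> (u x)) w' < ennreal \<epsilon> \<and> L2_dist_sq \<Omega> G g' < ennreal \<epsilon>"
      by blast
  qed
  have gG: "AE x in lebesgue_on \<Omega>. G x = grad \<Omega> (\<lambda>x. \<beta> (u x)) x"
    using H10_pair_grad[OF \<Omega> p\<beta>] by eventually_elim simp
  have gm: "grad \<Omega> (\<lambda>x. \<beta> (u x)) \<in> borel_measurable (lebesgue_on \<Omega>)"
    by (rule AE_lebesgue_on_measurable_cong[OF \<Omega>s Gm gG])
  have "L2_norm_sq \<Omega> (grad \<Omega> (\<lambda>x. \<beta> (u x))) = L2_norm_sq \<Omega> G"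
    unfolding L2_norm_sq_def by (rule nn_integral_cong_AE) (use gG in eventually_elim, simp)
  then have "(Lp_norm 2 \<Omega> (grad \<Omega> (\<lambda>x. \<beta> (u x))))\<^sup>2 = enn2real (L2_norm_sq \<Omega> G)"
    using Lp_norm_2[OF gm] by simp
  also have "\<dots> \<le> enn2real (H / ennreal \<alpha>)" by (rule enn2real_mono[OF sG]) (use Hfin in simp)
  also have "\<dots> = (LINT x|lebesgue_on \<Omega>. h x) / \<alpha>"
  proof -
    have "0 \<le> (LINT x|lebesgue_on \<Omega>. h x)" using h0 by (rule integral_nonneg_AE)
    then show ?thesis unfolding H using \<alpha> by (simp add: divide_ennreal)
  qed
  finally have "\<alpha> * (Lp_norm 2 \<Omega> (grad \<Omega> (\<lambda>x. \<beta> (u x))))\<^sup>2 \<le> (LINT x|lebesgue_on \<Omega>. h x)"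
    using \<alpha> by (simp add: field_simps)
  moreover have "Lp_norm 1 \<Omega> h = (LINT x|lebesgue_on \<Omega>. h x)"
  proof -
    have "(LINT x|lebesgue_on \<Omega>. norm (h x) powr 1) = (LINT x|lebesgue_on \<Omega>. h x)"
      by (rule LINT_lebesgue_on_cong_AE[OF \<Omega>s]) (use h0 in eventually_elim, simp)
    moreover have "0 \<le> (LINT x|lebesgue_on \<Omega>. h x)" using h0 by (rule integral_nonneg_AE)
    ultimately show ?thesis by (simp add: Lp_norm_def)
  qed
  ultimately show ?thesis using H10_pair_H10[OF \<Omega> p\<beta>] by simp
qed

end
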